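(* Assume (A1)-(A4) (see context) and that $\gamma$ is sufficiently large. Let $(u^+_{c1},u^+_{c2})$ be the open-loop Nash equilibrium of Level 2 given by $$u^+_{c1}=-R_{c1}^{-1}[S_{21}^\top\tilde x+\bar B_{c1}^\top\tilde y+\bar D_{c1}^\top\tilde z],\qquad u^+_{c2}=-R_{c2}^{-1}[S_{22}^\top\tilde x+\bar B_{c2}^\top\tilde Y+\bar D_{c2}^\top\tilde Z],$$ where the adapted square-integrable processes $(\tilde x,\tilde y,\tilde z,\tilde Y,\tilde Z)$ satisfy $$\begin{cases}d\tilde x=[\bar A\tilde x+\bar B_{c1}u^+_{c1}+\bar B_{c2}u^+_{c2}]dt+[\bar C\tilde x+\bar D_{c1}u^+_{c1}+\bar D_{c2}u^+_{c2}]dW,\\ d\tilde y=-[\bar A^\top\tilde y+\bar C^\top\tilde z+\bar Q_{21}\tilde x+S_{21}u^+_{c1}]dt+\tilde z\,dW,\\ d\tilde Y=-[\bar A^\top\tilde Y+\bar C^\top\tilde Z+\bar Q_{22}\tilde x+S_{22}u^+_{c2}]dt+\tilde Z\,dW,\\ \tilde x(0)=x_0,\quad\tilde y(T)=G_{21}\tilde x(T),\quad\tilde Y(T)=G_{22}\tilde x(T).\end{cases}$$ Suppose that the equation $$\begin{cases}\dot\Pi+\Pi\big(\bar A-\sum_{i=1}^2\bar B_{ci}R_{ci}^{-1}S_{2i}^\top\big)+\Pi\mathbb B_1\Pi+\mathbb A^\top\Pi+\mathbb Q\\ \quad+(\mathbb C^\top+\Pi\mathbb B_2)(I-\Pi\mathbb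 D_2)^{-1}\big(\Pi\bar C-\sum_{i=1}^2\Pi\bar D_{ci}R_{ci}^{-1}S_{2i}^\top+\Pi\mathbb D_1\Pi\big)=0,\\ \Pi(T)=\mathbb G\end{cases}$$ admits a solution $\Pi(\cdot)$ on $[0,T]$ such that $I-\Pi\mathbb D_2$ has bounded inverse. Put $\Sigma:=(I-\Pi\mathbb D_2)^{-1}\big(\Pi\bar C-\sum_{i=1}^2\Pi\bar D_{ci}R_{ci}^{-1}S_{2i}^\top+\Pi\mathbb D_1\Pi\big)$. Then $$u^+_{c1}(t)=-R_{c1}^{-1}\big[S_{21}^\top+(\bar B_{c1}^\top\ \ 0)\Pi+(\bar D_{c1}^\top\ \ 0)\Sigma\big]\tilde x(t),\qquad u^+_{c2}(t)=-R_{c2}^{-1}\big[S_{22}^\top+(0\ \ \bar B_{c2}^\top)\Pi+(0\ \ \bar D_{c2}^\top)\Sigma\big]\tilde x(t),$$ where $\tilde x$ satisfies $$\begin{cases}d\tilde x=\big[\bar A-\bar B_{c1}R_{c1}^{-1}S_{21}^\top-\bar B_{c2}R_{c2}^{-1}S_{22}^\top+\mathbb B_1\Pi+\mathbb B_2\Sigma\big]\tilde x\,dt+\big[\bar C-\bar D_{c1}R_{c1}^{-1}S_{21}^\top-\bar D_{c2}R_{c2}^{-1}S_{22}^\top+\mathbb D_1\Pi+\mathbb D_2\Sigma\big]\tilde x\,dW,\\ \tilde x(0)=x_0.\end{cases}$$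
   Context: Indices: $i\in\{1,2\}$, $j\in\{1,2,3\}$. Fix $T>0$ and a complete filtered probability space $(\Omega,\mathcal F,\mathbb F,\mathbb P)$ with a one-dimensional Brownian motion $W$, $\mathbb F$ its augmented natural filtration. $L^2_{\mathbb F}(0,T;\mathbb H)$ is the space of $\mathbb F$-progressively measurable $\phi$ with $\mathbb E\int_0^T|\phi|^2dt<\infty$. For symmetric matrix functions, $M\gg0$ means $M(t)\ge\delta I$ for some $\delta>0$. State equation: $$dx=\Big[Ax+\sum_iB_{1i}u_{1i}+\sum_{i,j}B_{2ij}u_{2ij}+\sum_{j,i}B_{3ji}u_{3ji}+Ev\Big]dt+\Big[Cx+\sum_iD_{1i}u_{1i}+\sum_{i,j}D_{2ij}u_{2ij}+\sum_{j,i}D_{3ji}u_{3ji}\Big]dW,\quad x(0)=x_0\in\mathbb R^n,$$ with deterministic bounded coefficients on $[0,T]$; $u_{1i}\in L^2_{\mathbb F}(0,T;\mathbb R^{m_{1i}})$ are controls of Level 1, $u_{2ij}\in L^2_{\mathbb F}(0,T;\mathbb R^{m_{2ij}})$ of player $i$ of Level 2, $u_{3ji}\in L^2_{\mathbb F}(0,T;\mathbb R^{m_{3ji}})$ of player $j$ of Level 3, $v\in L^2_{\mathbb F}(0,T;\mathbb R^{n_v})$ is the disturbance. Write $u_{ci}=\mathrm{col}[u_{2i1},u_{2i2},u_{2i3},u_{31i},u_{32i},u_{33i}]$. Costs (deterministic bounded symmetric weights): $J^1=\mathbb E\{\int_0^T[\langle Q_1x,x\rangle+\sum_i\langle R_iu_{1i},u_{1i}\rangle+\sum_{i,j}\langle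 R_{1ij}u_{2ij},u_{2ij}\rangle+\sum_{j,i}\langle\bar R_{1ji}u_{3ji},u_{3ji}\rangle]dt+\langle G_1x(T),x(T)\rangle\}$; $J^2_i=\mathbb E\{\int_0^T[\langle Q_{2i}x,x\rangle+\langle R_{2i}u_{1i},u_{1i}\rangle+\sum_j\langle R_{2ij}u_{2ij},u_{2ij}\rangle+\sum_j\langle\bar R_{2ji}u_{3ji},u_{3ji}\rangle]dt+\langle G_{2i}x(T),x(T)\rangle\}$. (A1) (relevant part) $Q_1,Q_{2i},G_1,G_{2i}\ge0$. (A2) (relevant part) $R_i,R_{1ij},\bar R_{1ji},R_{2i},R_{2ij},\bar R_{2ji}\gg0$. Let $\gamma>0$ be the disturbance attenuation level. $B_c=[B_{11},B_{12},B_{211},B_{212},B_{213},B_{221},B_{222},B_{223},B_{311},B_{312},B_{321},B_{322},B_{331},B_{332}]$, $D_c$ likewise from the $D$'s, $R_c=\mathrm{blockdiag}(R_1,R_2,R_{111},R_{112},R_{113},R_{121},R_{122},R_{123},\bar R_{111},\bar R_{112},\bar R_{121},\bar R_{122},\bar R_{131},\bar R_{132})$. $P$ denotes the solution (assumed to exist on $[0,T]$, with $I+PD_cR_c^{-1}D_c^\top$ having bounded inverse) of $$\dot P+PA+A^\top P-P(B_cR_c^{-1}B_c^\top-\gamma^{-2}EE^\top)P+Q_1+(C-D_cR_c^{-1}B_c^\top P)^\top(I+PD_cR_c^{-1}D_c^\top)^{-1}P(C-D_cR_c^{-1}B_c^\top P)=0,\ P(T)=G_1,$$ and $\Lambda:=(I+PD_cR_c^{-1}D_c^\top)^{-1}P(C-D_cR_c^{-1}B_c^\top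 P)$. Put $K_{1i}:=R_i^{-1}(B_{1i}^\top P+D_{1i}^\top\Lambda)$, $K_{2ij}:=R_{1ij}^{-1}(B_{2ij}^\top P+D_{2ij}^\top\Lambda)$, $K_{3ji}:=\bar R_{1ji}^{-1}(B_{3ji}^\top P+D_{3ji}^\top\Lambda)$. Level 2 game for given continuous $\eta_{1ij}(t)\in\mathbb R^{m_{1i}\times m_{2ij}}$, $\zeta_{1ij}(t)\in\mathbb R^{m_{1i}\times m_{3ji}}$. Set $\xi_{1ij}:=-\frac13K_{1i}+\eta_{1ij}K_{2ij}+\zeta_{1ij}K_{3ji}$. Level 1 announces $u_{1i}=\sum_j\xi_{1ij}x+\sum_j\eta_{1ij}u_{2ij}+\sum_j\zeta_{1ij}u_{3ji}$, and the disturbance is taken as $v=\gamma^{-2}E^\top Px$. Substituting these into the state equation and into $J^2_i$ gives $$dx=\Big[\bar Ax+\sum_i\bar B_{ci}u_{ci}\Big]dt+\Big[\bar Cx+\sum_i\bar D_{ci}u_{ci}\Big]dW,\quad x(0)=x_0,$$ $$\bar J^2_i(u_{c1},u_{c2};x_0)=\mathbb E\Big\{\int_0^T[\langle\bar Q_{2i}x,x\rangle+2\langle x,S_{2i}u_{ci}\rangle+\langle R_{ci}u_{ci},u_{ci}\rangle]dt+\langle G_{2i}x(T),x(T)\rangle\Big\},$$ where, with $N_i:=[\eta_{1i1},\eta_{1i2},\eta_{1i3},\zeta_{1i1},\zeta_{1i2},\zeta_{1i3}]$ and $\xi_i:=\sum_j\xi_{1ij}$: $\bar A=A+\gamma^{-2}EE^\top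 P+\sum_iB_{1i}\xi_i$, $\bar C=C+\sum_iD_{1i}\xi_i$, $\bar B_{ci}=[B_{2i1},B_{2i2},B_{2i3},B_{31i},B_{32i},B_{33i}]+B_{1i}N_i$, $\bar D_{ci}=[D_{2i1},D_{2i2},D_{2i3},D_{31i},D_{32i},D_{33i}]+D_{1i}N_i$, $\bar Q_{2i}=Q_{2i}+\xi_i^\top R_{2i}\xi_i$, $S_{2i}=\xi_i^\top R_{2i}N_i$, $R_{ci}=\mathrm{blockdiag}(R_{2i1},R_{2i2},R_{2i3},\bar R_{21i},\bar R_{22i},\bar R_{23i})+N_i^\top R_{2i}N_i$. A pair $(u^+_{c1},u^+_{c2})$ of square-integrable controls is an open-loop Nash equilibrium of Level 2 if $\bar J^2_1(u^+_{c1},u^+_{c2};x_0)\le\bar J^2_1(u_{c1},u^+_{c2};x_0)$ and $\bar J^2_2(u^+_{c1},u^+_{c2};x_0)\le\bar J^2_2(u^+_{c1},u_{c2};x_0)$ for all square-integrable adapted $u_{c1},u_{c2}$. (A3) $R_{ci}\gg0$. (A4) For each $i$ there is $\delta>0$ with $J_i'(g)\ge\delta\,\mathbb E\int_0^T|g|^2dt$ for all square-integrable adapted $g$, where $J_i'(g)=\mathbb E\{\int_0^T[\langle\bar Q_{2i}z,z\rangle+2\langle z,S_{2i}g\rangle+\langle R_{ci}g,g\rangle]dt+\langle G_{2i}z(T),z(T)\rangle\}$ and $dz=[\bar Az+\bar B_{ci}g]dt+[\bar Cz+\bar D_{ci}g]dW$, $z(0)=0$. Block matrices: $\mathbb B_1=(-\bar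 B_{c1}R_{c1}^{-1}\bar B_{c1}^\top,\,-\bar B_{c2}R_{c2}^{-1}\bar B_{c2}^\top)$, $\mathbb B_2=(-\bar B_{c1}R_{c1}^{-1}\bar D_{c1}^\top,\,-\bar B_{c2}R_{c2}^{-1}\bar D_{c2}^\top)$, $\mathbb D_1=(-\bar D_{c1}R_{c1}^{-1}\bar B_{c1}^\top,\,-\bar D_{c2}R_{c2}^{-1}\bar B_{c2}^\top)$, $\mathbb D_2=(-\bar D_{c1}R_{c1}^{-1}\bar D_{c1}^\top,\,-\bar D_{c2}R_{c2}^{-1}\bar D_{c2}^\top)$, $\mathbb A=\mathrm{blockdiag}_{i=1,2}(\bar A-\bar B_{ci}R_{ci}^{-1}S_{2i}^\top)$, $\mathbb C=\mathrm{blockdiag}_{i=1,2}(\bar C-\bar D_{ci}R_{ci}^{-1}S_{2i}^\top)$, $\mathbb Q=\mathrm{col}_{i=1,2}(\bar Q_{2i}-S_{2i}R_{ci}^{-1}S_{2i}^\top)$, $\mathbb G=\mathrm{col}(G_{21},G_{22})$. $\Pi$ takes values in $\mathbb R^{2n\times n}$. "$\gamma$ sufficiently large" means $\gamma\ge\gamma_0$ for some $\gamma_0>0$ depending only on the coefficients of the state equation and of $J^1$ and on $T$. *)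

theory Defs
  imports "HOL-Probability.Probability"
begin

section \<open>Matrix functions\<close>

definition hcat :: "real^'a^'n \<Rightarrow> real^'b^'n \<Rightarrow> real^('a+'b)^'n"  (infixr "\<parallel>\<^sub>h" 60) where
  "A \<parallel>\<^sub>h B = (\<chi> r s. case s of Inl k \<Rightarrow> A $ r $ k | Inr k \<Rightarrow> B $ r $ k)"

definition vcat :: "real^'n^'a \<Rightarrow> real^'n^'b \<Rightarrow> real^'n^('a+'b)"  (infixr "\<parallel>\<^sub>v" 60) where
  "A \<parallel>\<^sub>v B = (\<chi> r. case r of Inl k \<Rightarrow> A $ k | Inr k \<Rightarrow> B $ k)"

definition bdiag :: "real^'a^'m \<Rightarrow> real^'b^'n \<Rightarrow> real^('a+'b)^('m+'n)"  (infixr "\<oplus>\<^sub>d" 60) where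
  "A \<oplus>\<^sub>d B = (A \<parallel>\<^sub>h 0) \<parallel>\<^sub>v (0 \<parallel>\<^sub>h B)"

definition psd :: "real^'n^'n \<Rightarrow> bool" where
  "psd M \<longleftrightarrow> transpose M = M \<and> (\<forall>x. 0 \<le> (M *v x) \<bullet> x)"

definition psd_on :: "real \<Rightarrow> (real \<Rightarrow> real^'n^'n) \<Rightarrow> bool" where
  "psd_on T M \<longleftrightarrow> (\<forall>t\<in>{0..T}. psd (M t))"

text \<open>The relation \<open>M \<gg> 0\<close> for symmetric matrix functions on \<open>[0,T]\<close>.\<close>

definition unif_pos :: "real \<Rightarrow> (real \<Rightarrow> real^'n^'n) \<Rightarrow> bool" where
  "unif_pos T M \<longleftrightarrow> (\<forall>t\<in>{0..T}. transpose (M t) = M t) \<and>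
     (\<exists>\<delta>>0. \<forall>t\<in>{0..T}. psd (M t - \<delta> *\<^sub>R mat 1))"

definition bdd_coeff :: "real \<Rightarrow> (real \<Rightarrow> real^'m^'n) \<Rightarrow> bool" where
  "bdd_coeff T f \<longleftrightarrow> f \<in> borel_measurable (restrict_space borel {0..T}) \<and> bounded (f ` {0..T})"

definition bdd_inverse :: "real \<Rightarrow> (real \<Rightarrow> real^'n^'n) \<Rightarrow> bool" where
  "bdd_inverse T M \<longleftrightarrow> (\<forall>t\<in>{0..T}. invertible (M t)) \<and> bounded ((\<lambda>t. matrix_inv (M t)) ` {0..T})"

text \<open>\<open>X' + f = 0\<close> on \<open>[0,T]\<close>, \<open>X(T) = \<Gamma>\<close>. Since the coefficients are only bounded and measurable, a
  solution is an absolutely continuous one, i.e. the equation holds in integrated form.\<close>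

definition terminal_ode :: "real \<Rightarrow> real^'m^'n \<Rightarrow> (real \<Rightarrow> real^'m^'n) \<Rightarrow> (real \<Rightarrow> real^'m^'n) \<Rightarrow> bool" where
  "terminal_ode T \<Gamma> f X \<longleftrightarrow> continuous_on {0..T} X \<and> set_integrable lborel {0..T} f \<and>
     (\<forall>t\<in>{0..T}. X t = \<Gamma> + (LINT s:{t..T}|lborel. f s))"

section \<open>Brownian motion and the Ito integral\<close>

definition aug_filtration :: "'w measure \<Rightarrow> (real \<Rightarrow> 'w \<Rightarrow> real) \<Rightarrow> real \<Rightarrow> 'w measure" where
  "aug_filtration M W t = sigma (space M)
     ({W s -` A \<inter> space M | s A. s \<in> {0..t} \<and> A \<in> sets borel} \<union> null_sets M)"

definition brownian_motion :: "'w measure \<Rightarrow> real \<Rightarrow> (real \<Rightarrow> 'w \<Rightarrow> real) \<Rightarrow> bool" where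
  "brownian_motion M T W \<longleftrightarrow>
     (\<forall>t\<in>{0..T}. W t \<in> borel_measurable M) \<and>
     (AE \<omega> in M. W 0 \<omega> = 0) \<and>
     (AE \<omega> in M. continuous_on {0..T} (\<lambda>t. W t \<omega>)) \<and>
     (\<forall>s t. 0 \<le> s \<and> s < t \<and> t \<le> T \<longrightarrow>
        distributed M lborel (\<lambda>\<omega>. W t \<omega> - W s \<omega>) (normal_density 0 (sqrt (t - s))) \<and>
        prob_space.indep_set M (sets (aug_filtration M W s))
          {(\<lambda>\<omega>. W t \<omega> - W s \<omega>) -` A \<inter> space M | A. A \<in> sets borel})"

definition stochastic_basis :: "'w measure \<Rightarrow> real \<Rightarrow> (real \<Rightarrow> 'w \<Rightarrow> real) \<Rightarrow> bool" where
  "stochastic_basis M T W \<longleftrightarrow> prob_space M \<and> complete_measure M \<and> brownian_motion M T W"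

definition prog_measurable ::
    "'w measure \<Rightarrow> real \<Rightarrow> (real \<Rightarrow> 'w \<Rightarrow> real) \<Rightarrow> (real \<Rightarrow> 'w \<Rightarrow> 'e::euclidean_space) \<Rightarrow> bool" where
  "prog_measurable M T W \<phi> \<longleftrightarrow> (\<forall>t\<in>{0..T}.
     (\<lambda>(s, \<omega>). \<phi> s \<omega>) \<in> borel_measurable (restrict_space borel {0..t} \<Otimes>\<^sub>M aug_filtration M W t))"

definition L2F :: "'w measure \<Rightarrow> real \<Rightarrow> (real \<Rightarrow> 'w \<Rightarrow> real) \<Rightarrow> (real \<Rightarrow> 'w \<Rightarrow> 'e::euclidean_space) set" where
  "L2F M T W = {\<phi>. prog_measurable M T W \<phi> \<and>
     (\<integral>\<^sup>+\<omega>. (\<integral>\<^sup>+t\<in>{0..T}. ennreal ((norm (\<phi> t \<omega>))\<^sup>2) \<partial>lborel) \<partial>M) < \<infinity>}"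

text \<open>A simple process is a finite sum of terms \<open>1\<^bsub>(a,b]\<^esub>(t) \<xi>(\<omega>)\<close> with \<open>\<xi>\<close> bounded and measurable at time \<open>a\<close>;
  it is represented by the list of its triples \<open>(a, b, \<xi>)\<close>. The intervals may overlap.\<close>

type_synonym ('w, 'e) simple = "(real \<times> real \<times> ('w \<Rightarrow> 'e)) list"

definition simple_wf :: "'w measure \<Rightarrow> real \<Rightarrow> (real \<Rightarrow> 'w \<Rightarrow> real) \<Rightarrow> ('w, 'e::euclidean_space) simple \<Rightarrow> bool" where
  "simple_wf M T W l \<longleftrightarrow> (\<forall>(a, b, \<xi>)\<in>set l. 0 \<le> a \<and> a \<le> b \<and> b \<le> T \<and>
     \<xi> \<in> borel_measurable (aug_filtration M W a) \<and> bounded (\<xi> ` space M))"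

definition simple_val :: "('w, 'e::euclidean_space) simple \<Rightarrow> real \<Rightarrow> 'w \<Rightarrow> 'e" where
  "simple_val l t \<omega> = (\<Sum>(a, b, \<xi>)\<leftarrow>l. indicator {a<..b} t *\<^sub>R \<xi> \<omega>)"

definition simple_int :: "(real \<Rightarrow> 'w \<Rightarrow> real) \<Rightarrow> ('w, 'e::euclidean_space) simple \<Rightarrow> real \<Rightarrow> 'w \<Rightarrow> 'e" where
  "simple_int W l t \<omega> = (\<Sum>(a, b, \<xi>)\<leftarrow>l. (W (min b t) \<omega> - W (min a t) \<omega>) *\<^sub>R \<xi> \<omega>)"

text \<open>\<open>I t\<close> is a version of \<open>\<integral>\<^sub>0\<^sup>t \<phi> dW\<close> for every \<open>t \<in> [0,T]\<close>: the \<open>L\<^sup>2\<close>-limit of the integrals of simple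
  processes approximating \<open>\<phi>\<close> in \<open>L\<^sup>2\<close>.\<close>

definition has_ito_integral :: "'w measure \<Rightarrow> real \<Rightarrow> (real \<Rightarrow> 'w \<Rightarrow> real) \<Rightarrow>
    (real \<Rightarrow> 'w \<Rightarrow> 'e::euclidean_space) \<Rightarrow> (real \<Rightarrow> 'w \<Rightarrow> 'e) \<Rightarrow> bool" where
  "has_ito_integral M T W \<phi> I \<longleftrightarrow> \<phi> \<in> L2F M T W \<and>
     (\<forall>t\<in>{0..T}. I t \<in> borel_measurable M) \<and>
     (\<exists>l. (\<forall>n. simple_wf M T W (l n)) \<and>
       (\<lambda>n. \<integral>\<^sup>+\<omega>. (\<integral>\<^sup>+t\<in>{0..T}. ennreal ((norm (simple_val (l n) t \<omega> - \<phi> t \<omega>))\<^sup>2) \<partial>lborel) \<partial>M)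
         \<longlonglongrightarrow> 0 \<and>
       (\<forall>t\<in>{0..T}. (\<lambda>n. \<integral>\<^sup>+\<omega>. ennreal ((norm (simple_int W (l n) t \<omega> - I t \<omega>))\<^sup>2) \<partial>M) \<longlonglongrightarrow> 0))"

text \<open>\<open>dx = b dt + \<sigma> dW\<close> on \<open>[0,T]\<close> for a square-integrable, pathwise continuous process \<open>x\<close>.\<close>

definition ito_process :: "'w measure \<Rightarrow> real \<Rightarrow> (real \<Rightarrow> 'w \<Rightarrow> real) \<Rightarrow> (real \<Rightarrow> 'w \<Rightarrow> 'e::euclidean_space) \<Rightarrow>
    (real \<Rightarrow> 'w \<Rightarrow> 'e) \<Rightarrow> (real \<Rightarrow> 'w \<Rightarrow> 'e) \<Rightarrow> bool" where
  "ito_process M T W x b \<sigma> \<longleftrightarrow> x \<in> L2F M T W \<and>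
     (AE \<omega> in M. continuous_on {0..T} (\<lambda>t. x t \<omega>)) \<and>
     (AE \<omega> in M. set_integrable lborel {0..T} (\<lambda>t. b t \<omega>)) \<and>
     has_ito_integral M T W \<sigma> (\<lambda>t \<omega>. x t \<omega> - x 0 \<omega> - (LINT s:{0..t}|lborel. b s \<omega>))"

definition ae_equal :: "'w measure \<Rightarrow> real \<Rightarrow> (real \<Rightarrow> 'w \<Rightarrow> 'e) \<Rightarrow> (real \<Rightarrow> 'w \<Rightarrow> 'e) \<Rightarrow> bool" where
  "ae_equal M T u v \<longleftrightarrow>
     (AE (t, \<omega>) in restrict_space lborel {0..T} \<Otimes>\<^sub>M M. u t \<omega> = v t \<omega>)"

section \<open>Data of the three-level game\<close>

text \<open>Coefficients of the state equation and weights of \<open>J\<^sup>1\<close> that belong to no player.\<close>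

record ('n, 'v) system =
  sA :: "real \<Rightarrow> real^('n::finite)^'n"
  sC :: "real \<Rightarrow> real^'n^'n"
  sE :: "real \<Rightarrow> real^('v::finite)^'n"
  sQ1 :: "real \<Rightarrow> real^'n^'n"
  sG1 :: "real^'n^'n"

text \<open>Coefficients of the state equation and weights of \<open>J\<^sup>1\<close> attached to an index \<open>i\<close>:
  \<open>cB1 = B\<^bsub>1i\<^esub>\<close>, \<open>cB2j = B\<^bsub>2ij\<^esub>\<close>, \<open>cB3j = B\<^bsub>3ji\<^esub>\<close>, likewise for \<open>D\<close>, and
  \<open>cR = R\<^sub>i\<close>, \<open>cR1j = R\<^bsub>1ij\<^esub>\<close>, \<open>cRb1j = Rbar\<^bsub>1ji\<^esub>\<close>. The type arguments are the dimensions
  \<open>n, m\<^bsub>1i\<^esub>, m\<^bsub>2i1\<^esub>, m\<^bsub>2i2\<^esub>, m\<^bsub>2i3\<^esub>, m\<^bsub>31i\<^esub>, m\<^bsub>32i\<^esub>, m\<^bsub>33i\<^esub>\<close>; the two values of \<open>i\<close> use different instances.\<close>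

record ('n, 'a, 'b1, 'b2, 'b3, 'c1, 'c2, 'c3) channels =
  cB1 :: "real \<Rightarrow> real^('a::finite)^('n::finite)"
  cB21 :: "real \<Rightarrow> real^('b1::finite)^'n"
  cB22 :: "real \<Rightarrow> real^('b2::finite)^'n"
  cB23 :: "real \<Rightarrow> real^('b3::finite)^'n"
  cB31 :: "real \<Rightarrow> real^('c1::finite)^'n"
  cB32 :: "real \<Rightarrow> real^('c2::finite)^'n"
  cB33 :: "real \<Rightarrow> real^('c3::finite)^'n"
  cD1 :: "real \<Rightarrow> real^'a^'n"
  cD21 :: "real \<Rightarrow> real^'b1^'n"
  cD22 :: "real \<Rightarrow> real^'b2^'n"
  cD23 :: "real \<Rightarrow> real^'b3^'n"
  cD31 :: "real \<Rightarrow> real^'c1^'n"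
  cD32 :: "real \<Rightarrow> real^'c2^'n"
  cD33 :: "real \<Rightarrow> real^'c3^'n"
  cR :: "real \<Rightarrow> real^'a^'a"
  cR11 :: "real \<Rightarrow> real^'b1^'b1"
  cR12 :: "real \<Rightarrow> real^'b2^'b2"
  cR13 :: "real \<Rightarrow> real^'b3^'b3"
  cRb11 :: "real \<Rightarrow> real^'c1^'c1"
  cRb12 :: "real \<Rightarrow> real^'c2^'c2"
  cRb13 :: "real \<Rightarrow> real^'c3^'c3"

text \<open>Weights of \<open>J\<^sup>2\<^sub>i\<close>: \<open>wQ = Q\<^bsub>2i\<^esub>\<close>, \<open>wG = G\<^bsub>2i\<^esub>\<close>, \<open>wR = R\<^bsub>2i\<^esub>\<close>, \<open>wR2j = R\<^bsub>2ij\<^esub>\<close>, \<open>wRb2j = Rbar\<^bsub>2ji\<^esub>\<close>.\<close>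

record ('n, 'a, 'b1, 'b2, 'b3, 'c1, 'c2, 'c3) weights2 =
  wQ :: "real \<Rightarrow> real^('n::finite)^'n"
  wG :: "real^'n^'n"
  wR :: "real \<Rightarrow> real^('a::finite)^'a"
  wR21 :: "real \<Rightarrow> real^('b1::finite)^'b1"
  wR22 :: "real \<Rightarrow> real^('b2::finite)^'b2"
  wR23 :: "real \<Rightarrow> real^('b3::finite)^'b3"
  wRb21 :: "real \<Rightarrow> real^('c1::finite)^'c1"
  wRb22 :: "real \<Rightarrow> real^('c2::finite)^'c2"
  wRb23 :: "real \<Rightarrow> real^('c3::finite)^'c3"

text \<open>Gains announced by Level 1 for an index \<open>i\<close>: \<open>etaj = \<eta>\<^bsub>1ij\<^esub>\<close>, \<open>zetaj = \<zeta>\<^bsub>1ij\<^esub>\<close>.\<close>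

record ('a, 'b1, 'b2, 'b3, 'c1, 'c2, 'c3) gains =
  eta1 :: "real \<Rightarrow> real^('b1::finite)^('a::finite)"
  eta2 :: "real \<Rightarrow> real^('b2::finite)^'a"
  eta3 :: "real \<Rightarrow> real^('b3::finite)^'a"
  zeta1 :: "real \<Rightarrow> real^('c1::finite)^'a"
  zeta2 :: "real \<Rightarrow> real^('c2::finite)^'a"
  zeta3 :: "real \<Rightarrow> real^('c3::finite)^'a"

definition bdd_system :: "real \<Rightarrow> ('n::finite, 'v::finite) system \<Rightarrow> bool" where
  "bdd_system T s \<longleftrightarrow> bdd_coeff T (sA s) \<and> bdd_coeff T (sC s) \<and> bdd_coeff T (sE s) \<and> bdd_coeff T (sQ1 s)"

definition bdd_channels :: "real \<Rightarrow> ('n::finite, 'a::finite, 'b1::finite, 'b2::finite, 'b3::finite,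
    'c1::finite, 'c2::finite, 'c3::finite) channels \<Rightarrow> bool" where
  "bdd_channels T c \<longleftrightarrow>
     bdd_coeff T (cB1 c) \<and> bdd_coeff T (cB21 c) \<and> bdd_coeff T (cB22 c) \<and> bdd_coeff T (cB23 c) \<and>
     bdd_coeff T (cB31 c) \<and> bdd_coeff T (cB32 c) \<and> bdd_coeff T (cB33 c) \<and>
     bdd_coeff T (cD1 c) \<and> bdd_coeff T (cD21 c) \<and> bdd_coeff T (cD22 c) \<and> bdd_coeff T (cD23 c) \<and>
     bdd_coeff T (cD31 c) \<and> bdd_coeff T (cD32 c) \<and> bdd_coeff T (cD33 c) \<and>
     bdd_coeff T (cR c) \<and> bdd_coeff T (cR11 c) \<and> bdd_coeff T (cR12 c) \<and> bdd_coeff T (cR13 c) \<and>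
     bdd_coeff T (cRb11 c) \<and> bdd_coeff T (cRb12 c) \<and> bdd_coeff T (cRb13 c)"

definition bdd_weights2 :: "real \<Rightarrow> ('n::finite, 'a::finite, 'b1::finite, 'b2::finite, 'b3::finite,
    'c1::finite, 'c2::finite, 'c3::finite) weights2 \<Rightarrow> bool" where
  "bdd_weights2 T w \<longleftrightarrow> bdd_coeff T (wQ w) \<and> bdd_coeff T (wR w) \<and>
     bdd_coeff T (wR21 w) \<and> bdd_coeff T (wR22 w) \<and> bdd_coeff T (wR23 w) \<and>
     bdd_coeff T (wRb21 w) \<and> bdd_coeff T (wRb22 w) \<and> bdd_coeff T (wRb23 w)"

definition continuous_gains :: "real \<Rightarrow> ('a::finite, 'b1::finite, 'b2::finite, 'b3::finite,
    'c1::finite, 'c2::finite, 'c3::finite) gains \<Rightarrow> bool" where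
  "continuous_gains T g \<longleftrightarrow>
     continuous_on {0..T} (eta1 g) \<and> continuous_on {0..T} (eta2 g) \<and> continuous_on {0..T} (eta3 g) \<and>
     continuous_on {0..T} (zeta1 g) \<and> continuous_on {0..T} (zeta2 g) \<and> continuous_on {0..T} (zeta3 g)"

text \<open>The positivity assumptions are split into a part on \<open>J\<^sup>1\<close> and a part on \<open>J\<^sup>2\<^sub>i\<close>, because the threshold for
  \<open>\<gamma>\<close> may depend on the former only.\<close>

definition A1_system :: "real \<Rightarrow> ('n::finite, 'v::finite) system \<Rightarrow> bool" where
  "A1_system T s \<longleftrightarrow> psd_on T (sQ1 s) \<and> psd (sG1 s)"

definition A2_channels :: "real \<Rightarrow> ('n::finite, 'a::finite, 'b1::finite, 'b2::finite, 'b3::finite,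
    'c1::finite, 'c2::finite, 'c3::finite) channels \<Rightarrow> bool" where
  "A2_channels T c \<longleftrightarrow> unif_pos T (cR c) \<and>
     unif_pos T (cR11 c) \<and> unif_pos T (cR12 c) \<and> unif_pos T (cR13 c) \<and>
     unif_pos T (cRb11 c) \<and> unif_pos T (cRb12 c) \<and> unif_pos T (cRb13 c)"

definition A1_weights2 :: "real \<Rightarrow> ('n::finite, 'a::finite, 'b1::finite, 'b2::finite, 'b3::finite,
    'c1::finite, 'c2::finite, 'c3::finite) weights2 \<Rightarrow> bool" where
  "A1_weights2 T w \<longleftrightarrow> psd_on T (wQ w) \<and> psd (wG w)"

definition A2_weights2 :: "real \<Rightarrow> ('n::finite, 'a::finite, 'b1::finite, 'b2::finite, 'b3::finite,
    'c1::finite, 'c2::finite, 'c3::finite) weights2 \<Rightarrow> bool" where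
  "A2_weights2 T w \<longleftrightarrow> unif_pos T (wR w) \<and>
     unif_pos T (wR21 w) \<and> unif_pos T (wR22 w) \<and> unif_pos T (wR23 w) \<and>
     unif_pos T (wRb21 w) \<and> unif_pos T (wRb22 w) \<and> unif_pos T (wRb23 w)"

section \<open>The Level 1 Riccati equation\<close>

definition Bc where
  "Bc c d t = cB1 c t \<parallel>\<^sub>h cB1 d t \<parallel>\<^sub>h cB21 c t \<parallel>\<^sub>h cB22 c t \<parallel>\<^sub>h cB23 c t \<parallel>\<^sub>h cB21 d t \<parallel>\<^sub>h cB22 d t \<parallel>\<^sub>h cB23 d t
     \<parallel>\<^sub>h cB31 c t \<parallel>\<^sub>h cB31 d t \<parallel>\<^sub>h cB32 c t \<parallel>\<^sub>h cB32 d t \<parallel>\<^sub>h cB33 c t \<parallel>\<^sub>h cB33 d t"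

definition Dc where
  "Dc c d t = cD1 c t \<parallel>\<^sub>h cD1 d t \<parallel>\<^sub>h cD21 c t \<parallel>\<^sub>h cD22 c t \<parallel>\<^sub>h cD23 c t \<parallel>\<^sub>h cD21 d t \<parallel>\<^sub>h cD22 d t \<parallel>\<^sub>h cD23 d t
     \<parallel>\<^sub>h cD31 c t \<parallel>\<^sub>h cD31 d t \<parallel>\<^sub>h cD32 c t \<parallel>\<^sub>h cD32 d t \<parallel>\<^sub>h cD33 c t \<parallel>\<^sub>h cD33 d t"

definition Rc where
  "Rc c d t = cR c t \<oplus>\<^sub>d cR d t \<oplus>\<^sub>d cR11 c t \<oplus>\<^sub>d cR12 c t \<oplus>\<^sub>d cR13 c t \<oplus>\<^sub>d cR11 d t \<oplus>\<^sub>d cR12 d t \<oplus>\<^sub>d cR13 d t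
     \<oplus>\<^sub>d cRb11 c t \<oplus>\<^sub>d cRb11 d t \<oplus>\<^sub>d cRb12 c t \<oplus>\<^sub>d cRb12 d t \<oplus>\<^sub>d cRb13 c t \<oplus>\<^sub>d cRb13 d t"

definition riccati_den where
  "riccati_den c d P t = mat 1 + P t ** Dc c d t ** matrix_inv (Rc c d t) ** transpose (Dc c d t)"

definition riccati_C where
  "riccati_C s c d P t = sC s t - Dc c d t ** matrix_inv (Rc c d t) ** transpose (Bc c d t) ** P t"

definition Lam where
  "Lam s c d P t = matrix_inv (riccati_den c d P t) ** P t ** riccati_C s c d P t"

definition riccati_rhs where
  "riccati_rhs s c d \<gamma> P t =
     P t ** sA s t + transpose (sA s t) ** P t
     - P t ** (Bc c d t ** matrix_inv (Rc c d t) ** transpose (Bc c d t)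
               - (1 / \<gamma>\<^sup>2) *\<^sub>R (sE s t ** transpose (sE s t))) ** P t
     + sQ1 s t
     + transpose (riccati_C s c d P t) ** matrix_inv (riccati_den c d P t) ** P t ** riccati_C s c d P t"

definition riccati_solution where
  "riccati_solution T s c d \<gamma> P \<longleftrightarrow>
     terminal_ode T (sG1 s) (riccati_rhs s c d \<gamma> P) P \<and> bdd_inverse T (riccati_den c d P)"

section \<open>Linear-quadratic two-player games\<close>

text \<open>One player of a game with state dynamics
  \<open>dx = [A x + B\<^sub>1 u\<^sub>1 + B\<^sub>2 u\<^sub>2] dt + [C x + D\<^sub>1 u\<^sub>1 + D\<^sub>2 u\<^sub>2] dW\<close>. Level 2 is the instance
  \<open>level2_game\<close> below, so these fields stand for the barred quantities
  \<open>Bbar\<^bsub>ci\<^esub>, Dbar\<^bsub>ci\<^esub>, Qbar\<^bsub>2i\<^esub>, S\<^bsub>2i\<^esub>, R\<^bsub>ci\<^esub>, G\<^bsub>2i\<^esub>\<close>.\<close>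

record ('n, 'p) player =
  pB :: "real \<Rightarrow> real^('p::finite)^('n::finite)"
  pD :: "real \<Rightarrow> real^'p^'n"
  pQ :: "real \<Rightarrow> real^'n^'n"
  pS :: "real \<Rightarrow> real^'p^'n"
  pR :: "real \<Rightarrow> real^'p^'p"
  pG :: "real^'n^'n"

record ('n, 'p, 'q) game =
  gA :: "real \<Rightarrow> real^('n::finite)^'n"
  gC :: "real \<Rightarrow> real^'n^'n"
  pl1 :: "('n, 'p::finite) player"
  pl2 :: "('n, 'q::finite) player"

definition game_state :: "'w measure \<Rightarrow> real \<Rightarrow> (real \<Rightarrow> 'w \<Rightarrow> real) \<Rightarrow> ('n::finite, 'p::finite, 'q::finite) game \<Rightarrow>
    real^'n \<Rightarrow> (real \<Rightarrow> 'w \<Rightarrow> real^'p) \<Rightarrow> (real \<Rightarrow> 'w \<Rightarrow> real^'q) \<Rightarrow> (real \<Rightarrow> 'w \<Rightarrow> real^'n) \<Rightarrow> bool" where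
  "game_state M T W g x0 u1 u2 x \<longleftrightarrow> (AE \<omega> in M. x 0 \<omega> = x0) \<and>
     ito_process M T W x
       (\<lambda>t \<omega>. gA g t *v x t \<omega> + pB (pl1 g) t *v u1 t \<omega> + pB (pl2 g) t *v u2 t \<omega>)
       (\<lambda>t \<omega>. gC g t *v x t \<omega> + pD (pl1 g) t *v u1 t \<omega> + pD (pl2 g) t *v u2 t \<omega>)"

definition cost :: "'w measure \<Rightarrow> real \<Rightarrow> ('n::finite, 'p::finite) player \<Rightarrow>
    (real \<Rightarrow> 'w \<Rightarrow> real^'n) \<Rightarrow> (real \<Rightarrow> 'w \<Rightarrow> real^'p) \<Rightarrow> real" where
  "cost M T p x u = (LINT \<omega>|M.
     (LINT t:{0..T}|lborel. (pQ p t *v x t \<omega>) \<bullet> x t \<omega> + 2 * (x t \<omega> \<bullet> (pS p t *v u t \<omega>))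
        + (pR p t *v u t \<omega>) \<bullet> u t \<omega>)
     + (pG p *v x T \<omega>) \<bullet> x T \<omega>)"

text \<open>The linear state equation determines the state up to indistinguishability, so quantifying over all
  states \<open>x\<close>, \<open>x'\<close> belonging to the given controls expresses the cost as a function of the controls.\<close>

definition nash_equilibrium :: "'w measure \<Rightarrow> real \<Rightarrow> (real \<Rightarrow> 'w \<Rightarrow> real) \<Rightarrow>
    ('n::finite, 'p::finite, 'q::finite) game \<Rightarrow> real^'n \<Rightarrow>
    (real \<Rightarrow> 'w \<Rightarrow> real^'p) \<Rightarrow> (real \<Rightarrow> 'w \<Rightarrow> real^'q) \<Rightarrow> bool" where
  "nash_equilibrium M T W g x0 u1 u2 \<longleftrightarrow> u1 \<in> L2F M T W \<and> u2 \<in> L2F M T W \<and>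
     (\<forall>x. game_state M T W g x0 u1 u2 x \<longrightarrow>
       (\<forall>v\<in>L2F M T W. \<forall>x'. game_state M T W g x0 v u2 x' \<longrightarrow>
          cost M T (pl1 g) x u1 \<le> cost M T (pl1 g) x' v) \<and>
       (\<forall>v\<in>L2F M T W. \<forall>x'. game_state M T W g x0 u1 v x' \<longrightarrow>
          cost M T (pl2 g) x u2 \<le> cost M T (pl2 g) x' v))"

text \<open>Uniform convexity in the player's own control, the other control and the initial state being \<open>0\<close>.\<close>

definition unif_convex :: "'w measure \<Rightarrow> real \<Rightarrow> (real \<Rightarrow> 'w \<Rightarrow> real) \<Rightarrow>
    (real \<Rightarrow> real^'n^'n) \<Rightarrow> (real \<Rightarrow> real^'n^'n) \<Rightarrow> ('n::finite, 'p::finite) player \<Rightarrow> bool" where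
  "unif_convex M T W A C p \<longleftrightarrow> (\<exists>\<delta>>0. \<forall>g\<in>L2F M T W. \<forall>z.
     (AE \<omega> in M. z 0 \<omega> = 0) \<and>
     ito_process M T W z
       (\<lambda>t \<omega>. A t *v z t \<omega> + pB p t *v g t \<omega>)
       (\<lambda>t \<omega>. C t *v z t \<omega> + pD p t *v g t \<omega>) \<longrightarrow>
     cost M T p z g \<ge> \<delta> * (LINT \<omega>|M. (LINT t:{0..T}|lborel. (norm (g t \<omega>))\<^sup>2)))"

definition A3 :: "real \<Rightarrow> ('n::finite, 'p::finite, 'q::finite) game \<Rightarrow> bool" where
  "A3 T g \<longleftrightarrow> unif_pos T (pR (pl1 g)) \<and> unif_pos T (pR (pl2 g))"

definition A4 :: "'w measure \<Rightarrow> real \<Rightarrow> (real \<Rightarrow> 'w \<Rightarrow> real) \<Rightarrow> ('n::finite, 'p::finite, 'q::finite) game \<Rightarrow> bool" where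
  "A4 M T W g \<longleftrightarrow> unif_convex M T W (gA g) (gC g) (pl1 g) \<and> unif_convex M T W (gA g) (gC g) (pl2 g)"

definition adjoint_bsde :: "'w measure \<Rightarrow> real \<Rightarrow> (real \<Rightarrow> 'w \<Rightarrow> real) \<Rightarrow>
    (real \<Rightarrow> real^'n^'n) \<Rightarrow> (real \<Rightarrow> real^'n^'n) \<Rightarrow> ('n::finite, 'p::finite) player \<Rightarrow>
    (real \<Rightarrow> 'w \<Rightarrow> real^'n) \<Rightarrow> (real \<Rightarrow> 'w \<Rightarrow> real^'p) \<Rightarrow>
    (real \<Rightarrow> 'w \<Rightarrow> real^'n) \<Rightarrow> (real \<Rightarrow> 'w \<Rightarrow> real^'n) \<Rightarrow> bool" where
  "adjoint_bsde M T W A C p x u y z \<longleftrightarrow> (AE \<omega> in M. y T \<omega> = pG p *v x T \<omega>) \<and>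
     ito_process M T W y
       (\<lambda>t \<omega>. - (transpose (A t) *v y t \<omega> + transpose (C t) *v z t \<omega> + pQ p t *v x t \<omega> + pS p t *v u t \<omega>))
       z"

definition open_loop_form :: "('n::finite, 'p::finite) player \<Rightarrow> (real \<Rightarrow> 'w \<Rightarrow> real^'n) \<Rightarrow>
    (real \<Rightarrow> 'w \<Rightarrow> real^'n) \<Rightarrow> (real \<Rightarrow> 'w \<Rightarrow> real^'n) \<Rightarrow> real \<Rightarrow> 'w \<Rightarrow> real^'p" where
  "open_loop_form p x y z t \<omega> = - (matrix_inv (pR p t) *v
     (transpose (pS p t) *v x t \<omega> + transpose (pB p t) *v y t \<omega> + transpose (pD p t) *v z t \<omega>))"

text \<open>The block matrices of the decoupling equation; \<open>BRS\<close> and \<open>DRS\<close> abbreviate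
  \<open>B R\<^sup>-\<^sup>1 S\<^sup>T\<close> and \<open>D R\<^sup>-\<^sup>1 S\<^sup>T\<close>. The unknown of that equation is called \<open>Pm\<close>, as the letter Pi is
  reserved syntax.\<close>

definition BRS :: "('n::finite, 'p::finite) player \<Rightarrow> real \<Rightarrow> real^'n^'n" where
  "BRS p t = pB p t ** matrix_inv (pR p t) ** transpose (pS p t)"

definition DRS :: "('n::finite, 'p::finite) player \<Rightarrow> real \<Rightarrow> real^'n^'n" where
  "DRS p t = pD p t ** matrix_inv (pR p t) ** transpose (pS p t)"

definition BB1 :: "('n::finite, 'p::finite, 'q::finite) game \<Rightarrow> real \<Rightarrow> real^('n+'n)^'n" where
  "BB1 g t = (- (pB (pl1 g) t ** matrix_inv (pR (pl1 g) t) ** transpose (pB (pl1 g) t)))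
     \<parallel>\<^sub>h (- (pB (pl2 g) t ** matrix_inv (pR (pl2 g) t) ** transpose (pB (pl2 g) t)))"

definition BB2 :: "('n::finite, 'p::finite, 'q::finite) game \<Rightarrow> real \<Rightarrow> real^('n+'n)^'n" where
  "BB2 g t = (- (pB (pl1 g) t ** matrix_inv (pR (pl1 g) t) ** transpose (pD (pl1 g) t)))
     \<parallel>\<^sub>h (- (pB (pl2 g) t ** matrix_inv (pR (pl2 g) t) ** transpose (pD (pl2 g) t)))"

definition DD1 :: "('n::finite, 'p::finite, 'q::finite) game \<Rightarrow> real \<Rightarrow> real^('n+'n)^'n" where
  "DD1 g t = (- (pD (pl1 g) t ** matrix_inv (pR (pl1 g) t) ** transpose (pB (pl1 g) t)))
     \<parallel>\<^sub>h (- (pD (pl2 g) t ** matrix_inv (pR (pl2 g) t) ** transpose (pB (pl2 g) t)))"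

definition DD2 :: "('n::finite, 'p::finite, 'q::finite) game \<Rightarrow> real \<Rightarrow> real^('n+'n)^'n" where
  "DD2 g t = (- (pD (pl1 g) t ** matrix_inv (pR (pl1 g) t) ** transpose (pD (pl1 g) t)))
     \<parallel>\<^sub>h (- (pD (pl2 g) t ** matrix_inv (pR (pl2 g) t) ** transpose (pD (pl2 g) t)))"

definition AA :: "('n::finite, 'p::finite, 'q::finite) game \<Rightarrow> real \<Rightarrow> real^('n+'n)^('n+'n)" where
  "AA g t = (gA g t - BRS (pl1 g) t) \<oplus>\<^sub>d (gA g t - BRS (pl2 g) t)"

definition CC :: "('n::finite, 'p::finite, 'q::finite) game \<Rightarrow> real \<Rightarrow> real^('n+'n)^('n+'n)" where
  "CC g t = (gC g t - DRS (pl1 g) t) \<oplus>\<^sub>d (gC g t - DRS (pl2 g) t)"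

definition QQ :: "('n::finite, 'p::finite, 'q::finite) game \<Rightarrow> real \<Rightarrow> real^'n^('n+'n)" where
  "QQ g t =
     (pQ (pl1 g) t - pS (pl1 g) t ** matrix_inv (pR (pl1 g) t) ** transpose (pS (pl1 g) t))
     \<parallel>\<^sub>v (pQ (pl2 g) t - pS (pl2 g) t ** matrix_inv (pR (pl2 g) t) ** transpose (pS (pl2 g) t))"

definition GG :: "('n::finite, 'p::finite, 'q::finite) game \<Rightarrow> real^'n^('n+'n)" where
  "GG g = pG (pl1 g) \<parallel>\<^sub>v pG (pl2 g)"

definition Sigma_fb :: "('n::finite, 'p::finite, 'q::finite) game \<Rightarrow> (real \<Rightarrow> real^'n^('n+'n)) \<Rightarrow>
    real \<Rightarrow> real^'n^('n+'n)" where
  "Sigma_fb g Pm t = matrix_inv (mat 1 - Pm t ** DD2 g t) **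
     (Pm t ** gC g t - (Pm t ** DRS (pl1 g) t + Pm t ** DRS (pl2 g) t) + Pm t ** DD1 g t ** Pm t)"

definition Pi_rhs :: "('n::finite, 'p::finite, 'q::finite) game \<Rightarrow> (real \<Rightarrow> real^'n^('n+'n)) \<Rightarrow>
    real \<Rightarrow> real^'n^('n+'n)" where
  "Pi_rhs g Pm t =
     Pm t ** (gA g t - (BRS (pl1 g) t + BRS (pl2 g) t)) + Pm t ** BB1 g t ** Pm t
     + transpose (AA g t) ** Pm t + QQ g t
     + (transpose (CC g t) + Pm t ** BB2 g t) ** matrix_inv (mat 1 - Pm t ** DD2 g t) **
       (Pm t ** gC g t - (Pm t ** DRS (pl1 g) t + Pm t ** DRS (pl2 g) t) + Pm t ** DD1 g t ** Pm t)"

definition Pi_solution :: "real \<Rightarrow> ('n::finite, 'p::finite, 'q::finite) game \<Rightarrow>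
    (real \<Rightarrow> real^'n^('n+'n)) \<Rightarrow> bool" where
  "Pi_solution T g Pm \<longleftrightarrow> terminal_ode T (GG g) (Pi_rhs g Pm) Pm \<and>
     bdd_inverse T (\<lambda>t. mat 1 - Pm t ** DD2 g t)"

section \<open>The Level 2 game\<close>

definition gainK :: "real^'m^'m \<Rightarrow> real^'m^'n \<Rightarrow> real^'m^'n \<Rightarrow> real^'n^'n \<Rightarrow> real^'n^'n \<Rightarrow> real^'n^'m" where
  "gainK R B D P \<Lambda> = matrix_inv R ** (transpose B ** P + transpose D ** \<Lambda>)"

definition xi_term :: "real^'n^'a \<Rightarrow> real^'b^'a \<Rightarrow> real^'n^'b \<Rightarrow> real^'c^'a \<Rightarrow> real^'n^'c \<Rightarrow> real^'n^'a" where
  "xi_term K1 \<eta> K2 \<zeta> K3 = - ((1 / 3) *\<^sub>R K1) + \<eta> ** K2 + \<zeta> ** K3"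

text \<open>\<open>\<xi>\<^sub>i = \<xi>\<^bsub>1i1\<^esub> + \<xi>\<^bsub>1i2\<^esub> + \<xi>\<^bsub>1i3\<^esub>\<close> at one time, where \<open>P\<close>, \<open>\<Lambda>\<close> are the values at that time.\<close>

definition xi :: "('n::finite, 'a::finite, 'b1::finite, 'b2::finite, 'b3::finite, 'c1::finite, 'c2::finite,
    'c3::finite) channels \<Rightarrow> ('a, 'b1, 'b2, 'b3, 'c1, 'c2, 'c3) gains \<Rightarrow>
    real^'n^'n \<Rightarrow> real^'n^'n \<Rightarrow> real \<Rightarrow> real^'n^'a" where
  "xi c h P \<Lambda> t = (let K1 = gainK (cR c t) (cB1 c t) (cD1 c t) P \<Lambda> in
     xi_term K1 (eta1 h t) (gainK (cR11 c t) (cB21 c t) (cD21 c t) P \<Lambda>)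
                (zeta1 h t) (gainK (cRb11 c t) (cB31 c t) (cD31 c t) P \<Lambda>)
     + xi_term K1 (eta2 h t) (gainK (cR12 c t) (cB22 c t) (cD22 c t) P \<Lambda>)
                  (zeta2 h t) (gainK (cRb12 c t) (cB32 c t) (cD32 c t) P \<Lambda>)
     + xi_term K1 (eta3 h t) (gainK (cR13 c t) (cB23 c t) (cD23 c t) P \<Lambda>)
                  (zeta3 h t) (gainK (cRb13 c t) (cB33 c t) (cD33 c t) P \<Lambda>))"

definition NN where
  "NN h t = eta1 h t \<parallel>\<^sub>h eta2 h t \<parallel>\<^sub>h eta3 h t \<parallel>\<^sub>h zeta1 h t \<parallel>\<^sub>h zeta2 h t \<parallel>\<^sub>h zeta3 h t"

definition level2_player where
  "level2_player c w h P \<Lambda> =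
     \<lparr> pB = (\<lambda>t. (cB21 c t \<parallel>\<^sub>h cB22 c t \<parallel>\<^sub>h cB23 c t \<parallel>\<^sub>h cB31 c t \<parallel>\<^sub>h cB32 c t \<parallel>\<^sub>h cB33 c t) + cB1 c t ** NN h t),
       pD = (\<lambda>t. (cD21 c t \<parallel>\<^sub>h cD22 c t \<parallel>\<^sub>h cD23 c t \<parallel>\<^sub>h cD31 c t \<parallel>\<^sub>h cD32 c t \<parallel>\<^sub>h cD33 c t) + cD1 c t ** NN h t),
       pQ = (\<lambda>t. wQ w t + transpose (xi c h (P t) (\<Lambda> t) t) ** wR w t ** xi c h (P t) (\<Lambda> t) t),
       pS = (\<lambda>t. transpose (xi c h (P t) (\<Lambda> t) t) ** wR w t ** NN h t),
       pR = (\<lambda>t. (wR21 w t \<oplus>\<^sub>d wR22 w t \<oplus>\<^sub>d wR23 w t \<oplus>\<^sub>d wRb21 w t \<oplus>\<^sub>d wRb22 w t \<oplus>\<^sub>d wRb23 w t)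
                 + transpose (NN h t) ** wR w t ** NN h t),
       pG = wG w \<rparr>"

text \<open>The game between the Level 2 players once Level 1 has announced the gains \<open>h1\<close>, \<open>h2\<close> and the disturbance
  is \<open>\<gamma>\<^sup>-\<^sup>2 E\<^sup>T P x\<close>.\<close>

definition level2_game where
  "level2_game s c1 c2 w1 w2 h1 h2 \<gamma> P =
     \<lparr> gA = (\<lambda>t. sA s t + (1 / \<gamma>\<^sup>2) *\<^sub>R (sE s t ** transpose (sE s t) ** P t)
                 + (cB1 c1 t ** xi c1 h1 (P t) (Lam s c1 c2 P t) t + cB1 c2 t ** xi c2 h2 (P t) (Lam s c1 c2 P t) t)),
       gC = (\<lambda>t. sC s t
                 + (cD1 c1 t ** xi c1 h1 (P t) (Lam s c1 c2 P t) t + cD1 c2 t ** xi c2 h2 (P t) (Lam s c1 c2 P t) t)),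
       pl1 = level2_player c1 w1 h1 P (Lam s c1 c2 P),
       pl2 = level2_player c2 w2 h2 P (Lam s c1 c2 P) \<rparr>"

end

theory Submission
  imports Defs
begin

text \<open>Collect the adjoint processes into columns \<open>X = col(y, Y)\<close> and \<open>U = col(z, Z)\<close>. Inserting the open-loop form
  of the controls, \<open>\<delta> = X - \<Pi> x\<close> solves, by the product rule and the equation for \<open>\<Pi>\<close>, a linear backward
  equation \<open>d\<delta> = - (M\<^sub>1 \<delta> + M\<^sub>2 \<zeta>) dt + \<zeta> dW\<close>, \<open>\<delta>(T) = 0\<close>, with bounded \<open>M\<^sub>1\<close>, \<open>M\<^sub>2\<close> and
  \<open>\<zeta> = (I - \<Pi> D\<^sub>2)(U - \<Sigma> x) - \<Pi> D\<^sub>1 \<delta>\<close>. Its only solution is zero, so \<open>X = \<Pi> x\<close> and \<open>U = \<Sigma> x\<close>.\<close>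

section \<open>Square-integrable functions\<close>

text \<open>\<open>has_ito_integral\<close> fixes the integral as an L2 limit, one version for each
  single time. Two consequences of the isometry carry the whole stochastic part: an increment after
  time s is orthogonal to everything known at s (\<open>ito_pythagoras\<close>), and convergence of
  integrands identifies the integrals (\<open>ito_limit_AE\<close>). The first yields uniqueness for
  the backward equation, the second the product rule. The rule is wanted only for a deterministic
  absolutely continuous factor, so no quadratic covariation appears and the integrals can be
  followed path by path through Riemann sums. The open-loop form of the controls holds only for
  almost every pair of time and path. Hence drifts and diffusions have to be exchanged for almost
  everywhere equal ones, once before uniqueness applies to \<delta> and once to close the loop for
  x. Boundedness of the matrices in the equation for \<delta> comes from three sources: continuity
  of \<Pi>, the bounded inverse of I - \<Pi> D2, and uniform positivity of the control weights,
  which bounds their inverses.\<close>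

lemma norm_add_sq_le:
  fixes x y :: "'e::real_inner" assumes "e > 0"
  shows "(norm (x + y))\<^sup>2 \<le> (1 + e) * (norm x)\<^sup>2 + (1 + 1 / e) * (norm y)\<^sup>2"
proof -
  \<comment> \<open>Young's inequality with a free weight e. Taking e = 1 gives the factors 2 of the
    crude estimates; letting e tend to 0 makes the factor of the leading term tend to 1, which takes
    the place of Minkowski's inequality in [0, \<infinity>].\<close>
  have "0 \<le> (norm (e *\<^sub>R x - y))\<^sup>2" by simp
  then have "2 * e * (x \<bullet> y) \<le> e\<^sup>2 * (norm x)\<^sup>2 + (norm y)\<^sup>2"
    by (simp only: power2_norm_eq_inner) (simp add: inner_diff algebra_simps power2_eq_square inner_commute)
  then have "2 * e * (x \<bullet> y) / e \<le> (e\<^sup>2 * (norm x)\<^sup>2 + (norm y)\<^sup>2) / e"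
    using assms by (intro divide_right_mono) auto
  then have "2 * (x \<bullet> y) \<le> e * (norm x)\<^sup>2 + (norm y)\<^sup>2 / e"
    using assms by (simp add: add_divide_distrib power2_eq_square)
  then show ?thesis
    by (simp add: power2_norm_eq_inner inner_add algebra_simps inner_commute)
qed

lemma nn_integral_sq_add_le:
  fixes f h :: "'a \<Rightarrow> 'e::euclidean_space"
  assumes "e > 0" "f \<in> borel_measurable N" "h \<in> borel_measurable N"
  shows "(\<integral>\<^sup>+x. ennreal ((norm (f x + h x))\<^sup>2) \<partial>N)
    \<le> ennreal (1 + e) * (\<integral>\<^sup>+x. ennreal ((norm (f x))\<^sup>2) \<partial>N)
      + ennreal (1 + 1 / e) * (\<integral>\<^sup>+x. ennreal ((norm (h x))\<^sup>2) \<partial>N)"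
proof -
  have "(\<integral>\<^sup>+x. ennreal ((norm (f x + h x))\<^sup>2) \<partial>N)
     \<le> (\<integral>\<^sup>+x. ennreal (1 + e) * ennreal ((norm (f x))\<^sup>2) + ennreal (1 + 1 / e) * ennreal ((norm (h x))\<^sup>2) \<partial>N)"
    using assms(1) norm_add_sq_le[OF assms(1)]
    by (intro nn_integral_mono) (simp add: ennreal_mult[symmetric] ennreal_plus[symmetric] del: ennreal_plus)
  also have "\<dots> = (\<integral>\<^sup>+x. ennreal (1 + e) * ennreal ((norm (f x))\<^sup>2) \<partial>N)
      + (\<integral>\<^sup>+x. ennreal (1 + 1 / e) * ennreal ((norm (h x))\<^sup>2) \<partial>N)"
    using assms by (intro nn_integral_add) simp_all
  also have "\<dots> = ennreal (1 + e) * (\<integral>\<^sup>+x. ennreal ((norm (f x))\<^sup>2) \<partial>N)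
      + ennreal (1 + 1 / e) * (\<integral>\<^sup>+x. ennreal ((norm (h x))\<^sup>2) \<partial>N)"
    using assms by (subst (1 2) nn_integral_cmult) (auto intro!: measurable_compose[OF _ measurable_ennreal])
  finally show ?thesis .
qed

text \<open>Let e tend to 0 from the right. This removes the weight of Young's inequality after the
  companion term with factor 1 + 1/e has already gone to zero.\<close>

lemma ennreal_le_of_scaled_le:
  fixes a b :: ennreal
  assumes "\<And>e. e > 0 \<Longrightarrow> a \<le> ennreal (1 + e) * b"
  shows "a \<le> b"
proof (cases b)
  case (real r)
  have *: "((\<lambda>e. ennreal ((1 + e) * r)) \<longlongrightarrow> ennreal ((1 + 0) * r)) (at_right 0)"
    by (intro tendsto_ennrealI tendsto_intros)
  have "a \<le> ennreal ((1 + 0) * r)"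
  proof (rule tendsto_lowerbound[OF *])
    show "\<forall>\<^sub>F e in at_right 0. a \<le> ennreal ((1 + e) * r)"
      using assms real
      by (intro eventually_at_right_less[THEN eventually_mono]) (auto simp: ennreal_mult)
  qed simp
  then show ?thesis using real by simp
qed simp

text \<open>Young's inequality is applied in both directions, once for the upper and once for the
  lower limit, because differences of possibly infinite squared norms cannot be formed.\<close>

lemma nn_integral_sq_tendsto:
  fixes X :: "'a \<Rightarrow> 'e::euclidean_space"
  assumes X: "X \<in> borel_measurable N" "\<And>n. Xn n \<in> borel_measurable N"
    and lim: "(\<lambda>n. \<integral>\<^sup>+x. ennreal ((norm (Xn n x - X x))\<^sup>2) \<partial>N) \<longlonglongrightarrow> 0"
  shows "(\<lambda>n. \<integral>\<^sup>+x. ennreal ((norm (Xn n x))\<^sup>2) \<partial>N) \<longlonglongrightarrow> (\<integral>\<^sup>+x. ennreal ((norm (X x))\<^sup>2) \<partial>N)"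
proof -
  let ?m = "\<lambda>f. \<integral>\<^sup>+x. ennreal ((norm (f x))\<^sup>2) \<partial>N"
  let ?d = "\<lambda>n. ?m (\<lambda>x. Xn n x - X x)"
  have tri: "?m f \<le> ennreal (1 + e) * ?m h + ennreal (1 + 1/e) * ?m (\<lambda>x. f x - h x)"
    if "e > 0" "f \<in> borel_measurable N" "h \<in> borel_measurable N" for f h :: "'a \<Rightarrow> 'e" and e
    using nn_integral_sq_add_le[of e h N "\<lambda>x. f x - h x"] that by simp
  have "limsup (\<lambda>n. ?m (Xn n)) \<le> ?m X"
  proof (rule ennreal_le_of_scaled_le)
    fix e :: real assume e: "e > 0"
    have "limsup (\<lambda>n. ?m (Xn n)) \<le> limsup (\<lambda>n. ennreal (1 + e) * ?m X + ennreal (1 + 1/e) * ?d n)"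
      by (intro Limsup_mono always_eventually allI tri e X)
    also have "(\<lambda>n. ennreal (1 + e) * ?m X + ennreal (1 + 1/e) * ?d n)
       \<longlonglongrightarrow> ennreal (1 + e) * ?m X + ennreal (1 + 1/e) * 0"
      by (intro tendsto_intros lim ennreal_tendsto_cmult) auto
    from lim_imp_Limsup[OF _ this]
    have "limsup (\<lambda>n. ennreal (1 + e) * ?m X + ennreal (1 + 1/e) * ?d n) = ennreal (1 + e) * ?m X" by simp
    finally show "limsup (\<lambda>n. ?m (Xn n)) \<le> ennreal (1 + e) * ?m X" .
  qed
  moreover have "?m X \<le> liminf (\<lambda>n. ?m (Xn n))"
  proof (rule ennreal_le_of_scaled_le)
    fix e :: real assume e: "e > 0"
    have *: "?m X \<le> ennreal (1 + e) * ?m (Xn n) + ennreal (1 + 1/e) * ?d n" for n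
      using tri[OF e X(1) X(2)[of n]] by (simp add: norm_minus_commute)
    \<comment> \<open>Along a subsequence that realises the lower limit every term on the right of *
      converges, so the inequality passes to the limit.\<close>
    obtain r where r: "strict_mono r" "(\<lambda>n. ?m (Xn (r n))) \<longlonglongrightarrow> liminf (\<lambda>n. ?m (Xn n))"
      using liminf_subseq_lim[of "\<lambda>n. ?m (Xn n)"] by (auto simp: comp_def)
    have l: "(\<lambda>n. ?d (r n)) \<longlonglongrightarrow> 0"
      using LIMSEQ_subseq_LIMSEQ[OF lim r(1)] by (simp add: comp_def)
    have "(\<lambda>n. ennreal (1 + e) * ?m (Xn (r n)) + ennreal (1 + 1/e) * ?d (r n))
       \<longlonglongrightarrow> ennreal (1 + e) * liminf (\<lambda>n. ?m (Xn n)) + ennreal (1 + 1/e) * 0"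
      by (intro tendsto_intros l r ennreal_tendsto_cmult) auto
    then have "(\<lambda>n. ennreal (1 + e) * ?m (Xn (r n)) + ennreal (1 + 1/e) * ?d (r n))
       \<longlonglongrightarrow> ennreal (1 + e) * liminf (\<lambda>n. ?m (Xn n))" by simp
    from Lim_bounded2[OF this] * show "?m X \<le> ennreal (1 + e) * liminf (\<lambda>n. ?m (Xn n))" by blast
  qed
  ultimately have "liminf (\<lambda>n. ?m (Xn n)) = ?m X" "limsup (\<lambda>n. ?m (Xn n)) = ?m X"
    using Liminf_le_Limsup[of sequentially "\<lambda>n. ?m (Xn n)"] by (auto intro: antisym order_trans)
  then show ?thesis by (simp add: tendsto_iff_Liminf_eq_Limsup)
qed

section \<open>Brownian increments\<close>

locale brownian_basis = prob_space M for M :: "'w measure" +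
  fixes T :: real and W :: "real \<Rightarrow> 'w \<Rightarrow> real"
  assumes T_pos: "0 < T" and brownian: "brownian_motion M T W"
begin

abbreviation F :: "real \<Rightarrow> 'w measure" where "F \<equiv> aug_filtration M W"

section \<open>The augmented filtration\<close>

lemma W_measurable: "t \<in> {0..T} \<Longrightarrow> W t \<in> borel_measurable M"
  using brownian by (auto simp: brownian_motion_def)

lemma F_gen_Pow: "{W s -` A \<inter> space M | s A. s \<in> {0..t} \<and> A \<in> sets borel} \<union> null_sets M \<subseteq> Pow (space M)"
  using sets.sets_into_space by fastforce

lemma space_F [simp]: "space (F t) = space M"
  unfolding aug_filtration_def by (rule space_measure_of[OF F_gen_Pow])

lemma sets_F: "sets (F t) = sigma_sets (space M)
    ({W s -` A \<inter> space M | s A. s \<in> {0..t} \<and> A \<in> sets borel} \<union> null_sets M)"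
  unfolding aug_filtration_def by (rule sets_measure_of[OF F_gen_Pow])

lemma F_subset: assumes "t \<le> T" shows "sets (F t) \<subseteq> sets M"
  unfolding sets_F
proof (rule sets.sigma_sets_subset, safe)
  fix s and A :: "real set" assume "s \<in> {0..t}" "A \<in> sets borel"
  with W_measurable[of s] assms show "W s -` A \<inter> space M \<in> sets M"
    by (auto intro: measurable_sets)
qed auto

lemma F_mono: assumes "s \<le> t" shows "sets (F s) \<subseteq> sets (F t)"
  unfolding sets_F
proof (rule sigma_sets_mono', rule Un_mono)
  show "{W r -` A \<inter> space M | r A. r \<in> {0..s} \<and> A \<in> sets borel}
      \<subseteq> {W r -` A \<inter> space M | r A. r \<in> {0..t} \<and> A \<in> sets borel}"
  proof (intro Collect_mono impI, elim exE conjE)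
    fix B r and A :: "real set" assume "B = W r -` A \<inter> space M" "r \<in> {0..s}" "A \<in> sets borel"
    with assms show "\<exists>r A. B = W r -` A \<inter> space M \<and> r \<in> {0..t} \<and> A \<in> sets borel"
      by (intro exI[of _ r] exI[of _ A]) simp
  qed
qed simp

lemma F_subalgebra: "t \<le> T \<Longrightarrow> subalgebra M (F t)"
  using F_subset[of t] by (simp add: subalgebra_def)

lemma F_measurable_M: "f \<in> measurable (F t) N \<Longrightarrow> t \<le> T \<Longrightarrow> f \<in> measurable M N"
  by (rule measurable_from_subalg[OF F_subalgebra])

lemma F_measurable_mono: "f \<in> measurable (F s) N \<Longrightarrow> s \<le> t \<Longrightarrow> f \<in> measurable (F t) N"
  using F_mono[of s t] by (intro measurable_from_subalg[of "F t" "F s"]) (simp_all add: subalgebra_def)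

lemma W_F_measurable: assumes "0 \<le> s" "s \<le> t" shows "W s \<in> borel_measurable (F t)"
proof (rule measurableI)
  fix A :: "real set" assume "A \<in> sets borel"
  then have "W s -` A \<inter> space M \<in> {W s -` A \<inter> space M | s A. s \<in> {0..t} \<and> A \<in> sets borel} \<union> null_sets M"
    using assms by (intro UnI1 CollectI exI[of _ s] exI[of _ A]) simp
  then show "W s -` A \<inter> space (F t) \<in> sets (F t)"
    unfolding sets_F space_F by (rule sigma_sets.Basic)
qed simp

section \<open>Moments and independence of Brownian increments\<close>

lemma increment_moments:
  assumes "0 \<le> s" "s < t" "t \<le> T"
  defines "D \<equiv> \<lambda>w. W t w - W s w"
  shows "integrable M D" "expectation D = 0"
    "integrable M (\<lambda>w. (D w)\<^sup>2)" "expectation (\<lambda>w. (D w)\<^sup>2) = t - s"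
proof -
  have d: "distributed M lborel D (normal_density 0 (sqrt (t - s)))"
    using brownian assms unfolding brownian_motion_def by blast
  have sg: "sqrt (t - s) > 0" using assms by simp
  have m: "integrable lborel (\<lambda>x. normal_density 0 (sqrt (t - s)) x * x ^ k)" for k
    using integrable_normal_moment[OF sg, of 0 k] by simp
  show 1: "integrable M D"
    using distributed_integrable[OF d, of "\<lambda>x. x"] m[of 1] by (simp add: distributed_measurable[OF d])
  show 2: "integrable M (\<lambda>w. (D w)\<^sup>2)"
    using distributed_integrable[OF d, of "\<lambda>x. x^2"] m[of 2] by simp
  show 3: "expectation D = 0" using normal_distributed_expectation[OF sg d] by simp
  show "expectation (\<lambda>w. (D w)\<^sup>2) = t - s"
    using normal_distributed_variance[OF sg d] 3 assms by simp
qed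

text \<open>\<open>brownian_motion\<close> asserts independence of two families of events,
  \<open>indep_var\<close> asks for the generated sigma-algebras. Both families are stable under
  intersection, so independence extends, and the sigma-algebra of U lies inside that of F s.\<close>

lemma increment_indep:
  assumes "0 \<le> s" "s < t" "t \<le> T" "U \<in> borel_measurable (F s)"
  shows "indep_var borel U borel (\<lambda>w. W t w - W s w)"
proof -
  let ?D = "\<lambda>w. W t w - W s w"
  have U: "U \<in> borel_measurable M" using F_measurable_M[OF assms(4)] assms by simp
  have D: "?D \<in> borel_measurable M" using assms by (intro borel_measurable_diff W_measurable) auto
  have i: "indep_set (sets (F s)) {?D -` A \<inter> space M | A. A \<in> sets borel}"
    using brownian assms unfolding brownian_motion_def by blast
  have "indep_set (sigma_sets (space M) (sets (F s))) (sigma_sets (space M) {?D -` A \<inter> space M | A. A \<in> sets borel})"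
  proof (rule indep_set_sigma_sets[OF i])
    show "Int_stable (sets (F s))" by (rule sets.Int_stable)
    show "Int_stable {?D -` A \<inter> space M | A. A \<in> sets borel}"
    proof (rule Int_stableI, clarsimp)
      fix A B :: "real set" assume "A \<in> sets borel" "B \<in> sets borel"
      then show "\<exists>C. ?D -` A \<inter> space M \<inter> (?D -` B \<inter> space M) = ?D -` C \<inter> space M \<and> C \<in> sets borel"
        by (intro exI[of _ "A \<inter> B"]) auto
    qed
  qed
  moreover have "sigma_sets (space M) {U -` A \<inter> space M | A. A \<in> sets borel} \<subseteq> sigma_sets (space M) (sets (F s))"
    using measurable_sets[OF assms(4)] by (intro sigma_sets_mono') auto
  ultimately have "indep_set (sigma_sets (space M) {U -` A \<inter> space M | A. A \<in> sets borel})
      (sigma_sets (space M) {?D -` A \<inter> space M | A. A \<in> sets borel})"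
    by (meson indep_setD indep_setD_ev1 indep_setD_ev2 indep_setI subset_iff)
  then show ?thesis unfolding indep_var_eq using U D by blast
qed

lemma increment_product:
  assumes "0 \<le> s" "s \<le> t" "t \<le> T" "U \<in> borel_measurable (F s)" "integrable M U"
  shows "integrable M (\<lambda>w. U w * (W t w - W s w))"
    and "expectation (\<lambda>w. U w * (W t w - W s w)) = 0"
    and "integrable M (\<lambda>w. U w * (W t w - W s w)\<^sup>2)"
    and "expectation (\<lambda>w. U w * (W t w - W s w)\<^sup>2) = (t - s) * expectation U"
proof -
  have *: "integrable M (\<lambda>w. U w * (W t w - W s w)) \<and>
     expectation (\<lambda>w. U w * (W t w - W s w)) = 0 \<and>
     integrable M (\<lambda>w. U w * (W t w - W s w)\<^sup>2) \<and>
     expectation (\<lambda>w. U w * (W t w - W s w)\<^sup>2) = (t - s) * expectation U"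
  \<comment> \<open>\<open>brownian_motion\<close> describes increments over intervals with s < t;
    for s = t both products are zero.\<close>
  proof (cases "s = t")
    case True then show ?thesis by simp
  next
    case False
    then have st: "s < t" using assms by simp
    note m = increment_moments[OF assms(1) st assms(3)]
    have i: "indep_var borel U borel (\<lambda>w. W t w - W s w)"
      using increment_indep st assms by blast
    have i2: "indep_var borel U borel (\<lambda>w. (W t w - W s w)\<^sup>2)"
      using indep_var_compose[OF i, of "\<lambda>x. x" borel "\<lambda>x. x^2" borel] by (simp add: comp_def)
    show ?thesis
      using indep_var_integrable[OF i assms(5) m(1)] indep_var_lebesgue_integral[OF i assms(5) m(1)]
        indep_var_integrable[OF i2 assms(5) m(3)] indep_var_lebesgue_integral[OF i2 assms(5) m(3)] m
      by simp
  qed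
  show "integrable M (\<lambda>w. U w * (W t w - W s w))"
    and "expectation (\<lambda>w. U w * (W t w - W s w)) = 0"
    and "integrable M (\<lambda>w. U w * (W t w - W s w)\<^sup>2)"
    and "expectation (\<lambda>w. U w * (W t w - W s w)\<^sup>2) = (t - s) * expectation U" using * by auto
qed

lemma increment_integrable:
  assumes "0 \<le> s" "s \<le> t" "t \<le> T"
  shows "integrable M (\<lambda>w. W t w - W s w)"
proof (cases "s = t")
  case False
  then show ?thesis using increment_moments(1)[of s t] assms by auto
qed simp

lemma bounded_times_increment:
  fixes V :: "'w \<Rightarrow> real"
  assumes "0 \<le> s" "s \<le> t" "t \<le> T" "V \<in> borel_measurable M" "bounded (V ` space M)"
  shows "integrable M (\<lambda>w. V w * (W t w - W s w))"
proof -
  obtain K where K: "\<And>w. w \<in> space M \<Longrightarrow> \<bar>V w\<bar> \<le> K"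
    using assms(5) by (auto simp: bounded_iff)
  have "integrable M (\<lambda>w. K * (W t w - W s w))"
    using increment_integrable[OF assms(1-3)] by simp
  then show ?thesis
  proof (rule Bochner_Integration.integrable_bound)
    show "(\<lambda>w. V w * (W t w - W s w)) \<in> borel_measurable M"
      using assms W_measurable[of s] W_measurable[of t] by simp
    show "AE w in M. norm (V w * (W t w - W s w)) \<le> norm (K * (W t w - W s w))"
    proof (rule AE_I2)
      fix w assume "w \<in> space M"
      then have "\<bar>V w\<bar> \<le> \<bar>K\<bar>" using K[of w] by linarith
      then show "norm (V w * (W t w - W s w)) \<le> norm (K * (W t w - W s w))"
        by (simp add: abs_mult mult_right_mono)
    qed
  qed
qed

text \<open>Both increments are cut at c and at e = min b d. A product of an increment with a factor
  known at its left end has mean zero, so only the square over the common part (c, e] survives. If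
  the intervals are disjoint, the whole product is of the first kind.\<close>

lemma increments_product_ordered:
  fixes V :: "'w \<Rightarrow> real"
  assumes ab: "0 \<le> a" "a \<le> b" "b \<le> T" and cd: "a \<le> c" "c \<le> d" "d \<le> T"
    and V: "V \<in> borel_measurable (F c)" "bounded (V ` space M)"
  shows "has_bochner_integral M (\<lambda>w. V w * (W b w - W a w) * (W d w - W c w))
      (max 0 (min b d - c) * expectation V)"
proof (cases "b \<le> c")
  case True
  have VM: "V \<in> borel_measurable M" using F_measurable_M[OF V(1)] cd by simp
  let ?U = "\<lambda>w. V w * (W b w - W a w)"
  have U: "?U \<in> borel_measurable (F c)"
    using ab True V W_F_measurable[of a c] W_F_measurable[of b c] by simp
  have Ui: "integrable M ?U" using bounded_times_increment[OF ab VM V(2)] .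
  have c: "0 \<le> c" using ab cd by simp
  show ?thesis
    using increment_product(1,2)[OF c cd(2,3) U Ui] True by (simp add: has_bochner_integral_iff)
next
  case False
  then have cb: "c \<le> b" by simp
  have VM: "V \<in> borel_measurable M" using F_measurable_M[OF V(1)] cd by simp
  have Vi: "integrable M V"
  proof -
    obtain K where "\<And>w. w \<in> space M \<Longrightarrow> norm (V w) \<le> K" using V(2) by (auto simp: bounded_iff)
    then show ?thesis using VM by (intro integrable_const_bound[of _ K]) auto
  qed
  define e where "e = min b d"
  have e: "c \<le> e" "e \<le> T" "e \<le> b" "e \<le> d" "e = b \<or> e = d" using cb cd ab by (auto simp: e_def)
  have c: "0 \<le> c" "0 \<le> e" "c \<le> T" using ab cd e by auto
  let ?U1 = "\<lambda>w. V w * (W c w - W a w)" and ?U2 = "\<lambda>w. V w * (W e w - W c w)"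
  have U1: "?U1 \<in> borel_measurable (F c)"
    using ab cd c V W_F_measurable[of a c] W_F_measurable[of c c] by simp
  have U2: "?U2 \<in> borel_measurable (F e)"
    using e c F_measurable_mono[OF V(1), of e] W_F_measurable[of c e] W_F_measurable[of e e] by simp
  have U1i: "integrable M ?U1" using bounded_times_increment[OF ab(1) cd(1) c(3) VM V(2)] .
  have U2i: "integrable M ?U2" using bounded_times_increment[OF c(1) e(1,2) VM V(2)] .
  \<comment> \<open>The expansion has a fifth piece, the product of the increments from e to b and
    from e to d; it is zero because e is one of b and d.\<close>
  have "has_bochner_integral M (\<lambda>w. ?U1 w * (W d w - W c w) + V w * (W e w - W c w)\<^sup>2
      + ?U2 w * (W d w - W e w) + ?U2 w * (W b w - W e w)) (0 + (e - c) * expectation V + 0 + 0)"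
    using increment_product[OF c(1) cd(2,3) U1 U1i] increment_product[OF c(1) e(1,2) V(1) Vi]
      increment_product[OF c(2) e(4) cd(3) U2 U2i] increment_product[OF c(2) e(3) ab(3) U2 U2i]
    by (intro has_bochner_integral_add) (simp_all add: has_bochner_integral_iff)
  moreover have "?U1 w * (W d w - W c w) + V w * (W e w - W c w)\<^sup>2
      + ?U2 w * (W d w - W e w) + ?U2 w * (W b w - W e w)
      = V w * (W b w - W a w) * (W d w - W c w)" for w
    using e(5) by (auto simp: algebra_simps power2_eq_square)
  ultimately show ?thesis using e by (simp add: e_def max_def)
qed

text \<open>The polarised isometry for two elementary terms. Ordering them by left endpoints makes
  the inner product of \<xi> and \<eta> measurable at the later one, so that it can play the part of
  V.\<close>

lemma simple_term_product:
  fixes \<xi> \<eta> :: "'w \<Rightarrow> 'e::euclidean_space"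
  assumes "0 \<le> a" "a \<le> b" "b \<le> T" and "0 \<le> c" "c \<le> d" "d \<le> T"
    and "\<xi> \<in> borel_measurable (F a)" "bounded (\<xi> ` space M)"
    and "\<eta> \<in> borel_measurable (F c)" "bounded (\<eta> ` space M)"
  shows "has_bochner_integral M (\<lambda>w. ((W b w - W a w) *\<^sub>R \<xi> w) \<bullet> ((W d w - W c w) *\<^sub>R \<eta> w))
      (measure lborel ({a<..b} \<inter> {c<..d}) * expectation (\<lambda>w. \<xi> w \<bullet> \<eta> w))"
proof -
  have m: "measure lborel ({a<..b} \<inter> {c<..d}) = max 0 (min b d - max a c)"
    by (auto simp: max_def min_def)
  obtain K L where KL: "\<And>w. w \<in> space M \<Longrightarrow> norm (\<xi> w) \<le> K" "\<And>w. w \<in> space M \<Longrightarrow> norm (\<eta> w) \<le> L"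
    using assms(8,10) by (auto simp: bounded_iff)
  have "\<bar>\<xi> w \<bullet> \<eta> w\<bar> \<le> K * L" if "w \<in> space M" for w
    using KL[OF that] order_trans[OF Cauchy_Schwarz_ineq2 mult_mono[OF KL[OF that] order_trans[OF norm_ge_zero KL(1)[OF that]]]]
    by simp
  then have bd: "bounded ((\<lambda>w. \<xi> w \<bullet> \<eta> w) ` space M)"
    unfolding bounded_iff by auto
  show ?thesis
  proof (cases "a \<le> c")
    case True
    have "(\<lambda>w. \<xi> w \<bullet> \<eta> w) \<in> borel_measurable (F c)"
      using assms True F_measurable_mono[OF assms(7) True] by simp
    from increments_product_ordered[OF assms(1-3) True assms(5,6) this bd] show ?thesis
      using True unfolding m by (simp add: ac_simps max_absorb2)
  next
    case False
    then have ca: "c \<le> a" by simp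
    have "(\<lambda>w. \<xi> w \<bullet> \<eta> w) \<in> borel_measurable (F a)"
      using assms F_measurable_mono[OF assms(9) ca] by simp
    from increments_product_ordered[OF assms(4-6) ca assms(2,3) this bd] show ?thesis
      using ca unfolding m by (simp add: ac_simps max_absorb1 inner_commute)
  qed
qed

end

section \<open>Simple processes\<close>

context brownian_basis
begin

text \<open>Squared L2 norms taken in [0, \<infinity>]: limits and estimates can be stated before
  anything is known to be square-integrable. \<open>rv_sq\<close> and \<open>proc_sq\<close> are the
  expressions inside \<open>has_ito_integral\<close> and \<open>L2F\<close>.\<close>

definition rv_sq :: "('w \<Rightarrow> 'e::euclidean_space) \<Rightarrow> ennreal" where
  "rv_sq X = (\<integral>\<^sup>+w. ennreal ((norm (X w))\<^sup>2) \<partial>M)"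

definition proc_sq :: "(real \<Rightarrow> 'w \<Rightarrow> 'e::euclidean_space) \<Rightarrow> ennreal" where
  "proc_sq \<phi> = (\<integral>\<^sup>+w. (\<integral>\<^sup>+t\<in>{0..T}. ennreal ((norm (\<phi> t w))\<^sup>2) \<partial>lborel) \<partial>M)"

lemma rv_sq_integrable:
  assumes "X \<in> borel_measurable M" "rv_sq X < \<infinity>"
  shows "integrable M (\<lambda>w. (norm (X w))\<^sup>2)"
  using assms unfolding rv_sq_def by (intro integrableI_nonneg) auto

lemma simple_val_sum: "simple_val l t w = (\<Sum>i<length l. indicator {fst (l ! i)<..fst (snd (l ! i))} t *\<^sub>R snd (snd (l ! i)) w)"
  unfolding simple_val_def by (simp add: sum_list_sum_nth case_prod_unfold atLeast0LessThan)

lemma simple_int_sum: "simple_int V l t w = (\<Sum>i<length l. (V (min (fst (snd (l ! i))) t) w - V (min (fst (l ! i)) t) w) *\<^sub>R snd (snd (l ! i)) w)"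
  unfolding simple_int_def by (simp add: sum_list_sum_nth case_prod_unfold atLeast0LessThan)

lemma simple_wf_nth:
  assumes "simple_wf M T W l" "i < length l"
  shows "0 \<le> fst (l ! i)" "fst (l ! i) \<le> fst (snd (l ! i))" "fst (snd (l ! i)) \<le> T"
    "snd (snd (l ! i)) \<in> borel_measurable (F (fst (l ! i)))" "bounded (snd (snd (l ! i)) ` space M)"
  using assms nth_mem[OF assms(2)] unfolding simple_wf_def by (auto simp: case_prod_unfold)

lemma simple_int_measurable:
  assumes "simple_wf M T W l" "t \<in> {0..T}"
  shows "simple_int W l t \<in> borel_measurable M"
proof -
  have "(\<lambda>w. (W (min (fst (snd (l ! i))) t) w - W (min (fst (l ! i)) t) w) *\<^sub>R snd (snd (l ! i)) w) \<in> borel_measurable M"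
    if "i < length l" for i
  proof (intro borel_measurable_scaleR borel_measurable_diff W_measurable)
    note wf = simple_wf_nth[OF assms(1) that]
    show "min (fst (snd (l ! i))) t \<in> {0..T}" "min (fst (l ! i)) t \<in> {0..T}" using wf assms(2) by auto
    show "snd (snd (l ! i)) \<in> borel_measurable M" using F_measurable_M[OF wf(4)] wf by simp
  qed
  then show ?thesis unfolding simple_int_sum by (intro borel_measurable_sum) auto
qed

text \<open>Expanding the square, each mixed term with U has mean zero because every interval starts
  at or after s. The double sum over the terms produces overlap lengths, and these are also what the
  time integral of the squared norm produces; overlapping intervals therefore do no harm. Carrying U
  along gives orthogonality to the past and the isometry at once.\<close>

lemma simple_isometry:
  fixes l :: "('w, 'e::euclidean_space) simple"
  assumes wf: "simple_wf M T W l" and U: "U \<in> borel_measurable (F s)" "rv_sq U < \<infinity>"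
    and s: "0 \<le> s" "s \<le> T" "\<And>a b \<xi>. (a, b, \<xi>) \<in> set l \<Longrightarrow> s \<le> a"
  shows "rv_sq (\<lambda>w. U w + simple_int W l T w) = rv_sq U + proc_sq (simple_val l)"
    and "proc_sq (simple_val l) < \<infinity>"
proof -
  define n where "n = length l"
  define a where "a i = fst (l ! i)" for i
  define b where "b i = fst (snd (l ! i))" for i
  define x where "x i = snd (snd (l ! i))" for i
  have w: "0 \<le> a i" "a i \<le> b i" "b i \<le> T" "x i \<in> borel_measurable (F (a i))" "bounded (x i ` space M)" "s \<le> a i" "a i \<le> T"
    if "i < n" for i
    using simple_wf_nth[OF wf, of i] s(3)[of "a i" "b i" "x i"] nth_mem[of i l] that unfolding a_def b_def x_def n_def by auto
  define D where "D i w = W (b i) w - W (a i) w" for i w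
  define m where "m i j = measure lborel ({a i<..b i} \<inter> {a j<..b j})" for i j
  define c where "c i j w = x i w \<bullet> x j w" for i j w
  have int_eq: "simple_int W l T w = (\<Sum>i<n. D i w *\<^sub>R x i w)" for w
    unfolding simple_int_sum n_def D_def a_def b_def x_def using simple_wf_nth[OF wf]
    by (intro sum.cong refl) (simp add: min_absorb1 order_trans[OF simple_wf_nth(2,3)[OF wf]])
  have val_eq: "simple_val l t w = (\<Sum>i<n. indicator {a i<..b i} t *\<^sub>R x i w)" for t w
    unfolding simple_val_sum n_def a_def b_def x_def ..
  have UM: "U \<in> borel_measurable M" using F_measurable_M[OF U(1) s(2)] .
  have U2: "integrable M (\<lambda>w. (norm (U w))\<^sup>2)" using rv_sq_integrable[OF UM U(2)] .
  have xM: "x i \<in> borel_measurable M" if "i < n" for i using F_measurable_M[OF w(4,7)] that by simp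
  obtain K where K: "\<And>i w. i < n \<Longrightarrow> w \<in> space M \<Longrightarrow> norm (x i w) \<le> K i"
    using w(5) unfolding bounded_iff by (metis imageI)
  have cint: "integrable M (c i j)" if "i < n" "j < n" for i j
    unfolding c_def
  proof (rule integrable_const_bound[of _ "K i * K j"])
    show "AE w in M. norm (x i w \<bullet> x j w) \<le> K i * K j"
    proof (rule AE_I2)
      fix w assume o: "w \<in> space M"
      have "norm (x i w \<bullet> x j w) \<le> norm (x i w) * norm (x j w)" by (simp add: Cauchy_Schwarz_ineq2)
      also have "\<dots> \<le> K i * K j"
        using K[OF that(1) o] K[OF that(2) o] by (intro mult_mono) (auto intro: order_trans[OF norm_ge_zero])
      finally show "norm (x i w \<bullet> x j w) \<le> K i * K j" .
    qed
  qed (use xM that in simp)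
  have cross: "has_bochner_integral M (\<lambda>w. (U w \<bullet> x i w) * D i w) 0" if i: "i < n" for i
  proof -
    have Ux: "(\<lambda>w. U w \<bullet> x i w) \<in> borel_measurable (F (a i))"
      using F_measurable_mono[OF U(1) w(6)[OF i]] w(4)[OF i] by simp
    \<comment> \<open>The bound |U| \<le> 1 + |U|^2 gives a dominating function from the second
      moment of U and the sup bound K i of the coefficient.\<close>
    have "integrable M (\<lambda>w. K i * (1 + (norm (U w))\<^sup>2))" using U2 by simp
    then have Uxi: "integrable M (\<lambda>w. U w \<bullet> x i w)"
    proof (rule Bochner_Integration.integrable_bound)
      show "AE w in M. norm (U w \<bullet> x i w) \<le> norm (K i * (1 + (norm (U w))\<^sup>2))"
      proof (rule AE_I2)
        fix w assume o: "w \<in> space M"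
        have "norm (U w \<bullet> x i w) \<le> norm (U w) * norm (x i w)" by (simp add: Cauchy_Schwarz_ineq2)
        also have "\<dots> \<le> norm (U w) * K i" using K[OF i o] by (intro mult_left_mono) auto
        also have "\<dots> \<le> (1 + (norm (U w))\<^sup>2) * K i"
        proof (rule mult_right_mono)
          show "norm (U w) \<le> 1 + (norm (U w))\<^sup>2"
          proof -
            have "2 * norm (U w) \<le> (norm (U w))\<^sup>2 + 1"
              using zero_le_power2[of "norm (U w) - 1"] by (simp add: power2_diff)
            then show ?thesis using norm_ge_zero[of "U w"] by linarith
          qed
          show "0 \<le> K i" using K[OF i o] norm_ge_zero order_trans by blast
        qed
        also have "\<dots> \<le> norm (K i * (1 + (norm (U w))\<^sup>2))" by (simp add: mult.commute)
        finally show "norm (U w \<bullet> x i w) \<le> norm (K i * (1 + (norm (U w))\<^sup>2))" .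
      qed
    qed (use UM xM i in simp)
    show ?thesis
      using increment_product(1,2)[OF w(1,2,3)[OF i] Ux Uxi]
      unfolding D_def has_bochner_integral_iff by simp
  qed
  have quad: "has_bochner_integral M (\<lambda>w. (D i w *\<^sub>R x i w) \<bullet> (D j w *\<^sub>R x j w)) (m i j * expectation (c i j))"
    if "i < n" "j < n" for i j
    using simple_term_product[OF w(1,2,3)[OF that(1)] w(1,2,3)[OF that(2)] w(4,5)[OF that(1)] w(4,5)[OF that(2)]]
    unfolding D_def m_def c_def .
  define S where "S = (\<Sum>i<n. \<Sum>j<n. m i j * expectation (c i j))"
  have "has_bochner_integral M (\<lambda>w. (norm (U w))\<^sup>2 + 2 * (\<Sum>i<n. (U w \<bullet> x i w) * D i w)
      + (\<Sum>i<n. \<Sum>j<n. (D i w *\<^sub>R x i w) \<bullet> (D j w *\<^sub>R x j w)))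
      (expectation (\<lambda>w. (norm (U w))\<^sup>2) + 2 * (\<Sum>i<n. 0) + S)"
    unfolding S_def
    by (intro has_bochner_integral_add has_bochner_integral_mult_right has_bochner_integral_sum cross quad)
       (use U2 in \<open>auto simp: has_bochner_integral_iff\<close>)
  moreover have "(norm (U w))\<^sup>2 + 2 * (\<Sum>i<n. (U w \<bullet> x i w) * D i w)
      + (\<Sum>i<n. \<Sum>j<n. (D i w *\<^sub>R x i w) \<bullet> (D j w *\<^sub>R x j w)) = (norm (U w + simple_int W l T w))\<^sup>2" for w
    unfolding int_eq power2_norm_eq_inner inner_add_left inner_add_right
    by (simp only: inner_sum_left inner_sum_right inner_scaleR_right inner_scaleR_left)
       (simp add: mult.commute mult.left_commute inner_commute sum_distrib_left)
  ultimately have left: "has_bochner_integral M (\<lambda>w. (norm (U w + simple_int W l T w))\<^sup>2)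
      (expectation (\<lambda>w. (norm (U w))\<^sup>2) + S)" by simp
  \<comment> \<open>q w is the time integral of the squared norm of the simple process along the
    path w, since products of indicators integrate to the overlap lengths. Its mean is the same S as
    on the stochastic side.\<close>
  define q where "q w = (\<Sum>i<n. \<Sum>j<n. m i j * c i j w)" for w
  have fin: "emeasure lborel ({p<..q} \<inter> {r<..u}) < \<infinity>" for p q r u :: real
    by (rule emeasure_bounded_finite, rule bounded_subset[of "{p..q}"]) auto
  have inner_val: "(\<integral>\<^sup>+t\<in>{0..T}. ennreal ((norm (simple_val l t w))\<^sup>2) \<partial>lborel) = ennreal (q w) \<and> 0 \<le> q w" for w
  proof -
    have "has_bochner_integral lborel (\<lambda>t. \<Sum>i<n. \<Sum>j<n. indicator ({a i<..b i} \<inter> {a j<..b j}) t * c i j w) (q w)"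
      unfolding q_def m_def
      by (intro has_bochner_integral_sum has_bochner_integral_mult_left has_bochner_integral_real_indicator fin) simp
    moreover have "(\<Sum>i<n. \<Sum>j<n. indicator ({a i<..b i} \<inter> {a j<..b j}) t * c i j w) = (norm (simple_val l t w))\<^sup>2" for t
      unfolding val_eq power2_norm_eq_inner c_def
      by (simp only: inner_sum_left inner_sum_right inner_scaleR_right inner_scaleR_left
          indicator_inter_arith sum_distrib_left mult.assoc)
         (intro sum.cong refl, simp only: inner_commute)
    ultimately have hb: "has_bochner_integral lborel (\<lambda>t. (norm (simple_val l t w))\<^sup>2) (q w)" by simp
    have zero: "simple_val l t w = 0" if "t \<notin> {0..T}" for t
      unfolding val_eq using that w(1,3)
      by (intro sum.neutral) (force simp: indicator_def)
    have "(\<integral>\<^sup>+t\<in>{0..T}. ennreal ((norm (simple_val l t w))\<^sup>2) \<partial>lborel) = (\<integral>\<^sup>+t. ennreal ((norm (simple_val l t w))\<^sup>2) \<partial>lborel)"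
      using zero by (intro nn_integral_cong) (auto simp: indicator_def)
    also have "\<dots> = ennreal (q w)"
      using hb by (subst nn_integral_eq_integral) (auto simp: has_bochner_integral_iff)
    finally have 1: "(\<integral>\<^sup>+t\<in>{0..T}. ennreal ((norm (simple_val l t w))\<^sup>2) \<partial>lborel) = ennreal (q w)" .
    have "0 \<le> (LBINT t. (norm (simple_val l t w))\<^sup>2)" by (rule integral_nonneg_AE) simp
    then show ?thesis
      using 1 hb unfolding has_bochner_integral_iff by simp
  qed
  have "has_bochner_integral M (\<lambda>w. \<Sum>i<n. \<Sum>j<n. m i j * c i j w) S"
    unfolding S_def using cint
    by (intro has_bochner_integral_sum has_bochner_integral_mult_right) (auto simp: has_bochner_integral_iff)
  then have qS: "integrable M q" "expectation q = S" unfolding q_def[abs_def] has_bochner_integral_iff by auto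
  have "proc_sq (simple_val l) = (\<integral>\<^sup>+w. ennreal (q w) \<partial>M)"
    unfolding proc_sq_def using inner_val by simp
  also have "\<dots> = ennreal (expectation q)"
    using inner_val qS by (intro nn_integral_eq_integral) auto
  finally have pS: "proc_sq (simple_val l) = ennreal S" unfolding qS .
  have S0: "0 \<le> S" using inner_val by (simp flip: qS(2) add: integral_nonneg_AE)
  have "rv_sq (\<lambda>w. U w + simple_int W l T w) = ennreal (expectation (\<lambda>w. (norm (U w))\<^sup>2) + S)"
    unfolding rv_sq_def using left
    by (subst nn_integral_eq_integral) (auto simp: has_bochner_integral_iff)
  also have "\<dots> = ennreal (expectation (\<lambda>w. (norm (U w))\<^sup>2)) + ennreal S"
    using S0 by (intro ennreal_plus) auto
  also have "ennreal (expectation (\<lambda>w. (norm (U w))\<^sup>2)) = rv_sq U"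
    unfolding rv_sq_def using U2 by (subst nn_integral_eq_integral) auto
  finally show "rv_sq (\<lambda>w. U w + simple_int W l T w) = rv_sq U + proc_sq (simple_val l)"
    using pS by simp
  show "proc_sq (simple_val l) < \<infinity>" using pS by simp
qed

text \<open>The left endpoint \<open>max s a\<close> is never below \<open>a\<close>, so that \<open>\<xi>\<close> stays measurable there.\<close>

definition simple_clip :: "real \<Rightarrow> real \<Rightarrow> ('w, 'e) simple \<Rightarrow> ('w, 'e) simple" where
  "simple_clip s r = map (\<lambda>(a, b, \<xi>). (max s a, max (max s a) (min b r), \<xi>))"

lemma simple_clip_wf:
  assumes "simple_wf M T W l" "0 \<le> s" "s \<le> r" "r \<le> T"
  shows "simple_wf M T W (simple_clip s r l)"
  unfolding simple_wf_def simple_clip_def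
proof (clarsimp)
  fix a b \<xi> assume "(a, b, \<xi>) \<in> set l"
  then have w: "0 \<le> a" "a \<le> b" "b \<le> T" "\<xi> \<in> borel_measurable (F a)" "bounded (\<xi> ` space M)"
    using assms(1) unfolding simple_wf_def by auto
  then show "0 \<le> max s a \<and> s \<le> T \<and> a \<le> T \<and> min b r \<le> T \<and> \<xi> \<in> borel_measurable (F (max s a)) \<and> bounded (\<xi> ` space M)"
    using assms F_measurable_mono[OF w(4), of "max s a"] by auto
qed

lemma simple_clip_val:
  assumes "s \<le> r"
  shows "simple_val (simple_clip s r l) t w = indicator {s<..r} t *\<^sub>R simple_val l t w"
proof -
  have "indicator {max s a<..max (max s a) (min b r)} t = (indicator {s<..r} t * indicator {a<..b} t :: real)" for a b
    using assms by (auto simp: indicator_def max_def min_def)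
  then show ?thesis
    unfolding simple_val_def simple_clip_def
    by (induction l) (auto simp: scaleR_add_right)
qed

lemma simple_clip_int:
  assumes "simple_wf M T W l" "s \<le> r"
  shows "simple_int W (simple_clip s r l) t w = simple_int W l (min r t) w - simple_int W l (min s t) w"
proof -
  \<comment> \<open>An interval that misses (s, r] has become empty and both sides vanish for it; in
    the other cases the identity is additivity of increments.\<close>
  have *: "W (min (max (max s a) (min b r)) t) w - W (min (max s a) t) w
    = (W (min b (min r t)) w - W (min a (min r t)) w) - (W (min b (min s t)) w - W (min a (min s t)) w)"
    if "a \<le> b" for a b
    using assms(2) that by (auto simp: max_def min_def)
  have "\<And>a b \<xi>. (a, b, \<xi>) \<in> set l \<Longrightarrow> a \<le> b" using assms(1) unfolding simple_wf_def by auto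
  then have "simple_int W (simple_clip s r l) t w
     = (\<Sum>(a, b, \<xi>)\<leftarrow>l. ((W (min b (min r t)) w - W (min a (min r t)) w) -
          (W (min b (min s t)) w - W (min a (min s t)) w)) *\<^sub>R \<xi> w)"
    unfolding simple_int_def simple_clip_def map_map o_def
    by (intro arg_cong[where f = sum_list] map_cong refl) (clarsimp simp only: prod.case *)
  also have "\<dots> = simple_int W l (min r t) w - simple_int W l (min s t) w"
    unfolding simple_int_def by (simp add: case_prod_unfold scaleR_left.diff sum_list_subtractf)
  finally show ?thesis .
qed

end

section \<open>The Ito integral\<close>

context brownian_basis
begin

text \<open>Measurability for the full sigma-algebra of M, as used by Tonelli's theorem and by
  sections at fixed time or fixed path. Adaptedness is tracked separately by
  \<open>prog_measurable\<close>.\<close>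

definition joint :: "(real \<Rightarrow> 'w \<Rightarrow> 'e::euclidean_space) \<Rightarrow> bool" where
  "joint \<phi> \<longleftrightarrow> (\<lambda>(t, w). \<phi> t w) \<in> borel_measurable (restrict_space lborel {0..T} \<Otimes>\<^sub>M M)"

abbreviation LT :: "real measure" where "LT \<equiv> restrict_space lborel {0..T}"

lemma sets_LT: "sets LT = sets (restrict_space borel {0..T})"
  by (rule sets_restrict_space_cong) simp

lemma space_LT: "space LT = {0..T}"
  by (simp add: space_restrict_space)

lemma sigma_finite_LT: "sigma_finite_measure LT"
  by (rule sigma_finite_measure_restrict_space) (auto simp: sigma_finite_lborel)

lemma pair_sigma_finite_LT: "pair_sigma_finite LT M"
  unfolding pair_sigma_finite_def using sigma_finite_LT sigma_finite_measure_axioms by blast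

lemma nn_integral_LT: "(\<integral>\<^sup>+t\<in>{0..T}. f t \<partial>lborel) = (\<integral>\<^sup>+t. f t \<partial>LT)"
  by (subst nn_integral_restrict_space) auto

lemma joint_rv: "joint \<phi> \<Longrightarrow> t \<in> {0..T} \<Longrightarrow> \<phi> t \<in> borel_measurable M"
  unfolding joint_def by (drule measurable_Pair2[where x = t]) (simp_all add: space_LT)

lemma joint_path: "joint \<phi> \<Longrightarrow> w \<in> space M \<Longrightarrow> (\<lambda>t. \<phi> t w) \<in> borel_measurable LT"
  unfolding joint_def by (drule measurable_Pair1[where y = w]) simp_all

text \<open>Tonelli's theorem. As an integral over one product space the squared norm of a process
  falls under the general results on squared integrals.\<close>

lemma proc_sq_pair:
  assumes "joint \<phi>"
  shows "proc_sq \<phi> = (\<integral>\<^sup>+p. ennreal ((norm (case p of (t, w) \<Rightarrow> \<phi> t w))\<^sup>2) \<partial>(LT \<Otimes>\<^sub>M M))"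
proof -
  interpret P: pair_sigma_finite LT M by (rule pair_sigma_finite_LT)
  have "(\<lambda>p. ennreal ((norm (case p of (t, w) \<Rightarrow> \<phi> t w))\<^sup>2)) \<in> borel_measurable (LT \<Otimes>\<^sub>M M)"
    using assms unfolding joint_def by simp
  from P.nn_integral_snd[OF this] show ?thesis
    unfolding proc_sq_def nn_integral_LT by simp
qed

text \<open>Progressive measurability at t = T already covers the whole time interval, and F T is
  contained in M.\<close>

lemma prog_measurable_joint:
  assumes "prog_measurable M T W \<phi>" shows "joint \<phi>"
proof -
  have 1: "(\<lambda>(s, w). \<phi> s w) \<in> borel_measurable (restrict_space borel {0..T} \<Otimes>\<^sub>M F T)"
    using assms T_pos unfolding prog_measurable_def by auto
  have "(\<lambda>p. p) \<in> measurable (LT \<Otimes>\<^sub>M M) (restrict_space borel {0..T} \<Otimes>\<^sub>M F T)"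
  proof (rule measurable_pair)
    show "fst \<circ> (\<lambda>p. p) \<in> measurable (LT \<Otimes>\<^sub>M M) (restrict_space borel {0..T})"
      by (simp add: comp_def measurable_cong_sets[OF refl sets_LT[symmetric]])
    have "(\<lambda>x. x) \<in> measurable M (F T)"
      by (rule measurable_from_subalg[OF F_subalgebra[of T]]) simp_all
    then show "snd \<circ> (\<lambda>p. p) \<in> measurable (LT \<Otimes>\<^sub>M M) (F T)"
      unfolding comp_def by (rule measurable_compose[OF measurable_snd])
  qed
  from measurable_compose[OF this 1] show ?thesis unfolding joint_def by simp
qed

lemma L2F_joint: "\<phi> \<in> L2F M T W \<Longrightarrow> joint \<phi>"
  unfolding L2F_def by (auto intro: prog_measurable_joint)

lemma L2F_iff: "\<phi> \<in> L2F M T W \<longleftrightarrow> prog_measurable M T W \<phi> \<and> proc_sq \<phi> < \<infinity>"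
  unfolding L2F_def proc_sq_def by simp

section \<open>Linear operations on processes and estimates of their squared norms\<close>

lemma joint_add: "joint \<phi> \<Longrightarrow> joint \<psi> \<Longrightarrow> joint (\<lambda>t w. \<phi> t w + \<psi> t w)"
  unfolding joint_def split_beta by simp

lemma joint_diff: "joint \<phi> \<Longrightarrow> joint \<psi> \<Longrightarrow> joint (\<lambda>t w. \<phi> t w - \<psi> t w)"
  unfolding joint_def split_beta by simp

lemma joint_time:
  assumes "f \<in> borel_measurable LT"
  shows "(\<lambda>p. f (fst p)) \<in> borel_measurable (LT \<Otimes>\<^sub>M M)"
  using measurable_compose[OF measurable_fst assms] .

lemma proc_sq_add_le:
  assumes "joint \<phi>" "joint \<psi>" "e > 0"
  shows "proc_sq (\<lambda>t w. \<phi> t w + \<psi> t w) \<le> ennreal (1 + e) * proc_sq \<phi> + ennreal (1 + 1 / e) * proc_sq \<psi>"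
  using nn_integral_sq_add_le[OF assms(3) assms(1,2)[unfolded joint_def]]
  unfolding proc_sq_pair[OF assms(1)] proc_sq_pair[OF assms(2)] proc_sq_pair[OF joint_add[OF assms(1,2)]]
  by (simp add: split_beta)

text \<open>Simple processes are built on left-open intervals and vanish at time 0. Discarding this
  null set allows pointwise bounds that hold on (0, T] only.\<close>

lemma AE_LT_pos: "AE t in LT. 0 < t \<and> t \<le> T"
proof -
  have "AE t in lborel. t \<noteq> (0::real)" by (rule AE_lborel_singleton)
  then show ?thesis by (subst AE_restrict_space_iff) (auto elim!: eventually_mono)
qed

lemma proc_sq_mono:
  assumes "\<And>t w. t \<in> {0<..T} \<Longrightarrow> w \<in> space M \<Longrightarrow> norm (\<phi> t w) \<le> norm (\<psi> t w)"
  shows "proc_sq \<phi> \<le> proc_sq \<psi>"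
  unfolding proc_sq_def nn_integral_LT
proof (rule nn_integral_mono, rule nn_integral_mono_AE)
  fix w assume o: "w \<in> space M"
  show "AE t in LT. ennreal ((norm (\<phi> t w))\<^sup>2) \<le> ennreal ((norm (\<psi> t w))\<^sup>2)"
    using AE_LT_pos
  proof eventually_elim
    case (elim t)
    with assms[OF _ o, of t] show ?case by (intro ennreal_leI power_mono) auto
  qed
qed

lemma proc_sq_scale:
  assumes "joint \<psi>" "\<And>t w. t \<in> {0<..T} \<Longrightarrow> w \<in> space M \<Longrightarrow> norm (\<phi> t w) \<le> K * norm (\<psi> t w)" "0 \<le> K"
  shows "proc_sq \<phi> \<le> ennreal (K\<^sup>2) * proc_sq \<psi>"
proof -
  have j: "joint (\<lambda>t w. K *\<^sub>R \<psi> t w)" using assms(1) unfolding joint_def split_beta by simp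
  have "proc_sq \<phi> \<le> proc_sq (\<lambda>t w. K *\<^sub>R \<psi> t w)"
    using assms by (intro proc_sq_mono) auto
  also have "\<dots> = (\<integral>\<^sup>+p. ennreal (K\<^sup>2) * ennreal ((norm (case p of (t, w) \<Rightarrow> \<psi> t w))\<^sup>2) \<partial>(LT \<Otimes>\<^sub>M M))"
    unfolding proc_sq_pair[OF j]
    by (intro nn_integral_cong) (simp add: split_beta power_mult_distrib ennreal_mult)
  also have "\<dots> = ennreal (K\<^sup>2) * proc_sq \<psi>"
    unfolding proc_sq_pair[OF assms(1)] using assms(1)
    by (intro nn_integral_cmult) (simp add: joint_def)
  finally show ?thesis .
qed

lemma proc_sq_minus: "proc_sq (\<lambda>t w. \<phi> t w - \<psi> t w) = proc_sq (\<lambda>t w. \<psi> t w - \<phi> t w)"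
  unfolding proc_sq_def by (simp add: norm_minus_commute)

lemma rv_sq_add_le:
  assumes "X \<in> borel_measurable M" "Y \<in> borel_measurable M"
  shows "rv_sq (\<lambda>w. X w + Y w) \<le> 2 * rv_sq X + 2 * rv_sq Y"
  using nn_integral_sq_add_le[of 1 X M Y] assms unfolding rv_sq_def by simp

lemma rv_sq_minus: "rv_sq (\<lambda>w. X w - Y w) = rv_sq (\<lambda>w. Y w - X w)"
  unfolding rv_sq_def by (simp add: norm_minus_commute)

lemma rv_sq_cong_AE: "AE w in M. X w = Y w \<Longrightarrow> rv_sq X = rv_sq Y"
  unfolding rv_sq_def by (rule nn_integral_cong_AE) auto

lemma rv_sq_eq_0: "X \<in> borel_measurable M \<Longrightarrow> rv_sq X = 0 \<longleftrightarrow> (AE w in M. X w = 0)"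
  unfolding rv_sq_def by (subst nn_integral_0_iff_AE) auto

lemma tendsto_0_le_ennreal:
  fixes f h :: "nat \<Rightarrow> ennreal"
  assumes "\<And>n. f n \<le> h n" "h \<longlonglongrightarrow> 0"
  shows "f \<longlonglongrightarrow> 0"
  by (rule tendsto_sandwich[OF _ _ tendsto_const assms(2)]) (use assms(1) in auto)

lemma tendsto_0_lin_ennreal:
  fixes f g :: "nat \<Rightarrow> ennreal"
  assumes "f \<longlonglongrightarrow> 0" "g \<longlonglongrightarrow> 0" "a < top" "b < top"
  shows "(\<lambda>n. a * f n + b * g n) \<longlonglongrightarrow> 0"
  using tendsto_add[OF ennreal_tendsto_cmult[OF assms(3,1)] ennreal_tendsto_cmult[OF assms(4,2)]] by simp

section \<open>Progressive measurability\<close>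

lemma prog_measurableI:
  assumes "\<And>t. t \<in> {0..T} \<Longrightarrow> (\<lambda>p. \<phi> (fst p) (snd p)) \<in> borel_measurable (restrict_space borel {0..t} \<Otimes>\<^sub>M F t)"
  shows "prog_measurable M T W \<phi>"
  unfolding prog_measurable_def split_beta' using assms by blast

lemma prog_measurableD:
  assumes "prog_measurable M T W \<phi>" "t \<in> {0..T}"
  shows "(\<lambda>p. \<phi> (fst p) (snd p)) \<in> borel_measurable (restrict_space borel {0..t} \<Otimes>\<^sub>M F t)"
  using bspec[OF assms[unfolded prog_measurable_def]] by (simp add: split_beta')

lemma prog_measurable_adapted:
  assumes "prog_measurable M T W \<phi>" "t \<in> {0..T}"
  shows "\<phi> t \<in> borel_measurable (F t)"
  using measurable_Pair2[OF prog_measurableD[OF assms], of t] assms(2) by (simp add: space_restrict_space)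

lemma prog_measurable_add:
  "prog_measurable M T W \<phi> \<Longrightarrow> prog_measurable M T W \<psi> \<Longrightarrow> prog_measurable M T W (\<lambda>t w. \<phi> t w + \<psi> t w)"
  by (rule prog_measurableI) (intro borel_measurable_add prog_measurableD)

lemma prog_measurable_continuous:
  assumes "prog_measurable M T W \<phi>" "continuous_on UNIV f"
  shows "prog_measurable M T W (\<lambda>t w. f (\<phi> t w))"
  by (rule prog_measurableI) (intro borel_measurable_continuous_on[OF assms(2)] prog_measurableD assms(1))

lemma restrict_measurable_mono:
  assumes "f \<in> measurable (restrict_space borel {0..T}) N" "t \<le> T"
  shows "f \<in> measurable (restrict_space borel {0..t::real}) N"
proof -
  have "f \<in> measurable (restrict_space (restrict_space borel {0..T}) {0..t}) N"
    using assms(1) by (rule measurable_restrict_space1)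
  also have "restrict_space (restrict_space borel {0..T}) {0..t} = restrict_space borel {0..t}"
    using assms(2) by (subst restrict_restrict_space) (auto simp: Int_absorb1)
  finally show ?thesis .
qed

lemma prog_measurable_time:
  assumes "f \<in> borel_measurable (restrict_space borel {0..T})"
  shows "prog_measurable M T W (\<lambda>t w. f t)"
proof (rule prog_measurableI)
  fix t assume "t \<in> {0..T}"
  then show "(\<lambda>p. f (fst p)) \<in> borel_measurable (restrict_space borel {0..t} \<Otimes>\<^sub>M F t)"
    by (intro measurable_compose[OF measurable_fst restrict_measurable_mono[OF assms]]) auto
qed

lemma prog_measurable_simple_val:
  assumes "simple_wf M T W l"
  shows "prog_measurable M T W (simple_val l)"
proof (rule prog_measurableI)
  fix t assume t: "t \<in> {0..T}"
  have "(\<lambda>p. indicator {fst (l ! i)<..fst (snd (l ! i))} (fst p) *\<^sub>R snd (snd (l ! i)) (snd p))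
      \<in> borel_measurable (restrict_space borel {0..t} \<Otimes>\<^sub>M F t)" (is "?f \<in> _") if i: "i < length l" for i
  proof (cases "fst (l ! i) \<le> t")
    case True
    have "snd (snd (l ! i)) \<in> borel_measurable (F t)"
      using F_measurable_mono[OF simple_wf_nth(4)[OF assms i] True] .
    then have 1: "(\<lambda>p. snd (snd (l ! i)) (snd p)) \<in> borel_measurable (restrict_space borel {0..t} \<Otimes>\<^sub>M F t)"
      by (rule measurable_compose[OF measurable_snd])
    have "indicator {fst (l ! i)<..fst (snd (l ! i))} \<in> borel_measurable (restrict_space borel {0..t})"
      by (rule measurable_restrict_space1) simp
    then have "(\<lambda>p. indicator {fst (l ! i)<..fst (snd (l ! i))} (fst p) :: real) \<in> borel_measurable (restrict_space borel {0..t} \<Otimes>\<^sub>M F t)"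
      by (rule measurable_compose[OF measurable_fst])
    then show ?thesis using 1 by (rule borel_measurable_scaleR)
  next
    \<comment> \<open>Here the coefficient is known to be measurable only at a time later than t,
      but the indicator of its interval vanishes on [0, t].\<close>
    case False
    then have "?f p = 0" if "p \<in> space (restrict_space borel {0..t} \<Otimes>\<^sub>M F t)" for p
      using that by (auto simp: space_pair_measure space_restrict_space)
    then show ?thesis by (subst measurable_cong[where g = "\<lambda>_. 0"]) auto
  qed
  then show "(\<lambda>p. simple_val l (fst p) (snd p)) \<in> borel_measurable (restrict_space borel {0..t} \<Otimes>\<^sub>M F t)"
    unfolding simple_val_sum by (intro borel_measurable_sum) auto
qed

lemma rv_sq_0 [simp]: "rv_sq (\<lambda>_. 0) = 0" by (simp add: rv_sq_def)

lemma proc_sq_simple_finite: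
  fixes l :: "('w, 'e::euclidean_space) simple"
  assumes "simple_wf M T W l" shows "proc_sq (simple_val l) < \<infinity>"
proof -
  have 1: "0 \<le> a" if "(a, b, \<xi>) \<in> set l" for a b \<xi> using assms that unfolding simple_wf_def by auto
  have 2: "(\<lambda>_. 0 :: 'e) \<in> borel_measurable (F 0)" "rv_sq (\<lambda>_. 0 :: 'e) < \<infinity>" by simp_all
  show ?thesis by (rule simple_isometry(2)[OF assms 2 order_refl less_imp_le[OF T_pos] 1])
qed

lemma simple_L2F: "simple_wf M T W l \<Longrightarrow> simple_val l \<in> L2F M T W"
  unfolding L2F_iff using prog_measurable_simple_val[of l] proc_sq_simple_finite[of l] by blast

section \<open>Linear operations on Ito integrals\<close>

lemma has_ito_integral_iff:
  "has_ito_integral M T W \<phi> I \<longleftrightarrow> \<phi> \<in> L2F M T W \<and> (\<forall>t\<in>{0..T}. I t \<in> borel_measurable M) \<and>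
    (\<exists>l. (\<forall>n. simple_wf M T W (l n)) \<and> (\<lambda>n. proc_sq (\<lambda>t w. simple_val (l n) t w - \<phi> t w)) \<longlonglongrightarrow> 0 \<and>
      (\<forall>t\<in>{0..T}. (\<lambda>n. rv_sq (\<lambda>w. simple_int W (l n) t w - I t w)) \<longlonglongrightarrow> 0))"
  unfolding has_ito_integral_def proc_sq_def rv_sq_def ..

lemma ito_simple:
  assumes "simple_wf M T W l" shows "has_ito_integral M T W (simple_val l) (simple_int W l)"
  unfolding has_ito_integral_iff
proof (intro conjI exI[of _ "\<lambda>_. l"] ballI allI)
  show "simple_val l \<in> L2F M T W" by (rule simple_L2F[OF assms])
  show "simple_int W l t \<in> borel_measurable M" if "t \<in> {0..T}" for t
    by (rule simple_int_measurable[OF assms that])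
qed (simp_all add: assms proc_sq_def rv_sq_def)

lemma ito_measurable: "has_ito_integral M T W \<phi> I \<Longrightarrow> t \<in> {0..T} \<Longrightarrow> I t \<in> borel_measurable M"
  unfolding has_ito_integral_iff by auto

lemma ito_L2F: "has_ito_integral M T W \<phi> I \<Longrightarrow> \<phi> \<in> L2F M T W"
  unfolding has_ito_integral_iff by auto

lemma L2F_add:
  assumes "\<phi> \<in> L2F M T W" "\<psi> \<in> L2F M T W" shows "(\<lambda>t w. \<phi> t w + \<psi> t w) \<in> L2F M T W"
proof -
  have "proc_sq (\<lambda>t w. \<phi> t w + \<psi> t w) \<le> ennreal (1 + 1) * proc_sq \<phi> + ennreal (1 + 1 / 1) * proc_sq \<psi>"
    by (intro proc_sq_add_le L2F_joint assms) simp
  also have "\<dots> < \<infinity>" using assms unfolding L2F_iff by (simp add: ennreal_mult_less_top)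
  finally show ?thesis using assms prog_measurable_add[of \<phi> \<psi>] unfolding L2F_iff by simp
qed

lemma L2F_linear:
  assumes "\<phi> \<in> L2F M T W" "bounded_linear L" shows "(\<lambda>t w. L (\<phi> t w)) \<in> L2F M T W"
proof -
  interpret bounded_linear L by fact
  obtain K where K: "0 \<le> K" "\<And>x. norm (L x) \<le> K * norm x" using nonneg_bounded by (auto simp: mult.commute)
  have "proc_sq (\<lambda>t w. L (\<phi> t w)) \<le> ennreal (K\<^sup>2) * proc_sq \<phi>"
    by (intro proc_sq_scale L2F_joint assms(1) K)
  also have "\<dots> < \<infinity>" using assms unfolding L2F_iff by (simp add: ennreal_mult_less_top)
  finally show ?thesis
    using assms prog_measurable_continuous[OF _ linear_continuous_on[OF assms(2)], of \<phi>] unfolding L2F_iff by simp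
qed

text \<open>Since the intervals of a simple process may overlap, the sum of two of them is the
  concatenated list; no common refinement has to be built.\<close>

lemma ito_add:
  assumes "has_ito_integral M T W \<phi> I" "has_ito_integral M T W \<psi> J"
  shows "has_ito_integral M T W (\<lambda>t w. \<phi> t w + \<psi> t w) (\<lambda>t w. I t w + J t w)"
proof -
  obtain l where l: "\<And>n. simple_wf M T W (l n)" "(\<lambda>n. proc_sq (\<lambda>t w. simple_val (l n) t w - \<phi> t w)) \<longlonglongrightarrow> 0"
      "\<And>t. t \<in> {0..T} \<Longrightarrow> (\<lambda>n. rv_sq (\<lambda>w. simple_int W (l n) t w - I t w)) \<longlonglongrightarrow> 0"
    using assms(1) unfolding has_ito_integral_iff by blast
  obtain k where k: "\<And>n. simple_wf M T W (k n)" "(\<lambda>n. proc_sq (\<lambda>t w. simple_val (k n) t w - \<psi> t w)) \<longlonglongrightarrow> 0"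
      "\<And>t. t \<in> {0..T} \<Longrightarrow> (\<lambda>n. rv_sq (\<lambda>w. simple_int W (k n) t w - J t w)) \<longlonglongrightarrow> 0"
    using assms(2) unfolding has_ito_integral_iff by blast
  have wf: "simple_wf M T W (l n @ k n)" for n using l(1)[of n] k(1)[of n] unfolding simple_wf_def by auto
  have 1: "(\<lambda>n. proc_sq (\<lambda>t w. simple_val (l n @ k n) t w - (\<phi> t w + \<psi> t w))) \<longlonglongrightarrow> 0"
  proof (rule tendsto_0_le_ennreal)
    fix n
    have "proc_sq (\<lambda>t w. simple_val (l n @ k n) t w - (\<phi> t w + \<psi> t w))
      = proc_sq (\<lambda>t w. (simple_val (l n) t w - \<phi> t w) + (simple_val (k n) t w - \<psi> t w))"
      by (simp add: simple_val_def algebra_simps)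
    also have "\<dots> \<le> ennreal (1 + 1) * proc_sq (\<lambda>t w. simple_val (l n) t w - \<phi> t w)
        + ennreal (1 + 1 / 1) * proc_sq (\<lambda>t w. simple_val (k n) t w - \<psi> t w)"
      by (intro proc_sq_add_le joint_diff L2F_joint simple_L2F l(1) k(1) assms[THEN ito_L2F]) simp
    finally show "proc_sq (\<lambda>t w. simple_val (l n @ k n) t w - (\<phi> t w + \<psi> t w)) \<le>
        ennreal (1 + 1) * proc_sq (\<lambda>t w. simple_val (l n) t w - \<phi> t w)
        + ennreal (1 + 1 / 1) * proc_sq (\<lambda>t w. simple_val (k n) t w - \<psi> t w)" .
  qed (intro tendsto_0_lin_ennreal l k; simp)
  have 2: "(\<lambda>n. rv_sq (\<lambda>w. simple_int W (l n @ k n) t w - (I t w + J t w))) \<longlonglongrightarrow> 0" if t: "t \<in> {0..T}" for t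
  proof (rule tendsto_0_le_ennreal)
    fix n
    have "rv_sq (\<lambda>w. simple_int W (l n @ k n) t w - (I t w + J t w))
      = rv_sq (\<lambda>w. (simple_int W (l n) t w - I t w) + (simple_int W (k n) t w - J t w))"
      by (simp add: simple_int_def algebra_simps)
    also have "\<dots> \<le> 2 * rv_sq (\<lambda>w. simple_int W (l n) t w - I t w) + 2 * rv_sq (\<lambda>w. simple_int W (k n) t w - J t w)"
      by (intro rv_sq_add_le borel_measurable_diff simple_int_measurable l(1) k(1) t
          ito_measurable[OF assms(1)] ito_measurable[OF assms(2)])
    finally show "rv_sq (\<lambda>w. simple_int W (l n @ k n) t w - (I t w + J t w)) \<le>
      2 * rv_sq (\<lambda>w. simple_int W (l n) t w - I t w) + 2 * rv_sq (\<lambda>w. simple_int W (k n) t w - J t w)" .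
  qed (intro tendsto_0_lin_ennreal l k t; simp)
  show ?thesis
    unfolding has_ito_integral_iff
  proof (intro conjI ballI exI[of _ "\<lambda>n. l n @ k n"] allI)
    show "(\<lambda>t w. \<phi> t w + \<psi> t w) \<in> L2F M T W" using assms[THEN ito_L2F] by (rule L2F_add)
    show "(\<lambda>w. I t w + J t w) \<in> borel_measurable M" if "t \<in> {0..T}" for t
      using assms[THEN ito_measurable[OF _ that]] by simp
  qed (rule wf 1 2, assumption?)+
qed

lemma ito_linear:
  assumes "has_ito_integral M T W \<phi> I" "bounded_linear L"
  shows "has_ito_integral M T W (\<lambda>t w. L (\<phi> t w)) (\<lambda>t w. L (I t w))"
proof -
  interpret bounded_linear L by fact
  obtain K where K: "0 \<le> K" "\<And>x. norm (L x) \<le> K * norm x" using nonneg_bounded by (auto simp: mult.commute)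
  obtain l where l: "\<And>n. simple_wf M T W (l n)" "(\<lambda>n. proc_sq (\<lambda>t w. simple_val (l n) t w - \<phi> t w)) \<longlonglongrightarrow> 0"
      "\<And>t. t \<in> {0..T} \<Longrightarrow> (\<lambda>n. rv_sq (\<lambda>w. simple_int W (l n) t w - I t w)) \<longlonglongrightarrow> 0"
    using assms(1) unfolding has_ito_integral_iff by blast
  define k where "k n = map (\<lambda>(a, b, \<xi>). (a, b, \<lambda>w. L (\<xi> w))) (l n)" for n
  have Lm: "L \<in> borel_measurable borel"
    by (intro borel_measurable_continuous_onI linear_continuous_on assms(2))
  have bd: "bounded ((\<lambda>w. L (\<xi> w)) ` space M)" if "bounded (\<xi> ` space M)" for \<xi> :: "'w \<Rightarrow> 'a"
    using bounded_linear_image[OF that assms(2)] by (simp add: image_image)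
  have wf: "simple_wf M T W (k n)" for n
    using l(1)[of n] unfolding simple_wf_def k_def
    by (auto intro: measurable_compose[OF _ Lm] bd split: prod.splits)
  have "simple_val (map (\<lambda>(a, b, \<xi>). (a, b, \<lambda>w. L (\<xi> w))) ll) t w = L (simple_val ll t w)" for ll t w
    unfolding simple_val_def by (induction ll) (auto simp: add scaleR zero)
  then have val: "simple_val (k n) t w = L (simple_val (l n) t w)" for n t w unfolding k_def .
  have "simple_int W (map (\<lambda>(a, b, \<xi>). (a, b, \<lambda>w. L (\<xi> w))) ll) t w = L (simple_int W ll t w)" for ll t w
    unfolding simple_int_def by (induction ll) (auto simp: add scaleR zero)
  then have int: "simple_int W (k n) t w = L (simple_int W (l n) t w)" for n t w unfolding k_def .
  have 1: "(\<lambda>n. proc_sq (\<lambda>t w. simple_val (k n) t w - L (\<phi> t w))) \<longlonglongrightarrow> 0"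
  proof (rule tendsto_0_le_ennreal)
    fix n
    show "proc_sq (\<lambda>t w. simple_val (k n) t w - L (\<phi> t w)) \<le> ennreal (K\<^sup>2) * proc_sq (\<lambda>t w. simple_val (l n) t w - \<phi> t w)"
      unfolding val diff[symmetric]
      by (intro proc_sq_scale joint_diff L2F_joint simple_L2F l(1) assms(1)[THEN ito_L2F] K)
  next
    show "(\<lambda>n. ennreal (K\<^sup>2) * proc_sq (\<lambda>t w. simple_val (l n) t w - \<phi> t w)) \<longlonglongrightarrow> 0"
      using ennreal_tendsto_cmult[OF _ l(2), of "ennreal (K\<^sup>2)"] by simp
  qed
  have 2: "(\<lambda>n. rv_sq (\<lambda>w. simple_int W (k n) t w - L (I t w))) \<longlonglongrightarrow> 0" if t: "t \<in> {0..T}" for t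
  proof (rule tendsto_0_le_ennreal)
    fix n
    have "rv_sq (\<lambda>w. simple_int W (k n) t w - L (I t w))
        \<le> (\<integral>\<^sup>+w. ennreal (K\<^sup>2) * ennreal ((norm (simple_int W (l n) t w - I t w))\<^sup>2) \<partial>M)"
      unfolding rv_sq_def int diff[symmetric]
    proof (intro nn_integral_mono)
      fix w
      have "(norm (L (simple_int W (l n) t w - I t w)))\<^sup>2 \<le> (K * norm (simple_int W (l n) t w - I t w))\<^sup>2"
        by (intro power_mono K) simp
      then show "ennreal ((norm (L (simple_int W (l n) t w - I t w)))\<^sup>2)
          \<le> ennreal (K\<^sup>2) * ennreal ((norm (simple_int W (l n) t w - I t w))\<^sup>2)"
        by (simp add: power_mult_distrib ennreal_mult[symmetric] ennreal_leI)
    qed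
    also have "\<dots> = ennreal (K\<^sup>2) * rv_sq (\<lambda>w. simple_int W (l n) t w - I t w)"
      unfolding rv_sq_def using simple_int_measurable[OF l(1) t] ito_measurable[OF assms(1) t]
      by (intro nn_integral_cmult) simp
    finally show "rv_sq (\<lambda>w. simple_int W (k n) t w - L (I t w)) \<le> ennreal (K\<^sup>2) * rv_sq (\<lambda>w. simple_int W (l n) t w - I t w)" .
  next
    show "(\<lambda>n. ennreal (K\<^sup>2) * rv_sq (\<lambda>w. simple_int W (l n) t w - I t w)) \<longlonglongrightarrow> 0"
      using ennreal_tendsto_cmult[OF _ l(3)[OF t], of "ennreal (K\<^sup>2)"] by simp
  qed
  show ?thesis
    unfolding has_ito_integral_iff
  proof (intro conjI ballI exI[of _ k] allI)
    show "(\<lambda>t w. L (\<phi> t w)) \<in> L2F M T W" using assms(1)[THEN ito_L2F] assms(2) by (rule L2F_linear)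
    show "(\<lambda>w. L (I t w)) \<in> borel_measurable M" if "t \<in> {0..T}" for t
      using measurable_compose[OF ito_measurable[OF assms(1) that] Lm] .
  qed (rule wf 1 2, assumption?)+
qed

lemma ito_diff:
  assumes "has_ito_integral M T W \<phi> I" "has_ito_integral M T W \<psi> J"
  shows "has_ito_integral M T W (\<lambda>t w. \<phi> t w - \<psi> t w) (\<lambda>t w. I t w - J t w)"
  using ito_add[OF assms(1) ito_linear[OF assms(2) bounded_linear_minus[OF bounded_linear_ident]]] by simp

lemma L2F_indicator:
  assumes "\<phi> \<in> L2F M T W" shows "(\<lambda>t w. indicator {s<..r} t *\<^sub>R \<phi> t w) \<in> L2F M T W"
proof -
  have "proc_sq (\<lambda>t w. indicator {s<..r} t *\<^sub>R \<phi> t w) \<le> proc_sq \<phi>"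
    by (intro proc_sq_mono) (simp add: indicator_def)
  also have "\<dots> < \<infinity>" using assms unfolding L2F_iff by simp
  finally have 1: "proc_sq (\<lambda>t w. indicator {s<..r} t *\<^sub>R \<phi> t w) < \<infinity>" .
  have "prog_measurable M T W (\<lambda>t w. indicator {s<..r} t *\<^sub>R \<phi> t w)"
  proof (rule prog_measurableI)
    fix t assume t: "t \<in> {0..T}"
    have "indicator {s<..r} \<in> borel_measurable (restrict_space borel {0..T})"
      by (rule measurable_restrict_space1) simp
    from prog_measurableD[OF prog_measurable_time[OF this] t] prog_measurableD[of \<phi>, OF _ t] assms
    show "(\<lambda>p. indicator {s<..r} (fst p) *\<^sub>R \<phi> (fst p) (snd p)) \<in> borel_measurable (restrict_space borel {0..t} \<Otimes>\<^sub>M F t)"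
      unfolding L2F_iff by (intro borel_measurable_scaleR) auto
  qed
  with 1 show ?thesis unfolding L2F_iff by simp
qed

text \<open>Clipping the approximating simple processes does not increase their distance to the
  integrand, and their integrals become differences of two values. An increment of I is thereby
  itself the terminal value of an Ito integral.\<close>

lemma ito_clip:
  assumes "has_ito_integral M T W \<phi> I" "0 \<le> s" "s \<le> r" "r \<le> T"
  shows "has_ito_integral M T W (\<lambda>t w. indicator {s<..r} t *\<^sub>R \<phi> t w) (\<lambda>t w. I (min r t) w - I (min s t) w)"
proof -
  obtain l where l: "\<And>n. simple_wf M T W (l n)" "(\<lambda>n. proc_sq (\<lambda>t w. simple_val (l n) t w - \<phi> t w)) \<longlonglongrightarrow> 0"
      "\<And>t. t \<in> {0..T} \<Longrightarrow> (\<lambda>n. rv_sq (\<lambda>w. simple_int W (l n) t w - I t w)) \<longlonglongrightarrow> 0"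
    using assms(1) unfolding has_ito_integral_iff by blast
  have wf: "simple_wf M T W (simple_clip s r (l n))" for n
    by (rule simple_clip_wf[OF l(1) assms(2-4)])
  have 1: "(\<lambda>n. proc_sq (\<lambda>t w. simple_val (simple_clip s r (l n)) t w - indicator {s<..r} t *\<^sub>R \<phi> t w)) \<longlonglongrightarrow> 0"
    by (rule tendsto_0_le_ennreal[OF _ l(2)], rule proc_sq_mono)
       (simp add: simple_clip_val[OF assms(3)] indicator_def)
  have 2: "(\<lambda>n. rv_sq (\<lambda>w. simple_int W (simple_clip s r (l n)) t w - (I (min r t) w - I (min s t) w))) \<longlonglongrightarrow> 0"
    if t: "t \<in> {0..T}" for t
  proof (rule tendsto_0_le_ennreal)
    fix n
    have rt: "min r t \<in> {0..T}" "min s t \<in> {0..T}" using assms t by auto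
    have "rv_sq (\<lambda>w. simple_int W (simple_clip s r (l n)) t w - (I (min r t) w - I (min s t) w))
      = rv_sq (\<lambda>w. (simple_int W (l n) (min r t) w - I (min r t) w) + (I (min s t) w - simple_int W (l n) (min s t) w))"
      by (simp add: simple_clip_int[OF l(1) assms(3)] algebra_simps)
    also have "\<dots> \<le> 2 * rv_sq (\<lambda>w. simple_int W (l n) (min r t) w - I (min r t) w)
        + 2 * rv_sq (\<lambda>w. I (min s t) w - simple_int W (l n) (min s t) w)"
      by (intro rv_sq_add_le borel_measurable_diff simple_int_measurable l(1) rt ito_measurable[OF assms(1)])
    finally show "rv_sq (\<lambda>w. simple_int W (simple_clip s r (l n)) t w - (I (min r t) w - I (min s t) w))
      \<le> 2 * rv_sq (\<lambda>w. simple_int W (l n) (min r t) w - I (min r t) w)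
        + 2 * rv_sq (\<lambda>w. simple_int W (l n) (min s t) w - I (min s t) w)"
      by (simp add: rv_sq_minus)
  qed (intro tendsto_0_lin_ennreal l, use assms t in auto)
  show ?thesis
    unfolding has_ito_integral_iff
  proof (intro conjI ballI exI[of _ "\<lambda>n. simple_clip s r (l n)"] allI)
    show "(\<lambda>t w. indicator {s<..r} t *\<^sub>R \<phi> t w) \<in> L2F M T W"
      by (rule L2F_indicator[OF ito_L2F[OF assms(1)]])
    show "(\<lambda>w. I (min r t) w - I (min s t) w) \<in> borel_measurable M" if "t \<in> {0..T}" for t
      using that assms by (intro borel_measurable_diff ito_measurable[OF assms(1)]) auto
  qed (rule wf 1 2, assumption?)+
qed

section \<open>Orthogonality, isometry and limits of Ito integrals\<close>

lemma proc_sq_tendsto: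
  assumes "\<And>n. joint (\<phi> n)" "joint \<psi>" "(\<lambda>n. proc_sq (\<lambda>t w. \<phi> n t w - \<psi> t w)) \<longlonglongrightarrow> 0"
  shows "(\<lambda>n. proc_sq (\<phi> n)) \<longlonglongrightarrow> proc_sq \<psi>"
proof -
  have "(\<lambda>n. \<integral>\<^sup>+p. ennreal ((norm ((case p of (t, w) \<Rightarrow> \<phi> n t w) - (case p of (t, w) \<Rightarrow> \<psi> t w)))\<^sup>2) \<partial>(LT \<Otimes>\<^sub>M M)) \<longlonglongrightarrow> 0"
    using assms(3) unfolding proc_sq_pair[OF joint_diff[OF assms(1,2)]] by (simp add: split_beta)
  from nn_integral_sq_tendsto[OF assms(2,1)[unfolded joint_def] this]
  show ?thesis unfolding proc_sq_pair[OF assms(1)] proc_sq_pair[OF assms(2)] .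
qed

lemma rv_sq_tendsto:
  assumes "\<And>n. X n \<in> borel_measurable M" "Y \<in> borel_measurable M" "(\<lambda>n. rv_sq (\<lambda>w. X n w - Y w)) \<longlonglongrightarrow> 0"
  shows "(\<lambda>n. rv_sq (X n)) \<longlonglongrightarrow> rv_sq Y"
  using nn_integral_sq_tendsto[OF assms(2,1)] assms(3) unfolding rv_sq_def .

text \<open>The limit of \<open>simple_isometry\<close> along approximations clipped to (s, T]:
  their intervals all start at or after s, and both sides converge because squared norms are
  continuous in L2.\<close>

lemma ito_pythagoras:
  fixes \<phi> :: "real \<Rightarrow> 'w \<Rightarrow> 'e::euclidean_space"
  assumes I: "has_ito_integral M T W \<phi> I" and s: "0 \<le> s" "s \<le> T"
    and U: "U \<in> borel_measurable (F s)" "rv_sq U < \<infinity>"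
  shows "rv_sq (\<lambda>w. U w + (I T w - I s w)) = rv_sq U + proc_sq (\<lambda>t w. indicator {s<..T} t *\<^sub>R \<phi> t w)"
proof -
  have UM: "U \<in> borel_measurable M" by (rule F_measurable_M[OF U(1) s(2)])
  have sT: "s \<in> {0..T}" "T \<in> {0..T}" using s T_pos by auto
  obtain l where l: "\<And>n. simple_wf M T W (l n)" "(\<lambda>n. proc_sq (\<lambda>t w. simple_val (l n) t w - \<phi> t w)) \<longlonglongrightarrow> 0"
      "\<And>t. t \<in> {0..T} \<Longrightarrow> (\<lambda>n. rv_sq (\<lambda>w. simple_int W (l n) t w - I t w)) \<longlonglongrightarrow> 0"
    using I unfolding has_ito_integral_iff by blast
  define k where "k n = simple_clip s T (l n)" for n
  have k: "simple_wf M T W (k n)" for n unfolding k_def by (rule simple_clip_wf[OF l(1) s order_refl])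
  have 1: "(\<lambda>n. proc_sq (simple_val (k n))) \<longlonglongrightarrow> proc_sq (\<lambda>t w. indicator {s<..T} t *\<^sub>R \<phi> t w)"
  proof (rule proc_sq_tendsto)
    show "joint (simple_val (k n))" for n by (intro L2F_joint simple_L2F k)
    show "joint (\<lambda>t w. indicator {s<..T} t *\<^sub>R \<phi> t w)" by (intro L2F_joint L2F_indicator ito_L2F[OF I])
    show "(\<lambda>n. proc_sq (\<lambda>t w. simple_val (k n) t w - indicator {s<..T} t *\<^sub>R \<phi> t w)) \<longlonglongrightarrow> 0"
      by (rule tendsto_0_le_ennreal[OF _ l(2)], rule proc_sq_mono)
         (simp add: k_def simple_clip_val[OF s(2)] indicator_def)
  qed
  have kT: "simple_int W (k n) T w = simple_int W (l n) T w - simple_int W (l n) s w" for n w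
    unfolding k_def simple_clip_int[OF l(1) s(2)] using s by (simp add: min_absorb1)
  have 2: "(\<lambda>n. rv_sq (\<lambda>w. U w + simple_int W (k n) T w)) \<longlonglongrightarrow> rv_sq (\<lambda>w. U w + (I T w - I s w))"
  proof (rule rv_sq_tendsto)
    show "(\<lambda>w. U w + simple_int W (k n) T w) \<in> borel_measurable M" for n
      by (intro borel_measurable_add UM simple_int_measurable k sT)
    show "(\<lambda>w. U w + (I T w - I s w)) \<in> borel_measurable M"
      by (intro borel_measurable_add borel_measurable_diff UM ito_measurable[OF I] sT)
    show "(\<lambda>n. rv_sq (\<lambda>w. U w + simple_int W (k n) T w - (U w + (I T w - I s w)))) \<longlonglongrightarrow> 0"
    proof (rule tendsto_0_le_ennreal)
      fix n
      have "rv_sq (\<lambda>w. U w + simple_int W (k n) T w - (U w + (I T w - I s w)))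
        = rv_sq (\<lambda>w. (simple_int W (l n) T w - I T w) + (I s w - simple_int W (l n) s w))"
        by (simp add: kT algebra_simps)
      also have "\<dots> \<le> 2 * rv_sq (\<lambda>w. simple_int W (l n) T w - I T w) + 2 * rv_sq (\<lambda>w. I s w - simple_int W (l n) s w)"
        by (intro rv_sq_add_le borel_measurable_diff simple_int_measurable l(1) sT ito_measurable[OF I])
      finally show "rv_sq (\<lambda>w. U w + simple_int W (k n) T w - (U w + (I T w - I s w)))
        \<le> 2 * rv_sq (\<lambda>w. simple_int W (l n) T w - I T w) + 2 * rv_sq (\<lambda>w. simple_int W (l n) s w - I s w)"
        by (simp add: rv_sq_minus)
    qed (intro tendsto_0_lin_ennreal l sT; simp)
  qed
  have "rv_sq (\<lambda>w. U w + simple_int W (k n) T w) = rv_sq U + proc_sq (simple_val (k n))" for n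
  proof (rule simple_isometry(1)[OF k U s])
    fix a b \<xi> assume "(a, b, \<xi>) \<in> set (k n)"
    then show "s \<le> a" unfolding k_def simple_clip_def by auto
  qed
  then have "(\<lambda>n. rv_sq U + proc_sq (simple_val (k n))) \<longlonglongrightarrow> rv_sq (\<lambda>w. U w + (I T w - I s w))"
    using 2 by simp
  moreover have "(\<lambda>n. rv_sq U + proc_sq (simple_val (k n)))
      \<longlonglongrightarrow> rv_sq U + proc_sq (\<lambda>t w. indicator {s<..T} t *\<^sub>R \<phi> t w)"
    by (intro tendsto_add tendsto_const 1)
  ultimately show ?thesis by (rule LIMSEQ_unique)
qed

text \<open>Every simple integral is zero at time 0, and I 0 is determined only as the L2 limit of
  these, hence up to a null set.\<close>

lemma ito_zero:
  assumes "has_ito_integral M T W \<phi> I" shows "AE w in M. I 0 w = 0"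
proof -
  obtain l where l: "\<And>n. simple_wf M T W (l n)"
      "\<And>t. t \<in> {0..T} \<Longrightarrow> (\<lambda>n. rv_sq (\<lambda>w. simple_int W (l n) t w - I t w)) \<longlonglongrightarrow> 0"
    using assms(1) unfolding has_ito_integral_iff by blast
  have "simple_int W (l n) 0 w = 0" for n w
    unfolding simple_int_sum
  proof (intro sum.neutral ballI)
    fix i assume "i \<in> {..<length (l n)}"
    with simple_wf_nth(1,2)[OF l(1)] have "0 \<le> fst (l n ! i)" "fst (l n ! i) \<le> fst (snd (l n ! i))" by auto
    then show "(W (min (fst (snd (l n ! i))) 0) w - W (min (fst (l n ! i)) 0) w) *\<^sub>R snd (snd (l n ! i)) w = 0"
      by (simp add: min_absorb2)
  qed
  then have "(\<lambda>n::nat. rv_sq (I 0)) \<longlonglongrightarrow> 0"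
    using l(2)[of 0] T_pos by (simp add: rv_sq_def)
  then have "rv_sq (I 0) = 0" by (simp add: LIMSEQ_const_iff)
  then show ?thesis using ito_measurable[OF assms, of 0] T_pos by (simp add: rv_sq_eq_0)
qed

lemma ito_isometry_le:
  assumes I: "has_ito_integral M T W \<phi> I" and t: "t \<in> {0..T}"
  shows "rv_sq (I t) \<le> proc_sq \<phi>"
proof -
  let ?J = "\<lambda>r w. I (min t r) w - I (min 0 r) w"
  \<comment> \<open>Clipped to (0, t] the integral has terminal value I t, so
    \<open>ito_pythagoras\<close> applies with the past value 0 at time 0.\<close>
  have J: "has_ito_integral M T W (\<lambda>r w. indicator {0<..t} r *\<^sub>R \<phi> r w) ?J"
    using t by (intro ito_clip[OF I]) auto
  have "rv_sq (I t) = rv_sq (\<lambda>w. 0 + (?J T w - ?J 0 w))"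
    by (rule rv_sq_cong_AE) (use ito_zero[OF I] t T_pos in \<open>auto simp: min_absorb1 min_absorb2\<close>)
  also have "\<dots> = rv_sq (\<lambda>_. 0 :: 'a) + proc_sq (\<lambda>r w. indicator {0<..T} r *\<^sub>R indicator {0<..t} r *\<^sub>R \<phi> r w)"
    using T_pos by (intro ito_pythagoras[OF J]) auto
  also have "\<dots> \<le> proc_sq \<phi>"
    by (simp, intro proc_sq_mono) (simp add: indicator_def)
  finally show ?thesis .
qed

text \<open>A diagonal choice: for each n a simple process within 1/(n + 1) of the n-th integrand.
  By the isometry its integral is equally close to I n at every time, so one sequence approximates
  both \<psi> and J.\<close>

lemma ito_limit:
  assumes I: "\<And>n. has_ito_integral M T W (\<phi> n) (I n)" and \<psi>: "\<psi> \<in> L2F M T W"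
    and lim: "(\<lambda>n. proc_sq (\<lambda>t w. \<phi> n t w - \<psi> t w)) \<longlonglongrightarrow> 0"
    and J: "\<And>t. t \<in> {0..T} \<Longrightarrow> J t \<in> borel_measurable M"
      "\<And>t. t \<in> {0..T} \<Longrightarrow> (\<lambda>n. rv_sq (\<lambda>w. I n t w - J t w)) \<longlonglongrightarrow> 0"
  shows "has_ito_integral M T W \<psi> J"
proof -
  have "\<exists>l. simple_wf M T W l \<and> proc_sq (\<lambda>t w. simple_val l t w - \<phi> n t w) < ennreal (1 / Suc n)" for n
  proof -
    obtain l where l: "\<And>m. simple_wf M T W (l m)" "(\<lambda>m. proc_sq (\<lambda>t w. simple_val (l m) t w - \<phi> n t w)) \<longlonglongrightarrow> 0"
      using I[of n] unfolding has_ito_integral_iff by blast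
    have "\<forall>\<^sub>F m in sequentially. proc_sq (\<lambda>t w. simple_val (l m) t w - \<phi> n t w) < ennreal (1 / Suc n)"
      by (rule order_tendstoD(2)[OF l(2)]) simp
    then obtain m where "proc_sq (\<lambda>t w. simple_val (l m) t w - \<phi> n t w) < ennreal (1 / Suc n)"
      using eventually_happens[of _ sequentially] by auto
    then show ?thesis using l(1)[of m] by blast
  qed
  then obtain l where l: "\<And>n. simple_wf M T W (l n)"
      "\<And>n. proc_sq (\<lambda>t w. simple_val (l n) t w - \<phi> n t w) < ennreal (1 / Suc n)" by metis
  have "(\<lambda>n. ennreal (1 / Suc n)) \<longlonglongrightarrow> ennreal 0"
    by (intro tendsto_ennrealI LIMSEQ_Suc[OF lim_1_over_n])
  then have S: "(\<lambda>n. ennreal (1 / Suc n)) \<longlonglongrightarrow> 0" by simp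
  have d0: "(\<lambda>n. proc_sq (\<lambda>t w. simple_val (l n) t w - \<phi> n t w)) \<longlonglongrightarrow> 0"
    by (rule tendsto_0_le_ennreal[OF less_imp_le[OF l(2)] S])
  have 1: "(\<lambda>n. proc_sq (\<lambda>t w. simple_val (l n) t w - \<psi> t w)) \<longlonglongrightarrow> 0"
  proof (rule tendsto_0_le_ennreal)
    fix n
    have "proc_sq (\<lambda>t w. simple_val (l n) t w - \<psi> t w)
      = proc_sq (\<lambda>t w. (simple_val (l n) t w - \<phi> n t w) + (\<phi> n t w - \<psi> t w))" by simp
    also have "\<dots> \<le> ennreal (1 + 1) * proc_sq (\<lambda>t w. simple_val (l n) t w - \<phi> n t w)
        + ennreal (1 + 1 / 1) * proc_sq (\<lambda>t w. \<phi> n t w - \<psi> t w)"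
      by (intro proc_sq_add_le joint_diff L2F_joint simple_L2F l(1) ito_L2F[OF I] \<psi>) simp
    finally show "proc_sq (\<lambda>t w. simple_val (l n) t w - \<psi> t w)
      \<le> ennreal (1 + 1) * proc_sq (\<lambda>t w. simple_val (l n) t w - \<phi> n t w)
        + ennreal (1 + 1 / 1) * proc_sq (\<lambda>t w. \<phi> n t w - \<psi> t w)" .
  qed (intro tendsto_0_lin_ennreal d0 lim; simp)
  have 2: "(\<lambda>n. rv_sq (\<lambda>w. simple_int W (l n) t w - J t w)) \<longlonglongrightarrow> 0" if t: "t \<in> {0..T}" for t
  proof (rule tendsto_0_le_ennreal)
    fix n
    have le: "rv_sq (\<lambda>w. simple_int W (l n) t w - I n t w) \<le> proc_sq (\<lambda>t w. simple_val (l n) t w - \<phi> n t w)"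
      by (rule ito_isometry_le[OF ito_diff[OF ito_simple[OF l(1)] I] t])
    have "rv_sq (\<lambda>w. simple_int W (l n) t w - J t w)
      = rv_sq (\<lambda>w. (simple_int W (l n) t w - I n t w) + (I n t w - J t w))" by simp
    also have "\<dots> \<le> 2 * rv_sq (\<lambda>w. simple_int W (l n) t w - I n t w) + 2 * rv_sq (\<lambda>w. I n t w - J t w)"
      by (intro rv_sq_add_le borel_measurable_diff simple_int_measurable l(1) t ito_measurable[OF I] J(1))
    also have "\<dots> \<le> 2 * proc_sq (\<lambda>t w. simple_val (l n) t w - \<phi> n t w) + 2 * rv_sq (\<lambda>w. I n t w - J t w)"
      by (intro add_right_mono mult_left_mono le) simp
    finally show "rv_sq (\<lambda>w. simple_int W (l n) t w - J t w)
      \<le> 2 * proc_sq (\<lambda>t w. simple_val (l n) t w - \<phi> n t w) + 2 * rv_sq (\<lambda>w. I n t w - J t w)" .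
  qed (intro tendsto_0_lin_ennreal d0 J t; simp)
  show ?thesis
    unfolding has_ito_integral_iff
  proof (intro conjI ballI exI[of _ l] allI)
    show "J t \<in> borel_measurable M" if "t \<in> {0..T}" for t by (rule J(1)[OF that])
  qed (rule \<psi> l(1) 1 2, assumption?)+
qed

end

section \<open>The product rule\<close>

lemma set_integrable_bilinear:
  fixes prd :: "'c::euclidean_space \<Rightarrow> 'd::euclidean_space \<Rightarrow> 'e::euclidean_space"
  assumes "bounded_bilinear prd" and f: "set_integrable lborel {a..b::real} f"
    and h: "h \<in> borel_measurable (restrict_space borel {a..b})" "bounded (h ` {a..b})"
  shows "set_integrable lborel {a..b} (\<lambda>t. prd (f t) (h t))"
proof -
  interpret bounded_bilinear prd by fact
  obtain K where K: "0 \<le> K" "\<And>a b. norm (prd a b) \<le> norm a * norm b * K" using nonneg_bounded by auto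
  obtain L where L: "\<And>t. t \<in> {a..b} \<Longrightarrow> norm (h t) \<le> L" using h(2) unfolding bounded_iff by blast
  have fm: "(\<lambda>t. indicator {a..b} t *\<^sub>R f t) \<in> borel_measurable lborel"
    using f unfolding set_integrable_def by auto
  have hm: "(\<lambda>t. indicator {a..b} t *\<^sub>R h t) \<in> borel_measurable lborel"
    using h(1) by (simp add: borel_measurable_restrict_space_iff)
  have "set_integrable lborel {a..b} (\<lambda>t. (L * K) *\<^sub>R f t)" using f by simp
  then show "set_integrable lborel {a..b} (\<lambda>t. prd (f t) (h t))"
  proof (rule set_integrable_bound)
    have eq: "(\<lambda>t. prd (indicator {a..b} t *\<^sub>R f t) (indicator {a..b} t *\<^sub>R h t)) = (\<lambda>t. indicator {a..b} t *\<^sub>R prd (f t) (h t))"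
      by (simp add: fun_eq_iff indicator_def zero_left)
    have "(\<lambda>t. prd (indicator {a..b} t *\<^sub>R f t) (indicator {a..b} t *\<^sub>R h t)) \<in> borel_measurable lborel"
      by (rule borel_measurable_continuous_Pair[OF fm hm])
         (intro continuous_on continuous_on_fst continuous_on_snd continuous_on_id)
    then show "set_borel_measurable lborel {a..b} (\<lambda>t. prd (f t) (h t))"
      unfolding set_borel_measurable_def eq .
    show "AE t in lborel. t \<in> {a..b} \<longrightarrow> norm (prd (f t) (h t)) \<le> norm ((L * K) *\<^sub>R f t)"
    proof (intro AE_I2 impI)
      fix t assume t: "t \<in> {a..b}"
      have "norm (prd (f t) (h t)) \<le> norm (f t) * norm (h t) * K" by (rule K)
      also have "\<dots> \<le> norm (f t) * L * K" by (intro mult_right_mono mult_left_mono L t K) simp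
      also have "\<dots> = (L * K) * norm (f t)" by simp
      also have "\<dots> \<le> \<bar>L * K\<bar> * norm (f t)" by (intro mult_right_mono abs_ge_self norm_ge_zero)
      finally show "norm (prd (f t) (h t)) \<le> norm ((L * K) *\<^sub>R f t)" by simp
    qed
  qed
qed

lemma set_integral_Ioc_diff:
  fixes f :: "real \<Rightarrow> 'e::euclidean_space"
  assumes "set_integrable lborel {0..T} f" "0 \<le> s" "s \<le> r" "r \<le> T"
  shows "(LINT u:{0..r}|lborel. f u) - (LINT u:{0..s}|lborel. f u) = (LINT u:{s<..r}|lborel. f u)"
proof -
  have "(LINT u:{0..s} \<union> {s<..r}|lborel. f u) = (LINT u:{0..s}|lborel. f u) + (LINT u:{s<..r}|lborel. f u)"
    using assms by (intro set_integral_Un set_integrable_subset[OF assms(1)]) auto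
  moreover have "{0..s} \<union> {s<..r} = {0..r}" using assms by auto
  ultimately show ?thesis by simp
qed

lemma set_integral_bounded_linear:
  fixes L :: "'e::euclidean_space \<Rightarrow> 'f::euclidean_space"
  assumes "bounded_linear L" "set_integrable M A f"
  shows "L (LINT u:A|M. f u) = (LINT u:A|M. L (f u))"
proof -
  interpret bounded_linear L by fact
  have "L (LINT u:A|M. f u) = (LINT u|M. L (indicator A u *\<^sub>R f u))"
    unfolding set_lebesgue_integral_def using assms unfolding set_integrable_def
    by (intro integral_bounded_linear[symmetric])
  then show ?thesis unfolding set_lebesgue_integral_def by (simp add: scaleR)
qed

lemma set_integral_Icc_self: "(LINT u:{a..a::real}|lborel. f u) = 0"
  unfolding set_lebesgue_integral_def
  by (rule integral_eq_zero_AE, use AE_lborel_singleton[of a] in eventually_elim) (simp add: indicator_def)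

text \<open>A pathwise statement. The sum is the Riemann sum of P against I with P taken at left
  ends. Summation by parts shows that on each cell the defect contains only oscillations of x and P
  there, integrated against the derivative of P and the drift b; this gives the factor e and an
  integral independent of the partition.\<close>

lemma product_sum_estimate:
  fixes prd :: "'c::euclidean_space \<Rightarrow> 'd::euclidean_space \<Rightarrow> 'e::euclidean_space"
    and \<tau> :: "nat \<Rightarrow> real"
  assumes bil: "bounded_bilinear prd" and K: "0 \<le> K" "\<And>a b. norm (prd a b) \<le> norm a * norm b * K"
    and t: "0 \<le> t" "t \<le> T" and \<tau>: "\<And>k. \<tau> k \<le> \<tau> (Suc k)" "\<tau> 0 = 0" "\<tau> n = T"
    and x: "continuous_on {0..T} x" and b: "set_integrable lborel {0..T} b"
    and dP: "set_integrable lborel {0..T} dP" and P: "\<And>r. r \<in> {0..T} \<Longrightarrow> P r = P 0 + (LINT u:{0..r}|lborel. dP u)"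
    and Pc: "continuous_on {0..T} P"
    and e: "0 \<le> e"
    and osc: "\<And>k r r'. k < n \<Longrightarrow> r \<in> {\<tau> k..\<tau> (Suc k)} \<Longrightarrow> r' \<in> {\<tau> k..\<tau> (Suc k)} \<Longrightarrow>
        norm (x r - x r') \<le> e \<and> norm (P r - P r') \<le> e"
  defines "I \<equiv> \<lambda>r. x r - x 0 - (LINT u:{0..r}|lborel. b u)"
  shows "norm ((\<Sum>k<n. prd (P (\<tau> k)) (I (min (\<tau> (Suc k)) t) - I (min (\<tau> k) t)))
      - (prd (P t) (x t) - prd (P 0) (x 0) - (LINT u:{0..t}|lborel. prd (dP u) (x u) + prd (P u) (b u))))
    \<le> e * K * (LINT u:{0..T}|lborel. norm (dP u) + norm (b u))"
proof -
  interpret bounded_bilinear prd by fact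
  define s where "s k = min (\<tau> k) t" for k
  have \<tau>mono: "\<tau> i \<le> \<tau> j" if "i \<le> j" for i j using lift_Suc_mono_le[of \<tau> i j] \<tau>(1) that by simp
  have \<tau>r: "0 \<le> \<tau> k" "k \<le> n \<Longrightarrow> \<tau> k \<le> T" for k using \<tau>mono[of 0 k] \<tau>mono[of k n] \<tau> by auto
  have s: "0 \<le> s k" "s k \<le> s (Suc k)" "s k \<le> T" "s 0 = 0" "s n = t" for k
    using \<tau>r[of k] \<tau> t by (auto simp: s_def min_def intro: order_trans)
  have bnd: "bounded (x ` {0..T})" "bounded (P ` {0..T})"
    by (intro compact_imp_bounded compact_continuous_image x Pc compact_Icc)+
  have meas: "x \<in> borel_measurable (restrict_space borel {0..T})" "P \<in> borel_measurable (restrict_space borel {0..T})"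
    using x Pc by (auto intro: borel_measurable_continuous_on_restrict)
  have int1: "set_integrable lborel {0..T} (\<lambda>u. prd (dP u) (x u))"
    by (rule set_integrable_bilinear[OF bil dP meas(1) bnd(1)])
  have int2: "set_integrable lborel {0..T} (\<lambda>u. prd (P u) (b u))"
    by (rule set_integrable_bilinear[OF flip b meas(2) bnd(2)])
  define f where "f u = prd (dP u) (x u) + prd (P u) (b u)" for u
  have int: "set_integrable lborel {0..T} (\<lambda>u. f u)"
    unfolding f_def using int1 int2 by (rule set_integral_add)
  have intn: "set_integrable lborel {0..T} (\<lambda>u. norm (dP u) + norm (b u))"
    using set_integrable_norm[OF dP] set_integrable_norm[OF b] by (rule set_integral_add)
  \<comment> \<open>The defect density on the k-th cell. The difference P(s') x(s') - P(s) x(s) is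
    split with x at the right end and P at the left end, which explains the two reference
    points.\<close>
  define h where "h k u = prd (dP u) (x u - x (s (Suc k))) + prd (P u - P (\<tau> k)) (b u)" for k u
  have sub: "{s k<..s (Suc k)} \<subseteq> {0..T}" for k using s(1)[of k] s(3)[of "Suc k"] by auto
  have term_eq: "prd (P (\<tau> k)) (I (s (Suc k)) - I (s k))
      - ((prd (P (s (Suc k))) (x (s (Suc k))) - (LINT u:{0..s (Suc k)}|lborel. f u))
       - (prd (P (s k)) (x (s k)) - (LINT u:{0..s k}|lborel. f u)))
      = (LINT u:{s k<..s (Suc k)}|lborel. h k u)" if k: "k < n" for k
  proof (cases "s k = s (Suc k)")
    case True
    then show ?thesis by (simp add: zero_right set_lebesgue_integral_def)
  next
    case False
    \<comment> \<open>A cell not emptied by the truncation at t starts before t, so its left end is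
      unchanged.\<close>
    then have sk: "s k = \<tau> k" using \<tau>(1)[of k] by (auto simp: s_def min_def split: if_splits)
    note d = set_integral_Ioc_diff[OF _ s(1)[of k] s(2)[of k] s(3)[of "Suc k"]]
    have i: "set_integrable lborel {s k<..s (Suc k)} f" if "set_integrable lborel {0..T} f" for f :: "real \<Rightarrow> 'z::euclidean_space"
      by (rule set_integrable_subset[OF that _ sub]) simp
    have e1: "prd (P (s (Suc k)) - P (s k)) (x (s (Suc k))) = (LINT u:{s k<..s (Suc k)}|lborel. prd (dP u) (x (s (Suc k))))"
      using P[of "s (Suc k)"] P[of "s k"] s(1,3)[of k] s(1,3)[of "Suc k"] d[OF dP]
        set_integral_bounded_linear[OF bounded_linear_left i[OF dP], of "x (s (Suc k))"] by simp
    have e2: "prd (P (\<tau> k)) ((LINT u:{0..s (Suc k)}|lborel. b u) - (LINT u:{0..s k}|lborel. b u))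
      = (LINT u:{s k<..s (Suc k)}|lborel. prd (P (\<tau> k)) (b u))"
      using d[OF b] set_integral_bounded_linear[OF bounded_linear_right i[OF b], of "P (\<tau> k)"] by simp
    have e3: "(LINT u:{s k<..s (Suc k)}|lborel. h k u)
      = (LINT u:{s k<..s (Suc k)}|lborel. (f u) - (prd (dP u) (x (s (Suc k))) + prd (P (\<tau> k)) (b u)))"
      unfolding h_def f_def by (simp add: diff_left diff_right algebra_simps)
    also have "\<dots> = (LINT u:{s k<..s (Suc k)}|lborel. f u)
        - (LINT u:{s k<..s (Suc k)}|lborel. prd (dP u) (x (s (Suc k))) + prd (P (\<tau> k)) (b u))"
    proof (rule set_integral_diff)
      show "set_integrable lborel {s k<..s (Suc k)} (\<lambda>u. f u)" by (rule i[OF int])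
      show "set_integrable lborel {s k<..s (Suc k)} (\<lambda>u. prd (dP u) (x (s (Suc k))) + prd (P (\<tau> k)) (b u))"
        by (intro set_integral_add i set_integrable_bilinear[OF bil dP] set_integrable_bilinear[OF flip b])
           (auto simp: bounded_iff)
    qed
    also have "(LINT u:{s k<..s (Suc k)}|lborel. prd (dP u) (x (s (Suc k))) + prd (P (\<tau> k)) (b u))
      = (LINT u:{s k<..s (Suc k)}|lborel. prd (dP u) (x (s (Suc k)))) + (LINT u:{s k<..s (Suc k)}|lborel. prd (P (\<tau> k)) (b u))"
      by (intro set_integral_add i set_integrable_bilinear[OF bil dP] set_integrable_bilinear[OF flip b])
         (auto simp: bounded_iff)
    finally have e4: "(LINT u:{s k<..s (Suc k)}|lborel. h k u) =
       (LINT u:{0..s (Suc k)}|lborel. f u) - (LINT u:{0..s k}|lborel. f u)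
       - (prd (P (s (Suc k)) - P (s k)) (x (s (Suc k)))
         + prd (P (\<tau> k)) ((LINT u:{0..s (Suc k)}|lborel. b u) - (LINT u:{0..s k}|lborel. b u)))"
      unfolding e1 e2 d[OF int] .
    show ?thesis unfolding e4 I_def sk[symmetric]
      by (simp add: diff_left diff_right add_left add_right algebra_simps)
  qed
  have tele: "prd (P t) (x t) - prd (P 0) (x 0) - (LINT u:{0..t}|lborel. f u)
     = (\<Sum>k<n. (prd (P (s (Suc k))) (x (s (Suc k))) - (LINT u:{0..s (Suc k)}|lborel. f u))
       - (prd (P (s k)) (x (s k)) - (LINT u:{0..s k}|lborel. f u)))"
  proof -
    have z: "(LINT u:{0..0::real}|lborel. f u) = 0"
      by (rule set_integral_Icc_self)
    show ?thesis
      unfolding sum_lessThan_telescope[of "\<lambda>k. prd (P (s k)) (x (s k)) - (LINT u:{0..s k}|lborel. f u)"]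
      using s z by simp
  qed
  have bound: "norm (LINT u:{s k<..s (Suc k)}|lborel. h k u) \<le> e * K * (LINT u:{s k<..s (Suc k)}|lborel. norm (dP u) + norm (b u))"
    if k: "k < n" for k
  proof -
    have i: "set_integrable lborel {s k<..s (Suc k)} (\<lambda>u. e * K * (norm (dP u) + norm (b u)))"
      by (intro set_integrable_mult_right set_integrable_subset[OF intn _ sub]) simp
    have "norm (LINT u:{s k<..s (Suc k)}|lborel. h k u) \<le> (LINT u:{s k<..s (Suc k)}|lborel. e * K * (norm (dP u) + norm (b u)))"
      unfolding set_lebesgue_integral_def
    proof (rule Bochner_Integration.integral_norm_bound_integral)
      show "integrable lborel (\<lambda>u. indicator {s k<..s (Suc k)} u *\<^sub>R (e * K * (norm (dP u) + norm (b u))))"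
        using i unfolding set_integrable_def .
    next
      have "set_integrable lborel {0..T} (h k)"
        unfolding h_def
        using bounded_minus_comp[OF bnd(1), of "\<lambda>_. x (s (Suc k))"] bounded_minus_comp[OF bnd(2), of "\<lambda>_. P (\<tau> k)"]
        by (intro set_integral_add set_integrable_bilinear[OF bil dP] set_integrable_bilinear[OF flip b]
            borel_measurable_diff meas borel_measurable_const) (simp_all add: image_constant_conv)
      then have "set_integrable lborel {s k<..s (Suc k)} (h k)"
        by (rule set_integrable_subset[OF _ _ sub]) simp
      then show "integrable lborel (\<lambda>u. indicator {s k<..s (Suc k)} u *\<^sub>R h k u)" unfolding set_integrable_def .
    next
      fix u
      show "norm (indicator {s k<..s (Suc k)} u *\<^sub>R h k u) \<le> indicator {s k<..s (Suc k)} u *\<^sub>R (e * K * (norm (dP u) + norm (b u)))"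
      proof (cases "u \<in> {s k<..s (Suc k)}")
        case True
        then have u: "u \<in> {\<tau> k..\<tau> (Suc k)}" "s (Suc k) \<in> {\<tau> k..\<tau> (Suc k)}" "\<tau> k \<in> {\<tau> k..\<tau> (Suc k)}"
          using \<tau>(1)[of k] unfolding s_def by (simp_all add: min_def split: if_splits)
        have "norm (h k u) \<le> norm (dP u) * norm (x u - x (s (Suc k))) * K + norm (P u - P (\<tau> k)) * norm (b u) * K"
          unfolding h_def by (intro norm_triangle_le add_mono K)
        also have "\<dots> \<le> norm (dP u) * e * K + e * norm (b u) * K"
          using osc[OF k u(1,2)] osc[OF k u(1,3)] K(1)
          by (intro add_mono mult_right_mono mult_left_mono) auto
        finally show ?thesis using True by (simp add: algebra_simps)
      qed simp
    qed
    then show ?thesis by simp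
  qed
  have "(\<Sum>k<n. prd (P (\<tau> k)) (I (min (\<tau> (Suc k)) t) - I (min (\<tau> k) t)))
      - (prd (P t) (x t) - prd (P 0) (x 0) - (LINT u:{0..t}|lborel. f u))
      = (\<Sum>k<n. LINT u:{s k<..s (Suc k)}|lborel. h k u)"
    unfolding tele sum_subtractf[symmetric] using term_eq by (intro sum.cong) (auto simp: s_def)
  also have "norm \<dots> \<le> (\<Sum>k<n. e * K * (LINT u:{s k<..s (Suc k)}|lborel. norm (dP u) + norm (b u)))"
    by (rule sum_norm_le) (use bound in simp)
  also have "\<dots> = e * K * (\<Sum>k<n. (LINT u:{0..s (Suc k)}|lborel. norm (dP u) + norm (b u)) - (LINT u:{0..s k}|lborel. norm (dP u) + norm (b u)))"
    unfolding sum_distrib_left[symmetric]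
    by (intro arg_cong[where f = "\<lambda>z. e * K * z"] sum.cong refl set_integral_Ioc_diff[OF intn, symmetric] s)
  also have "\<dots> = e * K * ((LINT u:{0..t}|lborel. norm (dP u) + norm (b u)) - (LINT u:{0..0}|lborel. norm (dP u) + norm (b u)))"
    unfolding sum_lessThan_telescope[of "\<lambda>k. LINT u:{0..s k}|lborel. norm (dP u) + norm (b u)"] s ..
  also have "\<dots> \<le> e * K * (LINT u:{0..T}|lborel. norm (dP u) + norm (b u))"
  proof (rule mult_left_mono)
    have "0 \<le> (LINT u:{t<..T}|lborel. norm (dP u) + norm (b u))"
      unfolding set_lebesgue_integral_def by (intro integral_nonneg_AE) auto
    moreover have "0 \<le> (LINT u:{0..0::real}|lborel. norm (dP u) + norm (b u))"
      unfolding set_lebesgue_integral_def by (intro integral_nonneg_AE) auto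
    ultimately show "(LINT u:{0..t}|lborel. norm (dP u) + norm (b u)) - (LINT u:{0..0}|lborel. norm (dP u) + norm (b u))
        \<le> (LINT u:{0..T}|lborel. norm (dP u) + norm (b u))"
      using set_integral_Ioc_diff[OF intn t order_refl] by linarith
  qed (use e K in simp)
  finally show ?thesis unfolding f_def .
qed

context brownian_basis
begin

section \<open>Bilinear maps applied to processes\<close>

lemma borel_measurable_bilinear:
  fixes prd :: "'c::euclidean_space \<Rightarrow> 'd::euclidean_space \<Rightarrow> 'e::euclidean_space"
  assumes "bounded_bilinear prd" "f \<in> borel_measurable N" "h \<in> borel_measurable N"
  shows "(\<lambda>p. prd (f p) (h p)) \<in> borel_measurable N"
proof -
  interpret bounded_bilinear prd by fact
  show ?thesis
    by (rule borel_measurable_continuous_Pair[OF assms(2,3)])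
       (intro continuous_on continuous_on_fst continuous_on_snd continuous_on_id)
qed

lemma joint_bilinear:
  fixes prd :: "'c::euclidean_space \<Rightarrow> 'd::euclidean_space \<Rightarrow> 'e::euclidean_space"
  assumes "bounded_bilinear prd" "f \<in> borel_measurable LT" "joint \<phi>"
  shows "joint (\<lambda>t w. prd (f t) (\<phi> t w))"
  using borel_measurable_bilinear[OF assms(1) joint_time[OF assms(2)] assms(3)[unfolded joint_def split_beta']]
  unfolding joint_def split_beta' .

lemma L2F_bilinear:
  fixes prd :: "'c::euclidean_space \<Rightarrow> 'd::euclidean_space \<Rightarrow> 'e::euclidean_space"
  assumes bil: "bounded_bilinear prd" and f: "f \<in> borel_measurable (restrict_space borel {0..T})" "bounded (f ` {0..T})"
    and \<phi>: "\<phi> \<in> L2F M T W"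
  shows "(\<lambda>t w. prd (f t) (\<phi> t w)) \<in> L2F M T W"
proof -
  interpret bounded_bilinear prd by fact
  obtain K where K: "0 \<le> K" "\<And>a b. norm (prd a b) \<le> norm a * norm b * K" using nonneg_bounded by auto
  obtain L where L: "\<And>t. t \<in> {0..T} \<Longrightarrow> norm (f t) \<le> L" using f(2) unfolding bounded_iff by blast
  have L0: "0 \<le> L" using order_trans[OF norm_ge_zero L[of 0]] T_pos by simp
  have "proc_sq (\<lambda>t w. prd (f t) (\<phi> t w)) \<le> ennreal ((L * K)\<^sup>2) * proc_sq \<phi>"
  proof (rule proc_sq_scale[OF L2F_joint[OF \<phi>]])
    fix t w assume t: "t \<in> {0<..T}"
    have "norm (prd (f t) (\<phi> t w)) \<le> norm (f t) * norm (\<phi> t w) * K" by (rule K)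
    also have "\<dots> \<le> L * norm (\<phi> t w) * K" using t by (intro mult_right_mono L K) auto
    finally show "norm (prd (f t) (\<phi> t w)) \<le> L * K * norm (\<phi> t w)" by (simp add: ac_simps)
  qed (use L0 K in simp)
  also have "\<dots> < \<infinity>" using \<phi> unfolding L2F_iff by (simp add: ennreal_mult_less_top)
  finally have 1: "proc_sq (\<lambda>t w. prd (f t) (\<phi> t w)) < \<infinity>" .
  have pm: "prog_measurable M T W \<phi>" using \<phi> unfolding L2F_iff by blast
  have "prog_measurable M T W (\<lambda>t w. prd (f t) (\<phi> t w))"
    by (rule prog_measurableI,
        rule borel_measurable_bilinear[OF bil prog_measurableD[OF prog_measurable_time[OF f(1)]] prog_measurableD[OF pm]])
  with 1 show ?thesis unfolding L2F_iff by blast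
qed

lemma set_integral_LT:
  fixes c :: "real \<Rightarrow> 'e::euclidean_space"
  assumes "A \<subseteq> {0..T}"
  shows "(LINT r:A|lborel. c r) = (LINT r|LT. indicator A r *\<^sub>R c r)"
  unfolding set_lebesgue_integral_def using assms
  by (subst integral_restrict_space) (auto intro!: Bochner_Integration.integral_cong simp: indicator_def)

lemma joint_integral_measurable:
  fixes c :: "real \<Rightarrow> 'w \<Rightarrow> 'e::euclidean_space"
  assumes "joint c" "A \<in> sets borel" "A \<subseteq> {0..T}"
  shows "(\<lambda>w. LINT r:A|lborel. c r w) \<in> borel_measurable M"
proof -
  interpret LT: sigma_finite_measure LT by (rule sigma_finite_LT)
  have i: "indicator A \<in> borel_measurable LT" using assms(2) by (intro measurable_restrict_space1) simp
  have "(\<lambda>p. indicator A (fst p) *\<^sub>R c (fst p) (snd p)) \<in> borel_measurable (LT \<Otimes>\<^sub>M M)"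
    by (rule borel_measurable_scaleR[OF joint_time[OF i] assms(1)[unfolded joint_def split_beta']])
  from measurable_compose[OF measurable_pair_swap'[of M LT] this]
  have "(\<lambda>(w, r). indicator A r *\<^sub>R c r w) \<in> borel_measurable (M \<Otimes>\<^sub>M LT)"
    by (simp add: split_beta')
  from LT.borel_measurable_lebesgue_integral[OF this]
  show ?thesis unfolding set_integral_LT[OF assms(3)] .
qed

lemma ito_sum:
  fixes n :: nat
  assumes "\<And>k. k < n \<Longrightarrow> has_ito_integral M T W (\<phi> k) (I k)"
  shows "has_ito_integral M T W (\<lambda>t w. \<Sum>k<n. \<phi> k t w) (\<lambda>t w. \<Sum>k<n. I k t w)"
  using assms
proof (induction n)
  case 0
  have "simple_wf M T W []" by (simp add: simple_wf_def)
  from ito_simple[OF this] show ?case by (simp add: simple_val_def[abs_def] simple_int_def[abs_def])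
next
  case (Suc n)
  have "has_ito_integral M T W (\<phi> n) (I n)" using Suc.prems by simp
  from ito_add[OF Suc.IH[OF Suc.prems] this] show ?case by simp
qed

text \<open>By the isometry the integrals form a Cauchy sequence in L2. With n fixed, Fatou's lemma
  in the second index bounds the distance of I n to the pointwise limit J, so almost sure
  convergence suffices to identify the integral.\<close>

lemma ito_limit_AE:
  assumes I: "\<And>n. has_ito_integral M T W (\<phi> n) (I n)" and \<psi>: "\<psi> \<in> L2F M T W"
    and lim: "(\<lambda>n. proc_sq (\<lambda>t w. \<phi> n t w - \<psi> t w)) \<longlonglongrightarrow> 0"
    and J: "\<And>t. t \<in> {0..T} \<Longrightarrow> J t \<in> borel_measurable M"
      "\<And>t. t \<in> {0..T} \<Longrightarrow> AE w in M. (\<lambda>n. I n t w) \<longlonglongrightarrow> J t w"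
  shows "has_ito_integral M T W \<psi> J"
proof (rule ito_limit[OF I \<psi> lim J(1)])
  fix t assume t: "t \<in> {0..T}"
  let ?p = "\<lambda>n. proc_sq (\<lambda>t w. \<phi> n t w - \<psi> t w)"
  show "(\<lambda>n. rv_sq (\<lambda>w. I n t w - J t w)) \<longlonglongrightarrow> 0"
  proof (rule tendsto_0_le_ennreal)
    fix n
    have "rv_sq (\<lambda>w. I n t w - J t w) = (\<integral>\<^sup>+w. liminf (\<lambda>m. ennreal ((norm (I n t w - I m t w))\<^sup>2)) \<partial>M)"
      unfolding rv_sq_def
    proof (rule nn_integral_cong_AE, use J(2)[OF t] in eventually_elim)
      fix w assume "(\<lambda>n. I n t w) \<longlonglongrightarrow> J t w"
      then have "(\<lambda>m. ennreal ((norm (I n t w - I m t w))\<^sup>2)) \<longlonglongrightarrow> ennreal ((norm (I n t w - J t w))\<^sup>2)"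
        by (intro tendsto_intros)
      from lim_imp_Liminf[OF _ this]
      show "ennreal ((norm (I n t w - J t w))\<^sup>2) = liminf (\<lambda>m. ennreal ((norm (I n t w - I m t w))\<^sup>2))" by simp
    qed
    also have "\<dots> \<le> liminf (\<lambda>m. rv_sq (\<lambda>w. I n t w - I m t w))"
      unfolding rv_sq_def using ito_measurable[OF I t] by (intro nn_integral_liminf) simp
    also have "\<dots> \<le> liminf (\<lambda>m. ennreal (1 + 1) * ?p n + ennreal (1 + 1 / 1) * ?p m)"
    proof (rule Liminf_mono, intro always_eventually allI)
      fix m
      have "rv_sq (\<lambda>w. I n t w - I m t w) \<le> proc_sq (\<lambda>t w. \<phi> n t w - \<phi> m t w)"
        by (rule ito_isometry_le[OF ito_diff[OF I I] t])
      also have "\<dots> = proc_sq (\<lambda>t w. (\<phi> n t w - \<psi> t w) + (\<psi> t w - \<phi> m t w))" by simp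
      also have "\<dots> \<le> ennreal (1 + 1) * ?p n + ennreal (1 + 1 / 1) * proc_sq (\<lambda>t w. \<psi> t w - \<phi> m t w)"
        by (intro proc_sq_add_le joint_diff L2F_joint ito_L2F[OF I] \<psi>) simp
      finally show "rv_sq (\<lambda>w. I n t w - I m t w) \<le> ennreal (1 + 1) * ?p n + ennreal (1 + 1 / 1) * ?p m"
        by (simp add: proc_sq_minus[of \<psi>])
    qed
    also have "\<dots> = ennreal (1 + 1) * ?p n + ennreal (1 + 1 / 1) * 0"
      by (intro lim_imp_Liminf tendsto_add tendsto_const ennreal_tendsto_cmult lim) auto
    finally show "rv_sq (\<lambda>w. I n t w - J t w) \<le> 2 * ?p n" by simp
  next
    show "(\<lambda>n. 2 * ?p n) \<longlonglongrightarrow> 0" using ennreal_tendsto_cmult[OF _ lim, of 2] by simp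
  qed
qed

lemma sum_indicator_partition:
  fixes \<tau> :: "nat \<Rightarrow> real"
  assumes "\<And>k. \<tau> k \<le> \<tau> (Suc k)"
  shows "(\<Sum>k<n. indicator {\<tau> k<..\<tau> (Suc k)} t) = (indicator {\<tau> 0<..\<tau> n} t :: real)"
proof (induction n)
  case (Suc n)
  have "\<tau> 0 \<le> \<tau> n" using lift_Suc_mono_le[of \<tau> 0 n] assms by simp
  then show ?case using Suc assms[of n] by (auto simp: indicator_def)
qed simp

text \<open>P is frozen at the left ends of a uniform partition, which makes the integral a finite
  sum of linear images of clipped integrals. The integrands converge in L2 by uniform continuity of
  P, the sums converge path by path by \<open>product_sum_estimate\<close>, and
  \<open>ito_limit_AE\<close> joins the two. Only integrability of the derivative of P enters, in
  line with solutions in integrated form.\<close>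

theorem ito_process_product:
  fixes prd :: "'c::euclidean_space \<Rightarrow> 'd::euclidean_space \<Rightarrow> 'e::euclidean_space"
  assumes bil: "bounded_bilinear prd" and x: "ito_process M T W x b \<sigma>" and b: "joint b"
    and Pc: "continuous_on {0..T} P" and dP: "set_integrable lborel {0..T} dP"
    and P: "\<And>t. t \<in> {0..T} \<Longrightarrow> P t = P 0 + (LINT u:{0..t}|lborel. dP u)"
  shows "ito_process M T W (\<lambda>t w. prd (P t) (x t w))
    (\<lambda>t w. prd (dP t) (x t w) + prd (P t) (b t w)) (\<lambda>t w. prd (P t) (\<sigma> t w))"
proof -
  interpret bounded_bilinear prd by fact
  obtain K where K: "0 \<le> K" "\<And>a b. norm (prd a b) \<le> norm a * norm b * K" using nonneg_bounded by auto
  have Pm: "P \<in> borel_measurable (restrict_space borel {0..T})"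
    by (rule borel_measurable_continuous_on_restrict[OF Pc])
  have Pb: "bounded (P ` {0..T})"
    by (intro compact_imp_bounded compact_continuous_image Pc compact_Icc)
  have PLT: "P \<in> borel_measurable LT" using Pm measurable_cong_sets[OF sets_LT refl] by blast
  have dPLT: "dP \<in> borel_measurable LT"
    using dP unfolding set_integrable_def by (simp add: borel_measurable_restrict_space_iff)
  have xL: "x \<in> L2F M T W" and xc: "AE w in M. continuous_on {0..T} (\<lambda>t. x t w)"
    and bi: "AE w in M. set_integrable lborel {0..T} (\<lambda>t. b t w)"
    and I: "has_ito_integral M T W \<sigma> (\<lambda>t w. x t w - x 0 w - (LINT s:{0..t}|lborel. b s w))"
    using x unfolding ito_process_def by auto
  define I where "I = (\<lambda>t w. x t w - x 0 w - (LINT s:{0..t}|lborel. b s w))"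
  define c where "c = (\<lambda>t w. prd (dP t) (x t w) + prd (P t) (b t w))"
  have jc: "joint c" unfolding c_def
    by (intro joint_add joint_bilinear[OF bil] dPLT PLT b L2F_joint xL)
  have \<psi>: "(\<lambda>t w. prd (P t) (\<sigma> t w)) \<in> L2F M T W" by (rule L2F_bilinear[OF bil Pm Pb ito_L2F[OF I]])
  \<comment> \<open>The modulus of continuity of P fixes the mesh uniformly over all paths. The
    extra demand \<open>Suc n \<le> N\<close> sends the mesh to zero in any case, because the path
    of x, whose modulus depends on w, needs that as well.\<close>
  have "\<exists>N. Suc n \<le> N \<and> (\<forall>r\<in>{0..T}. \<forall>r'\<in>{0..T}. \<bar>r - r'\<bar> \<le> T / real N \<longrightarrow> norm (P r - P r') \<le> 1 / Suc n)" for n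
  proof -
    have "uniformly_continuous_on {0..T} P" by (rule compact_uniformly_continuous[OF Pc compact_Icc])
    then obtain d where d: "d > 0" "\<And>r r'. r \<in> {0..T} \<Longrightarrow> r' \<in> {0..T} \<Longrightarrow> dist r' r < d \<Longrightarrow> dist (P r') (P r) < 1 / Suc n"
      unfolding uniformly_continuous_on_def by (metis of_nat_0_less_iff zero_less_Suc zero_less_divide_1_iff)
    obtain m where m: "T / d < real m" using reals_Archimedean2 by blast
    let ?N = "max (Suc n) m"
    have "T / d < real ?N" "real ?N > 0" using m by auto
    then have "T / real ?N < d" using d(1) by (simp add: field_simps)
    then have "norm (P r - P r') \<le> 1 / Suc n" if "r \<in> {0..T}" "r' \<in> {0..T}" "\<bar>r - r'\<bar> \<le> T / real ?N" for r r'
      using d(2)[OF that(2,1)] that(3) unfolding dist_norm real_norm_def by linarith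
    then show ?thesis by (intro exI[of _ ?N]) auto
  qed
  then obtain N where N: "\<And>n. Suc n \<le> N n"
      "\<And>n r r'. r \<in> {0..T} \<Longrightarrow> r' \<in> {0..T} \<Longrightarrow> \<bar>r - r'\<bar> \<le> T / real (N n) \<Longrightarrow> norm (P r - P r') \<le> 1 / Suc n"
    by metis
  define \<tau> where "\<tau> n k = T * real k / real (N n)" for n k
  have Npos: "real (N n) > 0" for n using N(1)[of n] by simp
  have \<tau>: "\<tau> n k \<le> \<tau> n (Suc k)" "\<tau> n 0 = 0" "\<tau> n (N n) = T" "0 \<le> \<tau> n k" for n k
    using Npos[of n] T_pos by (simp_all add: \<tau>_def divide_right_mono)
  have \<tau>T: "\<tau> n k \<le> T" if "k \<le> N n" for n k
    using that Npos[of n] T_pos by (simp add: \<tau>_def field_simps)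
  have \<tau>d: "\<tau> n (Suc k) - \<tau> n k = T / real (N n)" for n k
    unfolding \<tau>_def diff_divide_distrib[symmetric] by (simp add: algebra_simps)
  define \<phi> where "\<phi> n = (\<lambda>t w. \<Sum>k<N n. prd (P (\<tau> n k)) (indicator {\<tau> n k<..\<tau> n (Suc k)} t *\<^sub>R \<sigma> t w))" for n
  define J where "J n = (\<lambda>t w. \<Sum>k<N n. prd (P (\<tau> n k)) (I (min (\<tau> n (Suc k)) t) w - I (min (\<tau> n k) t) w))" for n
  have itoJ: "has_ito_integral M T W (\<phi> n) (J n)" for n
    unfolding \<phi>_def J_def I_def
    by (intro ito_sum ito_linear[OF ito_clip[OF I] bounded_linear_right] \<tau> \<tau>T) simp
  have osc: "norm (P r - P r') \<le> 1 / Suc n" if "k < N n" "r \<in> {\<tau> n k..\<tau> n (Suc k)}" "r' \<in> {\<tau> n k..\<tau> n (Suc k)}" for n k r r'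
  proof (rule N(2))
    show "\<bar>r - r'\<bar> \<le> T / real (N n)" using that \<tau>d[of n k] by (auto simp: abs_if)
    show "r \<in> {0..T}" "r' \<in> {0..T}" using that \<tau>(4)[of n k] \<tau>T[of "Suc k" n] by auto
  qed
  have lim: "(\<lambda>n. proc_sq (\<lambda>t w. \<phi> n t w - prd (P t) (\<sigma> t w))) \<longlonglongrightarrow> 0"
  proof (rule tendsto_0_le_ennreal)
    fix n
    show "proc_sq (\<lambda>t w. \<phi> n t w - prd (P t) (\<sigma> t w)) \<le> ennreal ((1 / Suc n * K)\<^sup>2) * proc_sq \<sigma>"
    proof (rule proc_sq_scale[OF L2F_joint[OF ito_L2F[OF I]]])
      fix t w assume t: "t \<in> {0<..T}"
      \<comment> \<open>For t in (0, T] exactly one cell contains t.\<close>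
      have s1: "(\<Sum>k<N n. indicator {\<tau> n k<..\<tau> n (Suc k)} t) = (1::real)"
        using sum_indicator_partition[of "\<tau> n" t "N n"] \<tau> t by simp
      have "\<phi> n t w - prd (P t) (\<sigma> t w) = \<phi> n t w - (\<Sum>k<N n. indicator {\<tau> n k<..\<tau> n (Suc k)} t) *\<^sub>R prd (P t) (\<sigma> t w)"
        unfolding s1 by simp
      also have "\<dots> = (\<Sum>k<N n. indicator {\<tau> n k<..\<tau> n (Suc k)} t *\<^sub>R prd (P (\<tau> n k) - P t) (\<sigma> t w))"
        unfolding \<phi>_def scaleR_sum_left sum_subtractf[symmetric]
        by (simp add: scaleR_right diff_left scaleR_diff_right)
      also have "norm \<dots> \<le> (\<Sum>k<N n. indicator {\<tau> n k<..\<tau> n (Suc k)} t * (1 / Suc n * norm (\<sigma> t w) * K))"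
      proof (rule sum_norm_le)
        fix k assume k: "k \<in> {..<N n}"
        show "norm (indicator {\<tau> n k<..\<tau> n (Suc k)} t *\<^sub>R prd (P (\<tau> n k) - P t) (\<sigma> t w))
          \<le> indicator {\<tau> n k<..\<tau> n (Suc k)} t * (1 / Suc n * norm (\<sigma> t w) * K)"
        proof (cases "t \<in> {\<tau> n k<..\<tau> n (Suc k)}")
          case True
          have "norm (prd (P (\<tau> n k) - P t) (\<sigma> t w)) \<le> norm (P (\<tau> n k) - P t) * norm (\<sigma> t w) * K" by (rule K)
          also have "\<dots> \<le> 1 / Suc n * norm (\<sigma> t w) * K"
            using True k by (intro mult_right_mono osc[of k] K) auto
          finally show ?thesis using True by simp
        qed simp
      qed
      also have "\<dots> = 1 / Suc n * norm (\<sigma> t w) * K"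
        unfolding sum_distrib_right[symmetric] s1 by simp
      finally show "norm (\<phi> n t w - prd (P t) (\<sigma> t w)) \<le> 1 / Suc n * K * norm (\<sigma> t w)"
        by (simp add: ac_simps)
    qed (use K in simp)
  next
    have "(\<lambda>n. ennreal ((1 / Suc n * K)\<^sup>2)) \<longlonglongrightarrow> ennreal ((0 * K)\<^sup>2)"
      by (intro tendsto_ennrealI tendsto_intros LIMSEQ_Suc[OF lim_1_over_n])
    then have "(\<lambda>n. proc_sq \<sigma> * ennreal ((1 / Suc n * K)\<^sup>2)) \<longlonglongrightarrow> proc_sq \<sigma> * ennreal ((0 * K)\<^sup>2)"
      using ito_L2F[OF I] unfolding L2F_iff by (intro ennreal_tendsto_cmult) auto
    then show "(\<lambda>n. ennreal ((1 / Suc n * K)\<^sup>2) * proc_sq \<sigma>) \<longlonglongrightarrow> 0"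
      by (simp add: mult.commute)
  qed
  define Z where "Z = (\<lambda>t w. prd (P t) (x t w) - prd (P 0) (x 0 w) - (LINT u:{0..t}|lborel. c u w))"
  have path: "(\<lambda>n. J n t w) \<longlonglongrightarrow> Z t w"
    if t: "t \<in> {0..T}" and c': "continuous_on {0..T} (\<lambda>t. x t w)" and b': "set_integrable lborel {0..T} (\<lambda>t. b t w)" for t w
  proof (rule LIMSEQ_I)
    fix r :: real assume r: "0 < r"
    define C where "C = (LINT u:{0..T}|lborel. norm (dP u) + norm (b u w))"
    have C0: "0 \<le> C" unfolding C_def set_lebesgue_integral_def by (intro integral_nonneg_AE) auto
    \<comment> \<open>The summand 1 keeps the denominator positive when K C = 0 and makes the final
      bound e K C < r strict.\<close>
    define e where "e = r / (K * C + 1)"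
    have KC: "0 \<le> K * C" using K C0 by simp
    have e: "e > 0" "e * K * C < r" using r KC by (auto simp: e_def field_simps)
    have "uniformly_continuous_on {0..T} (\<lambda>t. x t w)" by (rule compact_uniformly_continuous[OF c' compact_Icc])
    then obtain d where d: "d > 0" "\<And>r r'. r \<in> {0..T} \<Longrightarrow> r' \<in> {0..T} \<Longrightarrow> dist r' r < d \<Longrightarrow> dist (x r' w) (x r w) < e"
      unfolding uniformly_continuous_on_def using e(1) by metis
    obtain m where m: "max (T / d) (1 / e) < real m" using reals_Archimedean2 by blast
    show "\<exists>no. \<forall>n\<ge>no. norm (J n t w - Z t w) < r"
    proof (intro exI[of _ m] allI impI)
      fix n assume n: "m \<le> n"
      have "T / d < real (N n)" "1 / e < real (Suc n)" using m n N(1)[of n] by auto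
      then have small: "T / real (N n) < d" "1 / Suc n \<le> e"
        using d(1) e(1) Npos[of n] by (simp_all add: field_simps)
      have "norm (J n t w - Z t w) \<le> e * K * C"
        unfolding J_def Z_def c_def C_def I_def
      proof (rule product_sum_estimate[OF bil K _ _ \<tau>(1-3) c' b' dP P Pc])
        fix k q q' assume k: "k < N n" and q: "q \<in> {\<tau> n k..\<tau> n (Suc k)}" "q' \<in> {\<tau> n k..\<tau> n (Suc k)}"
        have qq: "\<bar>q - q'\<bar> < d" using q \<tau>d[of n k] small by (auto simp: abs_if)
        have "q \<in> {0..T}" "q' \<in> {0..T}" using q k \<tau>(4)[of n k] \<tau>T[of "Suc k" n] by auto
        from d(2)[OF this(2,1)] qq osc[OF k q] small
        show "norm (x q w - x q' w) \<le> e \<and> norm (P q - P q') \<le> e" by (simp add: dist_norm)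
      qed (use t e in auto)
      then show "norm (J n t w - Z t w) < r" using e by linarith
    qed
  qed
  have itoZ: "has_ito_integral M T W (\<lambda>t w. prd (P t) (\<sigma> t w)) Z"
  proof (rule ito_limit_AE[OF itoJ \<psi> lim])
    fix t assume t: "t \<in> {0..T}"
    have "(\<lambda>w. prd (P s) (x s w)) \<in> borel_measurable M" if "s \<in> {0..T}" for s
      by (rule borel_measurable_bilinear[OF bil _ joint_rv[OF L2F_joint[OF xL] that]]) simp
    then show "Z t \<in> borel_measurable M"
      unfolding Z_def using t T_pos by (intro borel_measurable_diff joint_integral_measurable[OF jc]) auto
    show "AE w in M. (\<lambda>n. J n t w) \<longlonglongrightarrow> Z t w"
      using xc bi by eventually_elim (rule path[OF t])
  qed
  show ?thesis
    unfolding ito_process_def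
  proof (intro conjI)
    show "(\<lambda>t w. prd (P t) (x t w)) \<in> L2F M T W" by (rule L2F_bilinear[OF bil Pm Pb xL])
    show "AE w in M. continuous_on {0..T} (\<lambda>t. prd (P t) (x t w))"
      using xc by eventually_elim (rule continuous_on[OF Pc])
    show "AE w in M. set_integrable lborel {0..T} (\<lambda>t. prd (dP t) (x t w) + prd (P t) (b t w))"
      using xc bi
    proof eventually_elim
      case (elim w)
      have "bounded ((\<lambda>t. x t w) ` {0..T})"
        by (intro compact_imp_bounded compact_continuous_image elim compact_Icc)
      with elim show ?case
        by (intro set_integral_add set_integrable_bilinear[OF bil dP] set_integrable_bilinear[OF flip _ Pm Pb]
            borel_measurable_continuous_on_restrict)
    qed
    show "has_ito_integral M T W (\<lambda>t w. prd (P t) (\<sigma> t w))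
      (\<lambda>t w. prd (P t) (x t w) - prd (P 0) (x 0 w) - (LINT s:{0..t}|lborel. prd (dP s) (x s w) + prd (P s) (b s w)))"
      using itoZ unfolding Z_def c_def .
  qed
qed

end

section \<open>Linear backward equations with zero data\<close>

context brownian_basis
begin

section \<open>Null sets of the product space and changes of coefficients\<close>

lemma borel_measurable_path_nn_integral:
  assumes "f \<in> borel_measurable (LT \<Otimes>\<^sub>M M)"
  shows "(\<lambda>w. \<integral>\<^sup>+t. f (t, w) \<partial>LT) \<in> borel_measurable M"
proof -
  interpret LT: sigma_finite_measure LT by (rule sigma_finite_LT)
  from measurable_compose[OF measurable_pair_swap'[of M LT] assms]
  have "(\<lambda>(w, t). f (t, w)) \<in> borel_measurable (M \<Otimes>\<^sub>M LT)" by (simp add: split_beta')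
  from LT.borel_measurable_nn_integral[OF this] show ?thesis .
qed

text \<open>Tonelli's theorem on a measurable null superset: almost every path section of it is
  null. Equality of controls is known on the product space, whereas drift integrals are formed along
  single paths.\<close>

lemma AE_pair_path:
  assumes "AE (t, w) in LT \<Otimes>\<^sub>M M. Q t w"
  shows "AE w in M. AE t in LT. Q t w"
proof -
  interpret P: pair_sigma_finite LT M by (rule pair_sigma_finite_LT)
  obtain N where N: "{p \<in> space (LT \<Otimes>\<^sub>M M). \<not> (case p of (t, w) \<Rightarrow> Q t w)} \<subseteq> N"
      "N \<in> sets (LT \<Otimes>\<^sub>M M)" "emeasure (LT \<Otimes>\<^sub>M M) N = 0"
    by (rule AE_E[OF assms])
  have "(\<integral>\<^sup>+w. (\<integral>\<^sup>+t. indicator N (t, w) \<partial>LT) \<partial>M) = 0"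
    using P.nn_integral_snd[of "indicator N"] N(2,3) by simp
  moreover have "(\<lambda>w. \<integral>\<^sup>+t. indicator N (t, w) \<partial>LT) \<in> borel_measurable M"
    by (rule borel_measurable_path_nn_integral[OF borel_measurable_indicator[OF N(2)]])
  ultimately have "AE w in M. (\<integral>\<^sup>+t. indicator N (t, w) \<partial>LT) = 0"
    by (simp add: nn_integral_0_iff_AE)
  then show ?thesis
    using AE_space
  proof eventually_elim
    case (elim w)
    have "(\<lambda>t. indicator N (t, w) :: ennreal) \<in> borel_measurable LT"
      by (rule measurable_compose[OF measurable_Pair2'[OF elim(2)] borel_measurable_indicator[OF N(2)]])
    with elim(1) have "AE t in LT. indicator N (t, w) = (0::ennreal)" by (simp only: nn_integral_0_iff_AE)
    then show "AE t in LT. Q t w"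
      using AE_space
    proof eventually_elim
      case (elim t)
      then have "(t, w) \<notin> N" by (simp add: indicator_eq_0_iff)
      with N(1) have "(t, w) \<notin> {p \<in> space (LT \<Otimes>\<^sub>M M). \<not> (case p of (t, w) \<Rightarrow> Q t w)}" by blast
      then show "Q t w" using elim(2) \<open>w \<in> space M\<close> by (simp add: space_pair_measure)
    qed
  qed
qed

lemma proc_sq_eq_0:
  assumes "joint \<phi>" shows "proc_sq \<phi> = 0 \<longleftrightarrow> (AE (t, w) in LT \<Otimes>\<^sub>M M. \<phi> t w = 0)"
  unfolding proc_sq_pair[OF assms] using assms
  by (subst nn_integral_0_iff_AE) (simp_all add: joint_def split_beta')

text \<open>A constant sequence in \<open>ito_limit_AE\<close>: the integrals are already equal
  almost surely and the integrands have distance zero.\<close>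

lemma ito_cong:
  assumes I: "has_ito_integral M T W \<phi> I" and \<psi>: "\<psi> \<in> L2F M T W"
    and eq: "AE (t, w) in LT \<Otimes>\<^sub>M M. \<phi> t w = \<psi> t w"
    and J: "\<And>t. t \<in> {0..T} \<Longrightarrow> J t \<in> borel_measurable M" "\<And>t. t \<in> {0..T} \<Longrightarrow> AE w in M. I t w = J t w"
  shows "has_ito_integral M T W \<psi> J"
proof (rule ito_limit_AE[OF I \<psi> _ J(1)])
  have "proc_sq (\<lambda>t w. \<phi> t w - \<psi> t w) = 0"
    using eq by (subst proc_sq_eq_0[OF joint_diff[OF L2F_joint[OF ito_L2F[OF I]] L2F_joint[OF \<psi>]]]) (simp add: split_beta')
  then show "(\<lambda>n::nat. proc_sq (\<lambda>t w. \<phi> t w - \<psi> t w)) \<longlonglongrightarrow> 0" by simp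
  show "AE w in M. (\<lambda>n::nat. I t w) \<longlonglongrightarrow> J t w" if "t \<in> {0..T}" for t
    using J(2)[OF that] by eventually_elim simp
qed

lemma set_integral_cong_LT:
  fixes f h :: "real \<Rightarrow> 'e::euclidean_space"
  assumes "AE t in LT. f t = h t" "f \<in> borel_measurable LT" "h \<in> borel_measurable LT"
  shows "set_integrable lborel {0..T} f \<longleftrightarrow> set_integrable lborel {0..T} h"
    and "r \<in> {0..T} \<Longrightarrow> (LINT t:{0..r}|lborel. f t) = (LINT t:{0..r}|lborel. h t)"
proof -
  have *: "set_integrable lborel {0..T} g \<longleftrightarrow> integrable LT g" for g :: "real \<Rightarrow> 'e"
    unfolding set_integrable_def by (subst integrable_restrict_space) simp_all
  show "set_integrable lborel {0..T} f \<longleftrightarrow> set_integrable lborel {0..T} h"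
    unfolding * by (rule integrable_cong_AE[OF assms(2,3,1)])
  assume r: "r \<in> {0..T}"
  then have sub: "{0..r} \<subseteq> {0..T}" by auto
  have i: "indicator {0..r} \<in> borel_measurable LT" by (rule measurable_restrict_space1) simp
  show "(LINT t:{0..r}|lborel. f t) = (LINT t:{0..r}|lborel. h t)"
    unfolding set_integral_LT[OF sub]
    by (intro integral_cong_AE borel_measurable_scaleR i assms(2,3)) (use assms(1) in eventually_elim, simp)
qed

text \<open>Needed because the open-loop form of the controls is an almost everywhere identity: the
  process stays, only its drift and diffusion are rewritten.\<close>

lemma ito_process_cong:
  assumes x: "ito_process M T W x b \<sigma>" and b: "joint b" "joint b'" and \<sigma>': "\<sigma>' \<in> L2F M T W"
    and eq: "AE (t, w) in LT \<Otimes>\<^sub>M M. b t w = b' t w" "AE (t, w) in LT \<Otimes>\<^sub>M M. \<sigma> t w = \<sigma>' t w"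
  shows "ito_process M T W x b' \<sigma>'"
proof -
  have xL: "x \<in> L2F M T W" and xc: "AE w in M. continuous_on {0..T} (\<lambda>t. x t w)"
    and bi: "AE w in M. set_integrable lborel {0..T} (\<lambda>t. b t w)"
    and I: "has_ito_integral M T W \<sigma> (\<lambda>t w. x t w - x 0 w - (LINT s:{0..t}|lborel. b s w))"
    using x unfolding ito_process_def by auto
  have sp: "AE w in M. w \<in> space M" by (rule AE_space)
  show ?thesis
    unfolding ito_process_def
  proof (intro conjI xL xc)
    show "AE w in M. set_integrable lborel {0..T} (\<lambda>t. b' t w)"
      using bi AE_pair_path[OF eq(1)] sp
    proof eventually_elim
      case (elim w)
      then show ?case
        using set_integral_cong_LT(1)[OF elim(2) joint_path[OF b(1) elim(3)] joint_path[OF b(2) elim(3)]] by blast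
    qed
    show "has_ito_integral M T W \<sigma>' (\<lambda>t w. x t w - x 0 w - (LINT s:{0..t}|lborel. b' s w))"
    proof (rule ito_cong[OF I \<sigma>' eq(2)])
      fix t assume t: "t \<in> {0..T}"
      show "(\<lambda>w. x t w - x 0 w - (LINT s:{0..t}|lborel. b' s w)) \<in> borel_measurable M"
        using t T_pos by (intro borel_measurable_diff joint_rv L2F_joint[OF xL] joint_integral_measurable b) auto
      show "AE w in M. x t w - x 0 w - (LINT s:{0..t}|lborel. b s w) = x t w - x 0 w - (LINT s:{0..t}|lborel. b' s w)"
        using AE_pair_path[OF eq(1)] sp
      proof eventually_elim
        case (elim w)
        then show ?case
          using set_integral_cong_LT(2)[OF elim(1) joint_path[OF b(1) elim(2)] joint_path[OF b(2) elim(2)] t] by simp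
      qed
    qed
  qed
qed

text \<open>Cauchy-Schwarz in time, then expectation. The factor r - s is what makes short intervals
  contracting in the uniqueness proof.\<close>

lemma set_integral_sq_le:
  fixes f :: "real \<Rightarrow> 'w \<Rightarrow> 'e::euclidean_space"
  assumes f: "joint f" and s: "0 \<le> s" "s \<le> r" "r \<le> T"
  shows "rv_sq (\<lambda>w. LINT u:{s<..r}|lborel. f u w) \<le> ennreal (r - s) * proc_sq (\<lambda>t w. indicator {s<..r} t *\<^sub>R f t w)"
proof -
  let ?A = "{s<..r}"
  have sub: "?A \<subseteq> {0..T}" using s by auto
  have i: "indicator ?A \<in> borel_measurable LT" by (rule measurable_restrict_space1) simp
  let ?g = "\<lambda>t w. indicator ?A t *\<^sub>R f t w"
  have jg: "joint ?g"
    using borel_measurable_scaleR[OF joint_time[OF i] f[unfolded joint_def split_beta']] unfolding joint_def split_beta' .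
  have path: "ennreal ((norm (LINT u:?A|lborel. f u w))\<^sup>2) \<le> ennreal (r - s) * (\<integral>\<^sup>+t. ennreal ((norm (?g t w))\<^sup>2) \<partial>LT)"
    if o: "w \<in> space M" for w
  proof -
    have gm: "(\<lambda>t. ?g t w) \<in> borel_measurable LT" by (rule joint_path[OF jg o])
    have "ennreal (norm (LINT u:?A|lborel. f u w)) \<le> (\<integral>\<^sup>+t. ennreal (norm (?g t w)) \<partial>LT)"
      unfolding set_integral_LT[OF sub]
    proof (cases "integrable LT (\<lambda>t. ?g t w)")
      case True then show "ennreal (norm (LINT t|LT. ?g t w)) \<le> (\<integral>\<^sup>+t. ennreal (norm (?g t w)) \<partial>LT)"
        by (rule integral_norm_bound_ennreal)
    next
      \<comment> \<open>For a path that is not integrable the Bochner integral is 0 by convention,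
        so the bound still holds.\<close>
      case False then show "ennreal (norm (LINT t|LT. ?g t w)) \<le> (\<integral>\<^sup>+t. ennreal (norm (?g t w)) \<partial>LT)"
        by (simp add: not_integrable_integral_eq)
    qed
    have "(ennreal (norm (LINT u:?A|lborel. f u w)))\<^sup>2 \<le> (\<integral>\<^sup>+t. indicator ?A t * ennreal (norm (?g t w)) \<partial>LT)\<^sup>2"
    proof -
      have "(\<integral>\<^sup>+t. ennreal (norm (?g t w)) \<partial>LT) = (\<integral>\<^sup>+t. indicator ?A t * ennreal (norm (?g t w)) \<partial>LT)"
        by (intro nn_integral_cong) (simp add: indicator_def)
      then show ?thesis
        using \<open>ennreal (norm (LINT u:?A|lborel. f u w)) \<le> _\<close> unfolding power2_eq_square by (intro mult_mono) simp_all
    qed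
    also have "\<dots> \<le> (\<integral>\<^sup>+t. (indicator ?A t)\<^sup>2 \<partial>LT) * (\<integral>\<^sup>+t. (ennreal (norm (?g t w)))\<^sup>2 \<partial>LT)"
      by (rule Cauchy_Schwarz_nn_integral[OF _ measurable_compose[OF measurable_compose[OF gm borel_measurable_norm] measurable_ennreal]],
          rule measurable_restrict_space1) simp
    also have "(\<integral>\<^sup>+t. (indicator ?A t)\<^sup>2 \<partial>LT) = (\<integral>\<^sup>+t. indicator ?A t \<partial>lborel)"
      using sub by (subst nn_integral_restrict_space) (simp, intro nn_integral_cong, auto simp: indicator_def)
    also have "\<dots> = ennreal (r - s)" using s by simp
    finally show ?thesis by (simp add: ennreal_power)
  qed
  have "rv_sq (\<lambda>w. LINT u:?A|lborel. f u w) \<le> (\<integral>\<^sup>+w. ennreal (r - s) * (\<integral>\<^sup>+t. ennreal ((norm (?g t w))\<^sup>2) \<partial>LT) \<partial>M)"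
    unfolding rv_sq_def by (intro nn_integral_mono path)
  also have "\<dots> = ennreal (r - s) * proc_sq ?g"
  proof -
    have "(\<lambda>p. ennreal ((norm (case p of (t, w) \<Rightarrow> ?g t w))\<^sup>2)) \<in> borel_measurable (LT \<Otimes>\<^sub>M M)"
      using jg unfolding joint_def by simp
    from borel_measurable_path_nn_integral[OF this]
    have "(\<lambda>w. \<integral>\<^sup>+t. ennreal ((norm (?g t w))\<^sup>2) \<partial>LT) \<in> borel_measurable M" by simp
    then show ?thesis unfolding proc_sq_def nn_integral_LT by (rule nn_integral_cmult)
  qed
  finally show ?thesis .
qed

lemma proc_sq_fst:
  assumes "joint \<phi>" shows "proc_sq \<phi> = (\<integral>\<^sup>+t. rv_sq (\<phi> t) \<partial>LT)"
proof -
  have "(\<lambda>p. ennreal ((norm (case p of (t, w) \<Rightarrow> \<phi> t w))\<^sup>2)) \<in> borel_measurable (LT \<Otimes>\<^sub>M M)"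
    using assms unfolding joint_def by simp
  from nn_integral_fst[OF this] show ?thesis
    unfolding proc_sq_pair[OF assms] rv_sq_def by simp
qed

lemma joint_indicator:
  assumes "joint \<phi>" "A \<in> sets borel" shows "joint (\<lambda>t w. indicator A t *\<^sub>R \<phi> t w)"
proof -
  have "(\<lambda>t. indicator A t :: real) \<in> borel_measurable LT" using assms(2) by (intro measurable_restrict_space1) simp
  from borel_measurable_scaleR[OF joint_time[OF this] assms(1)[unfolded joint_def split_beta']]
  show ?thesis unfolding joint_def split_beta' .
qed

lemma proc_sq_bound_sum:
  fixes b :: "real \<Rightarrow> 'w \<Rightarrow> 'e::euclidean_space" and \<phi> :: "real \<Rightarrow> 'w \<Rightarrow> 'f::euclidean_space"
    and \<psi> :: "real \<Rightarrow> 'w \<Rightarrow> 'g::euclidean_space"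
  assumes "joint \<phi>" "joint \<psi>" "0 \<le> k"
    and "\<And>t w. t \<in> {0<..T} \<Longrightarrow> w \<in> space M \<Longrightarrow> norm (b t w) \<le> k * (norm (\<phi> t w) + norm (\<psi> t w))"
  shows "proc_sq b \<le> ennreal (2 * k\<^sup>2) * (proc_sq \<phi> + proc_sq \<psi>)"
proof -
  have j: "joint (\<lambda>t w. norm (\<phi> t w))" "joint (\<lambda>t w. norm (\<psi> t w))"
    using assms(1,2) unfolding joint_def split_beta' by simp_all
  have "proc_sq b \<le> ennreal (k\<^sup>2) * proc_sq (\<lambda>t w. norm (\<phi> t w) + norm (\<psi> t w))"
    by (rule proc_sq_scale[OF joint_add[OF j]]) (use assms in auto)
  also have "\<dots> \<le> ennreal (k\<^sup>2) * (ennreal (1 + 1) * proc_sq (\<lambda>t w. norm (\<phi> t w)) + ennreal (1 + 1 / 1) * proc_sq (\<lambda>t w. norm (\<psi> t w)))"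
    by (intro mult_left_mono proc_sq_add_le j) simp_all
  also have "\<dots> = ennreal (2 * k\<^sup>2) * (proc_sq \<phi> + proc_sq \<psi>)"
    by (simp add: proc_sq_def ennreal_mult distrib_left mult_ac)
  finally show ?thesis .
qed

text \<open>Taking second moments in \<open>d\<^sub>s + \<integral>\<^sub>s\<^sup>T \<zeta> dW = - \<integral>\<^sub>s\<^sup>T b dt\<close>, where the two terms on the left are orthogonal,
  replaces the Ito formula for \<open>|d|\<^sup>2\<close>.\<close>

lemma bsde_energy:
  fixes d :: "real \<Rightarrow> 'w \<Rightarrow> 'e::euclidean_space"
  assumes d: "ito_process M T W d b \<zeta>" and b: "joint b" "proc_sq b < \<infinity>"
    and end0: "AE w in M. d T w = 0" and s: "0 \<le> s" "s \<le> T"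
  shows "rv_sq (d s) + proc_sq (\<lambda>t w. indicator {s<..T} t *\<^sub>R \<zeta> t w) = rv_sq (\<lambda>w. LINT u:{s<..T}|lborel. b u w)"
proof -
  define I where "I = (\<lambda>t w. d t w - d 0 w - (LINT u:{0..t}|lborel. b u w))"
  have dL: "d \<in> L2F M T W" and bi: "AE w in M. set_integrable lborel {0..T} (\<lambda>t. b t w)"
    and I: "has_ito_integral M T W \<zeta> I"
    using d unfolding ito_process_def I_def by auto
  have dF: "d s \<in> borel_measurable (F s)"
    using dL s unfolding L2F_iff by (intro prog_measurable_adapted) auto
  have Bm: "(\<lambda>w. LINT u:{s<..T}|lborel. b u w) \<in> borel_measurable M"
    using s by (intro joint_integral_measurable b) auto
  have Im: "I s \<in> borel_measurable M" "I T \<in> borel_measurable M" using ito_measurable[OF I] s by auto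
  have eq: "AE w in M. d s w + (I T w - I s w) = - (LINT u:{s<..T}|lborel. b u w)"
    using bi end0
  proof eventually_elim
    case (elim w)
    then show ?case
      using set_integral_Ioc_diff[OF elim(1) s order_refl] unfolding I_def by (simp add: algebra_simps)
  qed
  have Bfin: "rv_sq (\<lambda>w. LINT u:{s<..T}|lborel. b u w) < \<infinity>"
  proof -
    have "rv_sq (\<lambda>w. LINT u:{s<..T}|lborel. b u w) \<le> ennreal (T - s) * proc_sq (\<lambda>t w. indicator {s<..T} t *\<^sub>R b t w)"
      by (rule set_integral_sq_le[OF b(1) s order_refl])
    also have "\<dots> \<le> ennreal (T - s) * proc_sq b"
      by (intro mult_left_mono proc_sq_mono) (simp_all add: indicator_def)
    also have "\<dots> < \<infinity>" using b(2) by (simp add: ennreal_mult_less_top)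
    finally show ?thesis .
  qed
  have Ifin: "rv_sq (I r) < \<infinity>" if "r \<in> {0..T}" for r
    using ito_isometry_le[OF I that] ito_L2F[OF I] unfolding L2F_iff by (auto intro: order_le_less_trans)
  \<comment> \<open>Membership in \<open>L2F\<close> bounds the second moment at almost every time
    only. The identity \<open>eq\<close> gives it at each s, as \<open>ito_pythagoras\<close>
    requires of the past value.\<close>
  have dfin: "rv_sq (d s) < \<infinity>"
  proof -
    have "rv_sq (d s) = rv_sq (\<lambda>w. (- 1) *\<^sub>R (LINT u:{s<..T}|lborel. b u w) + (I s w - I T w))"
      by (rule rv_sq_cong_AE, use eq in eventually_elim) (simp add: algebra_simps)
    also have "\<dots> \<le> 2 * rv_sq (\<lambda>w. (- 1) *\<^sub>R (LINT u:{s<..T}|lborel. b u w)) + 2 * rv_sq (\<lambda>w. I s w + (- 1) *\<^sub>R I T w)"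
      using Bm Im rv_sq_add_le[of "\<lambda>w. (- 1) *\<^sub>R (LINT u:{s<..T}|lborel. b u w)" "\<lambda>w. I s w - I T w"] by simp
    also have "\<dots> \<le> 2 * rv_sq (\<lambda>w. (- 1) *\<^sub>R (LINT u:{s<..T}|lborel. b u w)) + 2 * (2 * rv_sq (I s) + 2 * rv_sq (\<lambda>w. (- 1) *\<^sub>R I T w))"
      using Im by (intro add_left_mono mult_left_mono rv_sq_add_le) simp_all
    also have "\<dots> = 2 * rv_sq (\<lambda>w. LINT u:{s<..T}|lborel. b u w) + 2 * (2 * rv_sq (I s) + 2 * rv_sq (I T))"
      unfolding rv_sq_def by simp
    also have "\<dots> < \<infinity>" using Bfin Ifin[of s] Ifin[of T] s by (simp add: ennreal_mult_less_top)
    finally show ?thesis .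
  qed
  have "rv_sq (d s) + proc_sq (\<lambda>t w. indicator {s<..T} t *\<^sub>R \<zeta> t w) = rv_sq (\<lambda>w. d s w + (I T w - I s w))"
    by (rule ito_pythagoras[OF I s dF dfin, symmetric])
  also have "\<dots> = rv_sq (\<lambda>w. - (LINT u:{s<..T}|lborel. b u w))" by (rule rv_sq_cong_AE[OF eq])
  also have "\<dots> = rv_sq (\<lambda>w. LINT u:{s<..T}|lborel. b u w)" unfolding rv_sq_def by simp
  finally show ?thesis .
qed

text \<open>The energy identity on a short interval bounds the norm of (d, \<zeta>) by a multiple
  smaller than 1 of itself. The solution therefore vanishes on the last stretch of length h, and the
  argument is repeated backwards with the same h, since h depends only on k.\<close>

lemma bsde_zero:
  fixes d :: "real \<Rightarrow> 'w \<Rightarrow> 'e::euclidean_space"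
  assumes d: "ito_process M T W d b \<zeta>" and b: "joint b"
    and end0: "AE w in M. d T w = 0" and k: "0 \<le> k"
    and bnd: "\<And>t w. t \<in> {0..T} \<Longrightarrow> w \<in> space M \<Longrightarrow> norm (b t w) \<le> k * (norm (d t w) + norm (\<zeta> t w))"
  shows "AE (t, w) in LT \<Otimes>\<^sub>M M. d t w = 0" "AE (t, w) in LT \<Otimes>\<^sub>M M. \<zeta> t w = 0"
proof -
  have dL: "d \<in> L2F M T W" and \<zeta>L: "\<zeta> \<in> L2F M T W"
    using d unfolding ito_process_def has_ito_integral_iff by auto
  have jd: "joint d" "joint \<zeta>" by (rule L2F_joint[OF dL], rule L2F_joint[OF \<zeta>L])
  define cut where "cut s \<phi> = (\<lambda>t (w::'w). indicator {s<..T} t *\<^sub>R (\<phi> t w :: 'e))" for s \<phi>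
  define G where "G s = proc_sq (cut s d) + proc_sq (cut s \<zeta>)" for s
  have jc: "joint (cut s \<phi>)" if "joint \<phi>" for s \<phi> unfolding cut_def by (rule joint_indicator[OF that]) simp
  have bG: "proc_sq (cut s b) \<le> ennreal (2 * k\<^sup>2) * G s" for s
    unfolding G_def
  proof (rule proc_sq_bound_sum[OF jc jc k])
    fix t w assume "t \<in> {0<..T}" "w \<in> space M"
    then show "norm (cut s b t w) \<le> k * (norm (cut s d t w) + norm (cut s \<zeta> t w))"
      using bnd[of t w] by (auto simp: cut_def indicator_def)
  qed (rule jd)+
  have Gfin: "G s < \<infinity>" for s
  proof -
    have "G s \<le> proc_sq d + proc_sq \<zeta>"
      unfolding G_def cut_def by (intro add_mono proc_sq_mono) (simp_all add: indicator_def)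
    also have "\<dots> < \<infinity>" using dL \<zeta>L unfolding L2F_iff by simp
    finally show ?thesis .
  qed
  have bfin: "proc_sq b < \<infinity>"
  proof -
    have "proc_sq b \<le> ennreal (2 * k\<^sup>2) * (proc_sq d + proc_sq \<zeta>)"
      by (rule proc_sq_bound_sum[OF jd k]) (use bnd in auto)
    also have "\<dots> < \<infinity>" using dL \<zeta>L unfolding L2F_iff by (simp add: ennreal_mult_less_top)
    finally show ?thesis .
  qed
  note energy = bsde_energy[OF d b bfin end0]
  have Gmono: "G s \<le> G r" if "r \<le> s" for r s
    unfolding G_def cut_def using that by (intro add_mono proc_sq_mono) (auto simp: indicator_def)
  \<comment> \<open>Chosen so that c (1 + h) \<le> 2 c = 4 k^2 h < 1: the minimum with 1 gives the
    first bound, the second term the last one, and the summand 1 covers k = 0.\<close>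
  define h where "h = min 1 (1 / (8 * k\<^sup>2 + 1))"
  have h: "0 < h" "h \<le> 1" "4 * k\<^sup>2 * h < 1"
  proof -
    have p: "0 < 8 * k\<^sup>2 + 1" using zero_le_power2[of k] by linarith
    show "0 < h" "h \<le> 1" using p by (simp_all add: h_def)
    have "4 * k\<^sup>2 * h \<le> 4 * k\<^sup>2 * (1 / (8 * k\<^sup>2 + 1))" by (intro mult_left_mono) (simp_all add: h_def)
    also have "\<dots> < 1" using p by (simp add: field_simps)
    finally show "4 * k\<^sup>2 * h < 1" .
  qed
  define c where "c = 2 * k\<^sup>2 * h"
  have c: "0 \<le> c" "c * (1 + h) < 1"
  proof -
    show "0 \<le> c" using h by (simp add: c_def)
    have "c * (1 + h) \<le> c * 2" using h \<open>0 \<le> c\<close> by (intro mult_left_mono) auto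
    also have "c * 2 = 4 * k\<^sup>2 * h" by (simp add: c_def)
    finally show "c * (1 + h) < 1" using h by linarith
  qed
  have step: "G t = 0" if t1: "G t1 = 0" and t: "0 \<le> t" "t \<le> t1" "t1 \<le> T" "t1 - t \<le> h" for t t1
  proof -
    \<comment> \<open>Once the solution vanishes after t1, so does its drift by the linear bound.
      Only the drift on (s, t1], an interval of length at most h, is left in the energy
      identity.\<close>
    have tail: "AE w in M. (LINT u:{r<..T}|lborel. b u w) = 0" if "t1 \<le> r" "r \<le> T" for r
    proof -
      have "rv_sq (\<lambda>w. LINT u:{r<..T}|lborel. b u w) \<le> ennreal (T - r) * proc_sq (cut r b)"
        unfolding cut_def using that t by (intro set_integral_sq_le b) auto
      also have "\<dots> \<le> ennreal (T - r) * (ennreal (2 * k\<^sup>2) * G t1)"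
        by (intro mult_left_mono order_trans[OF bG] Gmono that) simp_all
      finally have "rv_sq (\<lambda>w. LINT u:{r<..T}|lborel. b u w) = 0" using t1 by simp
      moreover have "(\<lambda>w. LINT u:{r<..T}|lborel. b u w) \<in> borel_measurable M"
        using that t by (intro joint_integral_measurable b) auto
      ultimately show ?thesis by (simp add: rv_sq_eq_0)
    qed
    have main: "rv_sq (d s) + proc_sq (cut s \<zeta>) \<le> ennreal c * G t" if s: "t \<le> s" "s \<le> t1" for s
    proof -
      have bi: "AE w in M. set_integrable lborel {0..T} (\<lambda>t. b t w)"
        using d unfolding ito_process_def by auto
      have "rv_sq (d s) + proc_sq (cut s \<zeta>) = rv_sq (\<lambda>w. LINT u:{s<..T}|lborel. b u w)"
        unfolding cut_def using s t by (intro energy) auto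
      also have "\<dots> = rv_sq (\<lambda>w. LINT u:{s<..t1}|lborel. b u w)"
      proof (rule rv_sq_cong_AE, use bi tail[OF order_refl t(3)] in eventually_elim)
        fix w assume i: "set_integrable lborel {0..T} (\<lambda>t. b t w)" and z: "(LINT u:{t1<..T}|lborel. b u w) = 0"
        have o: "0 \<le> s" "0 \<le> t1" "s \<le> T" using s t by auto
        show "(LINT u:{s<..T}|lborel. b u w) = (LINT u:{s<..t1}|lborel. b u w)"
          using set_integral_Ioc_diff[OF i o(1,3) order_refl] set_integral_Ioc_diff[OF i o(2) t(3) order_refl]
            set_integral_Ioc_diff[OF i o(1) s(2) t(3)] z by simp
      qed
      also have "\<dots> \<le> ennreal (t1 - s) * proc_sq (\<lambda>t w. indicator {s<..t1} t *\<^sub>R b t w)"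
        using s t by (intro set_integral_sq_le b) auto
      also have "\<dots> \<le> ennreal h * (ennreal (2 * k\<^sup>2) * G t)"
      proof (intro mult_mono)
        have "proc_sq (\<lambda>t w. indicator {s<..t1} t *\<^sub>R b t w) \<le> proc_sq (cut s b)"
          unfolding cut_def using t by (intro proc_sq_mono) (auto simp: indicator_def)
        also have "\<dots> \<le> ennreal (2 * k\<^sup>2) * G s" by (rule bG)
        also have "\<dots> \<le> ennreal (2 * k\<^sup>2) * G t" by (intro mult_left_mono Gmono s) simp
        finally show "proc_sq (\<lambda>t w. indicator {s<..t1} t *\<^sub>R b t w) \<le> ennreal (2 * k\<^sup>2) * G t" .
      qed (use s t in \<open>auto intro: ennreal_leI\<close>)
      also have "\<dots> = ennreal c * G t"
        using h unfolding c_def by (simp add: ennreal_mult mult_ac)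
      finally show ?thesis .
    qed
    \<comment> \<open>The bound \<open>main\<close> holds at every s, so integrating it over (t, t1]
      costs one more factor h for d; for \<zeta> the single time s = t is enough. Together they give
      the constant c h + c.\<close>
    have "proc_sq (cut t d) = (\<integral>\<^sup>+s. rv_sq (cut t d s) \<partial>LT)" by (rule proc_sq_fst[OF jc[OF jd(1)]])
    also have "\<dots> \<le> (\<integral>\<^sup>+s. (ennreal c * G t) * indicator {t<..t1} s \<partial>LT)"
    proof (rule nn_integral_mono)
      fix s assume "s \<in> space LT"
      then have sT: "0 \<le> s" "s \<le> T" by (auto simp: space_LT)
      consider "s \<le> t" | "t < s" "s \<le> t1" | "t1 < s" by linarith
      then show "rv_sq (cut t d s) \<le> ennreal c * G t * indicator {t<..t1} s"
      proof cases
        case 1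
        then show ?thesis by (simp add: cut_def)
      next
        case 2
        have "rv_sq (cut t d s) = rv_sq (d s)" using 2 sT by (simp add: cut_def)
        also have "\<dots> \<le> rv_sq (d s) + proc_sq (cut s \<zeta>)" by simp
        also have "\<dots> \<le> ennreal c * G t" using 2 by (intro main) auto
        finally show ?thesis using 2 by simp
      next
        case 3
        have "rv_sq (d s) \<le> rv_sq (d s) + proc_sq (cut s \<zeta>)" by simp
        also have "\<dots> = rv_sq (\<lambda>w. LINT u:{s<..T}|lborel. b u w)" unfolding cut_def by (rule energy[OF sT])
        also have "\<dots> = rv_sq (\<lambda>_. 0 :: 'e)" using 3 sT by (intro rv_sq_cong_AE tail) auto
        finally have "rv_sq (d s) = 0" by simp
        moreover have "rv_sq (cut t d s) = rv_sq (d s)" using 3 t sT by (simp add: cut_def)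
        ultimately show ?thesis by simp
      qed
    qed
    also have "\<dots> = (ennreal c * G t) * (\<integral>\<^sup>+s. indicator {t<..t1} s \<partial>LT)"
      by (rule nn_integral_cmult, rule measurable_restrict_space1) simp
    also have "(\<integral>\<^sup>+s. indicator {t<..t1} s \<partial>LT) = (\<integral>\<^sup>+s. indicator {t<..t1} s \<partial>lborel)"
      using t by (subst nn_integral_restrict_space) (simp, intro nn_integral_cong, auto simp: indicator_def)
    also have "\<dots> = ennreal (t1 - t)" using t by simp
    also have "ennreal c * G t * ennreal (t1 - t) \<le> ennreal c * G t * ennreal h"
      using t by (intro mult_left_mono ennreal_leI) auto
    finally have Gd: "proc_sq (cut t d) \<le> ennreal c * G t * ennreal h" .
    have "proc_sq (cut t \<zeta>) \<le> rv_sq (d t) + proc_sq (cut t \<zeta>)" by simp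
    also have "\<dots> \<le> ennreal c * G t" by (rule main[OF order_refl t(2)])
    finally have "proc_sq (cut t d) + proc_sq (cut t \<zeta>) \<le> ennreal c * G t * ennreal h + ennreal c * G t"
      by (intro add_mono Gd)
    then have "G t \<le> ennreal c * G t * ennreal h + ennreal c * G t"
      unfolding G_def[of t, symmetric] .
    \<comment> \<open>Finiteness of G allows the inequality to be read in the reals, where c (1 + h)
      < 1 forces g \<le> 0.\<close>
    moreover obtain g where g: "G t = ennreal g" "0 \<le> g" using Gfin[of t] by (cases "G t") auto
    ultimately have "ennreal g \<le> ennreal (c * g * h + c * g)"
      using c h by (simp add: ennreal_mult ennreal_plus)
    then have "g \<le> c * g * h + c * g" using c h g by (subst (asm) ennreal_le_iff) simp_all
    then have "g \<le> c * (1 + h) * g" by (simp add: algebra_simps)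
    then have "(1 - c * (1 + h)) * g \<le> 0" by (simp add: algebra_simps)
    then have "g \<le> 0" using c(2) by (simp add: mult_le_0_iff)
    then show ?thesis using g by simp
  qed
  \<comment> \<open>The induction starts from the empty interval (T, T]. The maximum with 0 keeps
    the times in range, and more than T / h steps reach 0.\<close>
  have "G (max 0 (T - real n * h)) = 0" for n
  proof (induction n)
    case 0
    have "cut T \<phi> = (\<lambda>t w. 0)" for \<phi> by (simp add: cut_def fun_eq_iff)
    then show ?case using T_pos by (simp add: G_def proc_sq_def)
  next
    case (Suc n)
    show ?case
      by (rule step[OF Suc.IH]) (use h T_pos in \<open>auto simp: max_def algebra_simps\<close>)
  qed
  moreover obtain n where "T / h < real n" using reals_Archimedean2 by blast
  moreover from this have "max 0 (T - real n * h) = 0" using h by (simp add: field_simps)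
  ultimately have G0: "G 0 = 0" by metis
  have "proc_sq d \<le> proc_sq (cut 0 d)" "proc_sq \<zeta> \<le> proc_sq (cut 0 \<zeta>)"
    by (intro proc_sq_mono; simp add: cut_def)+
  with G0 have "proc_sq d = 0" "proc_sq \<zeta> = 0" by (simp_all add: G_def)
  then show "AE (t, w) in LT \<Otimes>\<^sub>M M. d t w = 0" "AE (t, w) in LT \<Otimes>\<^sub>M M. \<zeta> t w = 0"
    by (simp_all add: proc_sq_eq_0 jd)
qed

end

section \<open>Bounded measurable matrix functions\<close>

lemma matrix_mult_add_rdistrib:
  fixes A B :: "real^'m^'n" shows "(A + B) ** C = A ** C + B ** C"
  by (simp add: vec_eq_iff matrix_matrix_mult_def distrib_right sum.distrib)

lemma bounded_bilinear_matrix_mult: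
  "bounded_bilinear (\<lambda>(A :: real^'m^'n) (B :: real^'k^'m). A ** B)"
  unfolding bilinear_conv_bounded_bilinear[symmetric] bilinear_def
  by (auto intro!: linearI simp: matrix_add_ldistrib matrix_mult_add_rdistrib matrix_scalar_ac scalar_matrix_assoc[symmetric])

lemma bounded_bilinear_matrix_vector_mult:
  "bounded_bilinear (\<lambda>(A :: real^'m^'n) (x :: real^'m). A *v x)"
  unfolding bilinear_conv_bounded_bilinear[symmetric] bilinear_def
  by (auto intro!: linearI simp: matrix_vector_right_distrib matrix_vector_mult_add_rdistrib matrix_vector_mult_scaleR
      scaleR_matrix_vector_assoc[symmetric])

lemma bdd_coeff_bilinear:
  fixes prd :: "real^'a^'b \<Rightarrow> real^'c^'d \<Rightarrow> real^'e^'f"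
  assumes bil: "bounded_bilinear prd" and f: "bdd_coeff T f" and g: "bdd_coeff T g"
  shows "bdd_coeff T (\<lambda>t. prd (f t) (g t))"
  unfolding bdd_coeff_def
proof
  interpret bounded_bilinear prd by fact
  show "(\<lambda>t. prd (f t) (g t)) \<in> borel_measurable (restrict_space borel {0..T})"
    by (rule borel_measurable_continuous_Pair[OF conjunct1[OF f[unfolded bdd_coeff_def]] conjunct1[OF g[unfolded bdd_coeff_def]]])
       (intro continuous_on continuous_on_fst continuous_on_snd continuous_on_id)
  obtain K where K: "0 \<le> K" "\<And>a b. norm (prd a b) \<le> norm a * norm b * K" using nonneg_bounded by auto
  obtain L where L: "\<And>t. t \<in> {0..T} \<Longrightarrow> norm (f t) \<le> L" using f unfolding bdd_coeff_def bounded_iff by blast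
  obtain N where N: "\<And>t. t \<in> {0..T} \<Longrightarrow> norm (g t) \<le> N" using g unfolding bdd_coeff_def bounded_iff by blast
  have "norm (prd (f t) (g t)) \<le> L * N * K" if t: "t \<in> {0..T}" for t
  proof -
    have "norm (prd (f t) (g t)) \<le> norm (f t) * norm (g t) * K" by (rule K)
    also have "\<dots> \<le> L * N * K"
      using order_trans[OF norm_ge_zero L[OF t]] by (intro mult_right_mono mult_mono L N t K) simp_all
    finally show ?thesis .
  qed
  then show "bounded ((\<lambda>t. prd (f t) (g t)) ` {0..T})" unfolding bounded_iff by blast
qed

lemma bdd_coeff_linear:
  fixes L :: "real^'a^'b \<Rightarrow> real^'c^'d"
  assumes "linear L" and f: "bdd_coeff T f"
  shows "bdd_coeff T (\<lambda>t. L (f t))"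
proof -
  have L: "bounded_linear L" using assms(1) by (simp add: linear_conv_bounded_linear)
  have m: "L \<in> borel_measurable borel"
    by (rule borel_measurable_continuous_onI[OF linear_continuous_on[OF L]])
  have "bounded ((\<lambda>t. L (f t)) ` {0..T})"
    using f bounded_linear_image[OF _ L, of "f ` {0..T}"] unfolding bdd_coeff_def by (simp add: image_image)
  moreover have "(\<lambda>t. L (f t)) \<in> borel_measurable (restrict_space borel {0..T})"
    using f unfolding bdd_coeff_def by (intro measurable_compose[OF _ m]) simp
  ultimately show ?thesis unfolding bdd_coeff_def by simp
qed

lemma bdd_coeff_mult: "bdd_coeff T f \<Longrightarrow> bdd_coeff T g \<Longrightarrow> bdd_coeff T (\<lambda>t. f t ** g t)"
  by (rule bdd_coeff_bilinear[OF bounded_bilinear_matrix_mult])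

lemma bdd_coeff_add: "bdd_coeff T f \<Longrightarrow> bdd_coeff T g \<Longrightarrow> bdd_coeff T (\<lambda>t. f t + g t)"
  unfolding bdd_coeff_def by (auto intro: bounded_plus_comp)

lemma bdd_coeff_diff: "bdd_coeff T f \<Longrightarrow> bdd_coeff T g \<Longrightarrow> bdd_coeff T (\<lambda>t. f t - g t)"
  unfolding bdd_coeff_def by (auto intro: bounded_minus_comp)

lemma bdd_coeff_minus: "bdd_coeff T f \<Longrightarrow> bdd_coeff T (\<lambda>t. - f t)"
  by (rule bdd_coeff_linear[of uminus]) (auto intro: linearI)

lemma bdd_coeff_scaleR: "bdd_coeff T f \<Longrightarrow> bdd_coeff T (\<lambda>t. c *\<^sub>R f t)"
  by (rule bdd_coeff_linear[of "\<lambda>x. c *\<^sub>R x"]) (auto intro: linearI simp: scaleR_add_right)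

lemma bdd_coeff_const: "bdd_coeff T (\<lambda>t. A)"
  unfolding bdd_coeff_def by (auto simp: image_constant_conv)

lemma bdd_coeff_transpose: "bdd_coeff T f \<Longrightarrow> bdd_coeff T (\<lambda>t. transpose (f t))"
  by (rule bdd_coeff_linear[of transpose]) (auto intro!: linearI simp: transpose_def vec_eq_iff)

lemma bdd_coeff_continuous: "continuous_on {0..T} f \<Longrightarrow> bdd_coeff T f"
  unfolding bdd_coeff_def
  by (auto intro: borel_measurable_continuous_on_restrict compact_imp_bounded compact_continuous_image)

section \<open>Block matrices with bounded measurable entries\<close>

lemma hcat_nth [simp]: "(A \<parallel>\<^sub>h B) $ r $ Inl k = A $ r $ k" "(A \<parallel>\<^sub>h B) $ r $ Inr l = B $ r $ l"
  by (simp_all add: hcat_def)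

lemma vcat_nth [simp]: "(A \<parallel>\<^sub>v B) $ Inl k = A $ k" "(A \<parallel>\<^sub>v B) $ Inr l = B $ l"
  by (simp_all add: vcat_def)

lemma all_sum_iff: "(\<forall>k :: 'a + 'b. Q k) \<longleftrightarrow> (\<forall>k. Q (Inl k)) \<and> (\<forall>k. Q (Inr k))"
  by (rule split_sum_all)

text \<open>Padding one block with zeros is a linear map, and the concatenation is the sum of two
  padded blocks.\<close>

lemma bdd_coeff_hcat:
  fixes f :: "real \<Rightarrow> real^'a^'n" and g :: "real \<Rightarrow> real^'b^'n"
  assumes "bdd_coeff T f" "bdd_coeff T g" shows "bdd_coeff T (\<lambda>t. f t \<parallel>\<^sub>h g t)"
proof -
  have "bdd_coeff T (\<lambda>t. (f t \<parallel>\<^sub>h (0 :: real^'b^'n)) + ((0 :: real^'a^'n) \<parallel>\<^sub>h g t))"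
    by (intro bdd_coeff_add bdd_coeff_linear[of "\<lambda>x. x \<parallel>\<^sub>h (0 :: real^'b^'n)"] bdd_coeff_linear[of "\<lambda>x. (0 :: real^'a^'n) \<parallel>\<^sub>h x"] assms)
       (auto intro!: linearI simp: vec_eq_iff all_sum_iff)
  also have "(\<lambda>t. (f t \<parallel>\<^sub>h (0 :: real^'b^'n)) + ((0 :: real^'a^'n) \<parallel>\<^sub>h g t)) = (\<lambda>t. f t \<parallel>\<^sub>h g t)"
    by (auto simp: fun_eq_iff vec_eq_iff all_sum_iff)
  finally show ?thesis .
qed

lemma bdd_coeff_vcat:
  fixes f :: "real \<Rightarrow> real^'n^'a" and g :: "real \<Rightarrow> real^'n^'b"
  assumes "bdd_coeff T f" "bdd_coeff T g" shows "bdd_coeff T (\<lambda>t. f t \<parallel>\<^sub>v g t)"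
proof -
  have "bdd_coeff T (\<lambda>t. (f t \<parallel>\<^sub>v (0 :: real^'n^'b)) + ((0 :: real^'n^'a) \<parallel>\<^sub>v g t))"
    by (intro bdd_coeff_add bdd_coeff_linear[of "\<lambda>x. x \<parallel>\<^sub>v (0 :: real^'n^'b)"] bdd_coeff_linear[of "\<lambda>x. (0 :: real^'n^'a) \<parallel>\<^sub>v x"] assms)
       (auto intro!: linearI simp: vec_eq_iff all_sum_iff)
  also have "(\<lambda>t. (f t \<parallel>\<^sub>v (0 :: real^'n^'b)) + ((0 :: real^'n^'a) \<parallel>\<^sub>v g t)) = (\<lambda>t. f t \<parallel>\<^sub>v g t)"
    by (auto simp: fun_eq_iff vec_eq_iff all_sum_iff)
  finally show ?thesis .
qed

lemma bdd_coeff_bdiag: "bdd_coeff T f \<Longrightarrow> bdd_coeff T g \<Longrightarrow> bdd_coeff T (\<lambda>t. f t \<oplus>\<^sub>d g t)"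
  unfolding bdiag_def by (intro bdd_coeff_vcat bdd_coeff_hcat bdd_coeff_const)

section \<open>Measurability and bounds for inverse matrices\<close>

lemma borel_measurable_matrixI:
  fixes f :: "'s \<Rightarrow> real^'m^'n"
  assumes "\<And>i j. (\<lambda>t. f t $ i $ j) \<in> borel_measurable N"
  shows "f \<in> borel_measurable N"
proof (subst borel_measurable_euclidean_space, intro ballI)
  fix b :: "real^'m^'n" assume "b \<in> Basis"
  then obtain i j where "b = axis i (axis j 1)" by (auto simp: Basis_vec_def)
  then show "(\<lambda>t. f t \<bullet> b) \<in> borel_measurable N" using assms by (simp add: inner_axis)
qed

lemma borel_measurable_matrix_nth:
  fixes f :: "'s \<Rightarrow> real^'m^'n"
  assumes "f \<in> borel_measurable N" shows "(\<lambda>t. f t $ i $ j) \<in> borel_measurable N"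
proof -
  have "(\<lambda>t. f t \<bullet> axis i (axis j 1)) \<in> borel_measurable N" using assms by simp
  then show ?thesis by (simp add: inner_axis)
qed

lemma borel_measurable_det:
  fixes f :: "'s \<Rightarrow> real^'n^'n"
  assumes "\<And>i j. (\<lambda>t. f t $ i $ j) \<in> borel_measurable N" shows "(\<lambda>t. det (f t)) \<in> borel_measurable N"
  unfolding det_def by (intro borel_measurable_sum borel_measurable_times borel_measurable_prod assms) simp

lemma matrix_inv_inverts:
  fixes A :: "real^'n^'n"
  assumes "invertible A" shows "A ** matrix_inv A = mat 1" "matrix_inv A ** A = mat 1"
proof -
  have "\<exists>B. A ** B = mat 1 \<and> B ** A = mat 1" using assms unfolding invertible_def .
  from someI_ex[OF this] show "A ** matrix_inv A = mat 1" "matrix_inv A ** A = mat 1"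
    unfolding matrix_inv_def by auto
qed

lemma matrix_inv_unique:
  fixes A B :: "real^'n^'n"
  assumes "A ** B = mat 1" shows "matrix_inv A = B" "invertible A"
proof -
  have BA: "B ** A = mat 1" using assms matrix_left_right_inverse[of A B] by blast
  then show "invertible A" unfolding invertible_def using assms by blast
  from matrix_inv_inverts(1)[OF this] have "B ** (A ** matrix_inv A) = B" by simp
  then show "matrix_inv A = B" unfolding matrix_mul_assoc BA by simp
qed

text \<open>Cramer's rule for the columns of the inverse. It exhibits the entries as quotients of
  determinants, which makes the inverse of a measurable matrix function measurable.\<close>

lemma matrix_inv_entry:
  fixes A :: "real^'n^'n"
  assumes "invertible A"
  shows "matrix_inv A $ k $ l = det (\<chi> i j. if j = k then axis l 1 $ i else A $ i $ j) / det A"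
proof -
  have "A *v (matrix_inv A *v axis l 1) = axis l 1"
    by (simp add: matrix_vector_mul_assoc matrix_inv_inverts[OF assms])
  then have "matrix_inv A *v axis l 1 = (\<chi> k. det (\<chi> i j. if j = k then axis l 1 $ i else A $ i $ j) / det A)"
    using cramer[of A "matrix_inv A *v axis l 1" "axis l 1"] assms invertible_det_nz by blast
  moreover have "(matrix_inv A *v axis l 1) $ k = matrix_inv A $ k $ l"
    by (simp add: matrix_vector_mult_basis column_def)
  ultimately show ?thesis by simp
qed

lemma bdd_coeff_matrix_inv:
  fixes f :: "real \<Rightarrow> real^'n^'n"
  assumes f: "bdd_coeff T f" and i: "bdd_inverse T f"
  shows "bdd_coeff T (\<lambda>t. matrix_inv (f t))"
  unfolding bdd_coeff_def
proof
  show "bounded ((\<lambda>t. matrix_inv (f t)) ` {0..T})" using i unfolding bdd_inverse_def by blast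
  have m: "(\<lambda>t. f t $ i $ j) \<in> borel_measurable (restrict_space borel {0..T})" for i j
    using f unfolding bdd_coeff_def by (intro borel_measurable_matrix_nth) simp
  show "(\<lambda>t. matrix_inv (f t)) \<in> borel_measurable (restrict_space borel {0..T})"
  proof (rule borel_measurable_matrixI)
    fix k l
    have "(\<lambda>t. det (\<chi> i j. if j = k then axis l 1 $ i else f t $ i $ j) / det (f t)) \<in> borel_measurable (restrict_space borel {0..T})"
    proof (intro borel_measurable_divide borel_measurable_det)
      show "(\<lambda>t. (\<chi> i j. if j = k then axis l 1 $ i else f t $ i $ j) $ i $ j) \<in> borel_measurable (restrict_space borel {0..T})" for i j
        by (cases "j = k") (simp_all add: m)
    qed (rule m)
    then show "(\<lambda>t. matrix_inv (f t) $ k $ l) \<in> borel_measurable (restrict_space borel {0..T})"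
    proof (rule measurable_cong[THEN iffD1, rotated])
      fix t assume "t \<in> space (restrict_space borel {0..T})"
      then have "invertible (f t)" using i unfolding bdd_inverse_def by (simp add: space_restrict_space)
      from matrix_inv_entry[OF this]
      show "det (\<chi> i j. if j = k then axis l 1 $ i else f t $ i $ j) / det (f t) = matrix_inv (f t) $ k $ l" by simp
    qed
  qed
qed

text \<open>The norm on matrices is the Euclidean norm of the entries. Evaluating on basis vectors
  turns an operator bound into a bound of every entry; the factors count rows and columns.\<close>

lemma norm_matrix_le:
  fixes A :: "real^'m^'n"
  assumes "\<And>x. norm (A *v x) \<le> C * norm x"
  shows "norm A \<le> real CARD('n) * (real CARD('m) * C)"
proof -
  have e: "\<bar>A $ i $ j\<bar> \<le> C" for i j
  proof -
    have "\<bar>(A *v axis j 1) $ i\<bar> \<le> C * norm (axis j (1::real) :: real^'m)"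
      by (rule order_trans[OF component_le_norm_cart assms])
    then show ?thesis by (simp add: matrix_vector_mult_basis column_def)
  qed
  have "norm (A $ i) \<le> real CARD('m) * C" for i
  proof -
    have "(\<Sum>j\<in>UNIV. \<bar>A $ i $ j\<bar>) \<le> real CARD('m) * C" by (rule sum_bounded_above) (rule e)
    then show ?thesis using norm_le_l1_cart[of "A $ i"] by linarith
  qed
  then have "(\<Sum>i\<in>UNIV. norm (A $ i)) \<le> real CARD('n) * (real CARD('m) * C)"
    using sum_bounded_above[of UNIV "\<lambda>i. norm (A $ i)" "real CARD('m) * C"] by simp
  then show ?thesis
    unfolding norm_vec_def[of A] using L2_set_le_sum[of UNIV "\<lambda>i. norm (A $ i)"] by simp
qed

text \<open>Uniform positivity gives \<delta> |x| \<le> |f(t) x|. This yields injectivity, hence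
  invertibility, and the operator bound 1/\<delta> for the inverse.\<close>

lemma unif_pos_bdd_inverse:
  fixes f :: "real \<Rightarrow> real^'n^'n"
  assumes "unif_pos T f" shows "bdd_inverse T f"
proof -
  obtain \<delta> where \<delta>: "\<delta> > 0" "\<And>t. t \<in> {0..T} \<Longrightarrow> psd (f t - \<delta> *\<^sub>R mat 1)"
    using assms unfolding unif_pos_def by blast
  have coer: "\<delta> * norm x \<le> norm (f t *v x)" if t: "t \<in> {0..T}" for t x
  proof -
    have "0 \<le> ((f t - \<delta> *\<^sub>R mat 1) *v x) \<bullet> x" using \<delta>(2)[OF t] unfolding psd_def by blast
    also have "\<dots> = (f t *v x) \<bullet> x - \<delta> * (norm x)\<^sup>2"
      by (simp add: matrix_vector_mult_diff_rdistrib scaleR_matrix_vector_assoc[symmetric] inner_diff_left power2_norm_eq_inner)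
    finally have "\<delta> * norm x * norm x \<le> norm (f t *v x) * norm x"
      using norm_cauchy_schwarz[of "f t *v x" x] by (simp add: power2_eq_square)
    then show ?thesis by (cases "x = 0") simp_all
  qed
  have inv: "invertible (f t)" if t: "t \<in> {0..T}" for t
  proof -
    have "inj ((*v) (f t))"
    proof (rule injI)
      fix x y assume "f t *v x = f t *v y"
      then have "\<delta> * norm (x - y) \<le> 0" using coer[OF t, of "x - y"] by (simp add: matrix_vector_mult_diff_distrib)
      then show "x = y" using \<delta>(1) by (simp add: mult_le_0_iff)
    qed
    then show ?thesis
      unfolding invertible_left_inverse matrix_left_invertible_injective .
  qed
  have "norm (matrix_inv (f t)) \<le> real CARD('n) * (real CARD('n) * (1 / \<delta>))" if t: "t \<in> {0..T}" for t
  proof (rule norm_matrix_le)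
    fix y
    have "\<delta> * norm (matrix_inv (f t) *v y) \<le> norm y"
      using coer[OF t, of "matrix_inv (f t) *v y"] by (simp add: matrix_vector_mul_assoc matrix_inv_inverts[OF inv[OF t]])
    then show "norm (matrix_inv (f t) *v y) \<le> 1 / \<delta> * norm y" using \<delta>(1) by (simp add: field_simps)
  qed
  then show ?thesis unfolding bdd_inverse_def bounded_iff using inv by blast
qed

lemma sum_UNIV_Plus:
  fixes g :: "'a::finite + 'b::finite \<Rightarrow> 'c::comm_monoid_add"
  shows "(\<Sum>k\<in>UNIV. g k) = (\<Sum>k\<in>UNIV. g (Inl k)) + (\<Sum>k\<in>UNIV. g (Inr k))"
  using sum.Plus[OF finite finite, of g UNIV UNIV] by (simp add: comp_def)

lemma bdiag_nth [simp]:
  "(A \<oplus>\<^sub>d B) $ Inl i $ Inl j = A $ i $ j" "(A \<oplus>\<^sub>d B) $ Inl i $ Inr l = 0"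
  "(A \<oplus>\<^sub>d B) $ Inr k $ Inl j = 0" "(A \<oplus>\<^sub>d B) $ Inr k $ Inr l = B $ k $ l"
  by (simp_all add: bdiag_def)

lemma bdiag_mult: "(A \<oplus>\<^sub>d B) ** (C \<oplus>\<^sub>d D) = (A ** C) \<oplus>\<^sub>d (B ** D)"
  for A :: "real^'b^'a" and B :: "real^'d^'c" and C :: "real^'e^'b" and D :: "real^'f^'d"
  by (simp add: vec_eq_iff all_sum_iff matrix_matrix_mult_def sum_UNIV_Plus)

lemma bdiag_mat_1: "mat 1 \<oplus>\<^sub>d mat 1 = (mat 1 :: real^('a::finite+'b::finite)^('a+'b))"
  by (simp add: vec_eq_iff all_sum_iff mat_def)

lemma bdd_inverse_bdiag:
  fixes f :: "real \<Rightarrow> real^'a^'a" and g :: "real \<Rightarrow> real^'b^'b"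
  assumes "bdd_inverse T f" "bdd_inverse T g" shows "bdd_inverse T (\<lambda>t. f t \<oplus>\<^sub>d g t)"
proof -
  have i: "(f t \<oplus>\<^sub>d g t) ** (matrix_inv (f t) \<oplus>\<^sub>d matrix_inv (g t)) = mat 1" if "t \<in> {0..T}" for t
    using assms that unfolding bdd_inverse_def by (simp add: bdiag_mult matrix_inv_inverts bdiag_mat_1)
  obtain K where K: "\<And>t. t \<in> {0..T} \<Longrightarrow> norm (matrix_inv (f t)) \<le> K"
    using assms(1) unfolding bdd_inverse_def bounded_iff by blast
  obtain L where L: "\<And>t. t \<in> {0..T} \<Longrightarrow> norm (matrix_inv (g t)) \<le> L"
    using assms(2) unfolding bdd_inverse_def bounded_iff by blast
  \<comment> \<open>N bounds the linear embeddings of the two diagonal blocks, so that bounds on the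
    inverses of the blocks carry over to the inverse of the whole.\<close>
  obtain N where N: "\<And>(A :: real^'a^'a) (B :: real^'b^'b). norm (A \<oplus>\<^sub>d B) \<le> N * (norm A + norm B)" "0 \<le> N"
  proof -
    have "linear (\<lambda>(A :: real^'a^'a). A \<oplus>\<^sub>d (0 :: real^'b^'b))" "linear (\<lambda>(B :: real^'b^'b). (0 :: real^'a^'a) \<oplus>\<^sub>d B)"
      by (auto intro!: linearI simp: vec_eq_iff all_sum_iff)
    then have bl: "bounded_linear (\<lambda>(A :: real^'a^'a). A \<oplus>\<^sub>d (0 :: real^'b^'b))"
        "bounded_linear (\<lambda>(B :: real^'b^'b). (0 :: real^'a^'a) \<oplus>\<^sub>d B)"
      unfolding linear_conv_bounded_linear .
    obtain a where a: "\<And>A :: real^'a^'a. norm (A \<oplus>\<^sub>d (0 :: real^'b^'b)) \<le> norm A * a" "0 \<le> a"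
      using bounded_linear.nonneg_bounded[OF bl(1)] by blast
    obtain b where b: "\<And>B :: real^'b^'b. norm ((0 :: real^'a^'a) \<oplus>\<^sub>d B) \<le> norm B * b" "0 \<le> b"
      using bounded_linear.nonneg_bounded[OF bl(2)] by blast
    note ab = a b
    show ?thesis
    proof (rule that[of "a + b"])
      fix A :: "real^'a^'a" and B :: "real^'b^'b"
      have "A \<oplus>\<^sub>d B = (A \<oplus>\<^sub>d 0) + (0 \<oplus>\<^sub>d B)" by (simp add: vec_eq_iff all_sum_iff)
      then have "norm (A \<oplus>\<^sub>d B) \<le> norm A * a + norm B * b"
        using norm_triangle_le[OF add_mono[OF ab(1)[of A] ab(3)[of B]]] by simp
      also have "\<dots> \<le> (a + b) * (norm A + norm B)" using ab(2,4) by (simp add: algebra_simps)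
      finally show "norm (A \<oplus>\<^sub>d B) \<le> (a + b) * (norm A + norm B)" .
    qed (use ab in simp)
  qed
  have "norm (matrix_inv (f t \<oplus>\<^sub>d g t)) \<le> N * (K + L)" if t: "t \<in> {0..T}" for t
    unfolding matrix_inv_unique(1)[OF i[OF t]]
    by (rule order_trans[OF N(1)]) (intro mult_left_mono add_mono K L t N(2))
  then show ?thesis
    unfolding bdd_inverse_def bounded_iff using matrix_inv_unique(2)[OF i] by blast
qed

section \<open>Block algebra\<close>

text \<open>\<open>blk1 *v y + blk2 *v Y\<close> is the column \<open>col(y, Y)\<close>.\<close>

definition blk1 :: "real^'n::finite^('n+'n)" where "blk1 = mat 1 \<parallel>\<^sub>v 0"
definition blk2 :: "real^'n::finite^('n+'n)" where "blk2 = 0 \<parallel>\<^sub>v mat 1"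

lemma blk_nth [simp]:
  "(blk1 *v y) $ Inl k = y $ k" "(blk1 *v y) $ Inr k = 0" "(blk2 *v y) $ Inl k = 0" "(blk2 *v y) $ Inr k = y $ k"
proof -
  have *: "(\<Sum>j\<in>UNIV. mat 1 $ k $ j * y $ j) = y $ k"
    using arg_cong[OF matrix_vector_mul_lid[of y], of "\<lambda>z. z $ k"] by (simp add: matrix_vector_mult_def)
  show "(blk1 *v y) $ Inl k = y $ k" "(blk1 *v y) $ Inr k = 0" "(blk2 *v y) $ Inl k = 0" "(blk2 *v y) $ Inr k = y $ k"
    by (simp_all add: blk1_def blk2_def matrix_vector_mult_def *)
qed

lemma hcat_blk: "(A \<parallel>\<^sub>h B) *v (blk1 *v y) = A *v y" "(A \<parallel>\<^sub>h B) *v (blk2 *v y) = B *v y"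
  by (simp_all add: vec_eq_iff matrix_vector_mult_def[of "A \<parallel>\<^sub>h B"] matrix_vector_mult_def[of A]
      matrix_vector_mult_def[of B] sum_UNIV_Plus)

lemma bdiag_blk:
  "(A \<oplus>\<^sub>d B) *v (blk1 *v y) = blk1 *v (A *v y)" "(A \<oplus>\<^sub>d B) *v (blk2 *v y) = blk2 *v (B *v y)"
  by (simp_all add: vec_eq_iff all_sum_iff matrix_vector_mult_def[of "A \<oplus>\<^sub>d B"] matrix_vector_mult_def[of A]
      matrix_vector_mult_def[of B] sum_UNIV_Plus)

lemma vcat_blk: "(A \<parallel>\<^sub>v B) *v x = blk1 *v (A *v x) + blk2 *v (B *v x)"
  by (simp add: vec_eq_iff all_sum_iff matrix_vector_mult_def[of "A \<parallel>\<^sub>v B"] matrix_vector_mult_def[of A]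
      matrix_vector_mult_def[of B])

lemma transpose_bdiag: "transpose (A \<oplus>\<^sub>d B) = transpose A \<oplus>\<^sub>d transpose B"
  by (simp add: vec_eq_iff all_sum_iff transpose_def)

lemma transpose_diff: "transpose (A - B) = transpose A - transpose B" for A B :: "real^'m^'n"
  by (simp add: vec_eq_iff transpose_def)

lemma matrix_vector_minus: "(- A) *v x = - (A *v x)" "A *v (- x) = - (A *v x)" for A :: "real^'m^'n"
  by (simp_all add: vec_eq_iff matrix_vector_mult_def sum_negf)

lemmas mv_simps = matrix_vector_mul_assoc[symmetric] matrix_vector_minus matrix_vector_right_distrib
  matrix_vector_mult_diff_distrib matrix_vector_mult_add_rdistrib matrix_vector_mult_diff_rdistrib

text \<open>What acts on x after the summand of each open-loop control that is proportional to x has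
  been absorbed; \<open>closed_C\<close> is the same for the diffusion.\<close>

definition closed_A :: "('n::finite, 'p::finite, 'q::finite) game \<Rightarrow> real \<Rightarrow> real^'n^'n" where
  "closed_A g t = gA g t - BRS (pl1 g) t - BRS (pl2 g) t"

definition closed_C :: "('n::finite, 'p::finite, 'q::finite) game \<Rightarrow> real \<Rightarrow> real^'n^'n" where
  "closed_C g t = gC g t - DRS (pl1 g) t - DRS (pl2 g) t"

text \<open>Linear algebra at one time and one path. The x-parts of the controls merge into
  \<open>closed_A\<close> and \<open>closed_C\<close>, and the blocks collect the action of the
  stacked adjoint vectors.\<close>

lemma forward_coefficients:
  assumes "u1 = - (matrix_inv (pR (pl1 g) t) *v (transpose (pS (pl1 g) t) *v x + transpose (pB (pl1 g) t) *v y + transpose (pD (pl1 g) t) *v z))"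
    and "u2 = - (matrix_inv (pR (pl2 g) t) *v (transpose (pS (pl2 g) t) *v x + transpose (pB (pl2 g) t) *v Y + transpose (pD (pl2 g) t) *v Z))"
  shows "gA g t *v x + pB (pl1 g) t *v u1 + pB (pl2 g) t *v u2
      = closed_A g t *v x + BB1 g t *v (blk1 *v y + blk2 *v Y) + BB2 g t *v (blk1 *v z + blk2 *v Z)"
    and "gC g t *v x + pD (pl1 g) t *v u1 + pD (pl2 g) t *v u2
      = closed_C g t *v x + DD1 g t *v (blk1 *v y + blk2 *v Y) + DD2 g t *v (blk1 *v z + blk2 *v Z)"
  unfolding assms closed_A_def closed_C_def BRS_def DRS_def BB1_def BB2_def DD1_def DD2_def
    matrix_vector_right_distrib hcat_blk
  by (simp_all add: mv_simps)

text \<open>Symmetry of the inverse weights identifies S R^-1 B^T with the transpose of B R^-1 S^T,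
  and likewise for D. This is why the transposes of \<open>AA\<close> and \<open>CC\<close> appear
  as coefficients of the stacked adjoint equations.\<close>

lemma backward_coefficients:
  assumes "u1 = - (matrix_inv (pR (pl1 g) t) *v (transpose (pS (pl1 g) t) *v x + transpose (pB (pl1 g) t) *v y + transpose (pD (pl1 g) t) *v z))"
    and "u2 = - (matrix_inv (pR (pl2 g) t) *v (transpose (pS (pl2 g) t) *v x + transpose (pB (pl2 g) t) *v Y + transpose (pD (pl2 g) t) *v Z))"
    and "transpose (matrix_inv (pR (pl1 g) t)) = matrix_inv (pR (pl1 g) t)"
    and "transpose (matrix_inv (pR (pl2 g) t)) = matrix_inv (pR (pl2 g) t)"
  shows "blk1 *v (transpose (gA g t) *v y + transpose (gC g t) *v z + pQ (pl1 g) t *v x + pS (pl1 g) t *v u1)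
      + blk2 *v (transpose (gA g t) *v Y + transpose (gC g t) *v Z + pQ (pl2 g) t *v x + pS (pl2 g) t *v u2)
      = transpose (AA g t) *v (blk1 *v y + blk2 *v Y) + transpose (CC g t) *v (blk1 *v z + blk2 *v Z) + QQ g t *v x"
proof -
  have T: "transpose (BRS p t) = pS p t ** matrix_inv (pR p t) ** transpose (pB p t)"
      "transpose (DRS p t) = pS p t ** matrix_inv (pR p t) ** transpose (pD p t)"
    if "transpose (matrix_inv (pR p t)) = matrix_inv (pR p t)" for p :: "('s::finite, 'r::finite) player"
    using that by (simp_all add: BRS_def DRS_def matrix_transpose_mul matrix_mul_assoc)
  show ?thesis
    unfolding assms(1,2) AA_def CC_def QQ_def transpose_bdiag transpose_diff T[OF assms(3)] T[OF assms(4)]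
      matrix_vector_right_distrib bdiag_blk vcat_blk
    by (simp add: mv_simps)
qed

text \<open>The definition of \<zeta> contains Zc on both sides, through D2; H resolves it for Zc.
  After inserting this and X = \<delta> + Pm x, the terms in x cancel against the right-hand side of
  the equation for \<Pi>, whose last factor is S. What is left is linear in \<delta> and
  \<zeta>.\<close>

lemma decoupling_identity:
  fixes Pm :: "real^'n^'k" and D2 :: "real^'k^'n" and H :: "real^'k^'k"
  assumes H: "H ** (mat 1 - Pm ** D2) = mat 1"
    and \<delta>: "\<delta> = X - Pm *v x"
    and \<zeta>: "\<zeta> = Zc - Pm *v (C0 *v x + D1 *v X + D2 *v Zc)"
    and S: "S = H ** (Pm ** C0 + Pm ** D1 ** Pm)"
  shows "Zc = S *v x + H *v (\<zeta> + (Pm ** D1) *v \<delta>)"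
    and "- (AT *v X + CT *v Zc + Q *v x)
      + ((Pm ** A0 + Pm ** B1 ** Pm + AT ** Pm + Q + (CT + Pm ** B2) ** S) *v x
         - Pm *v (A0 *v x + B1 *v X + B2 *v Zc))
      = - ((AT + Pm ** B1 + (CT + Pm ** B2) ** H ** (Pm ** D1)) *v \<delta> + ((CT + Pm ** B2) ** H) *v \<zeta>)"
proof -
  have "\<zeta> + (Pm ** D1) *v \<delta> = (mat 1 - Pm ** D2) *v Zc - (Pm ** C0 + Pm ** D1 ** Pm) *v x"
    unfolding \<delta> \<zeta> by (simp add: mv_simps)
  then have "H *v (\<zeta> + (Pm ** D1) *v \<delta>) = Zc - S *v x"
    unfolding S by (simp only: matrix_vector_mult_diff_distrib matrix_vector_mul_assoc H matrix_vector_mul_lid)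
  then show Z: "Zc = S *v x + H *v (\<zeta> + (Pm ** D1) *v \<delta>)" by simp
  have X: "X = \<delta> + Pm *v x" using \<delta> by simp
  define w where "w = H *v (\<zeta> + (Pm ** D1) *v \<delta>)"
  have Z': "Zc = S *v x + w" using Z w_def by simp
  have "- (AT *v X + CT *v Zc + Q *v x)
      + ((Pm ** A0 + Pm ** B1 ** Pm + AT ** Pm + Q + (CT + Pm ** B2) ** S) *v x
         - Pm *v (A0 *v x + B1 *v X + B2 *v Zc)) = - ((AT + Pm ** B1) *v \<delta> + (CT + Pm ** B2) *v w)"
    unfolding Z' X by (simp add: mv_simps)
  also have "(CT + Pm ** B2) *v w = ((CT + Pm ** B2) ** H ** (Pm ** D1)) *v \<delta> + ((CT + Pm ** B2) ** H) *v \<zeta>"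
    unfolding w_def by (simp only: matrix_vector_right_distrib matrix_vector_mul_assoc matrix_mul_assoc add.commute)
  finally show "- (AT *v X + CT *v Zc + Q *v x)
      + ((Pm ** A0 + Pm ** B1 ** Pm + AT ** Pm + Q + (CT + Pm ** B2) ** S) *v x
         - Pm *v (A0 *v x + B1 *v X + B2 *v Zc))
      = - ((AT + Pm ** B1 + (CT + Pm ** B2) ** H ** (Pm ** D1)) *v \<delta> + ((CT + Pm ** B2) ** H) *v \<zeta>)"
    by (simp add: matrix_vector_mult_add_rdistrib)
qed

text \<open>Brings both objects into the shape of \<open>decoupling_identity\<close>: the inverse
  and the bracket at the end of the equation for \<Pi> are together \<open>Sigma_fb\<close>.\<close>

lemma Sigma_fb_eq:
  "Sigma_fb g Pm t = matrix_inv (mat 1 - Pm t ** DD2 g t) ** (Pm t ** closed_C g t + Pm t ** DD1 g t ** Pm t)"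
  and Pi_rhs_eq: "Pi_rhs g Pm t = Pm t ** closed_A g t + Pm t ** BB1 g t ** Pm t + transpose (AA g t) ** Pm t + QQ g t
     + (transpose (CC g t) + Pm t ** BB2 g t) ** Sigma_fb g Pm t"
proof -
  have d: "A ** (B - C) = A ** B - A ** C" for A :: "real^'x^'y" and B C :: "real^'z^'x"
    by (simp add: vec_eq_iff matrix_matrix_mult_def right_diff_distrib sum_subtractf)
  show 1: "Sigma_fb g Pm t = matrix_inv (mat 1 - Pm t ** DD2 g t) ** (Pm t ** closed_C g t + Pm t ** DD1 g t ** Pm t)"
    by (simp add: Sigma_fb_def closed_C_def d diff_diff_eq matrix_add_ldistrib)
  show "Pi_rhs g Pm t = Pm t ** closed_A g t + Pm t ** BB1 g t ** Pm t + transpose (AA g t) ** Pm t + QQ g t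
     + (transpose (CC g t) + Pm t ** BB2 g t) ** Sigma_fb g Pm t"
    unfolding Pi_rhs_def Sigma_fb_def closed_A_def matrix_mul_assoc by (simp add: diff_diff_eq)
qed

section \<open>Feedback form of the equilibrium\<close>

lemma unif_pos_inv_symmetric:
  fixes f :: "real \<Rightarrow> real^'n^'n"
  assumes "unif_pos T f" "t \<in> {0..T}"
  shows "transpose (matrix_inv (f t)) = matrix_inv (f t)"
proof -
  have i: "invertible (f t)" using unif_pos_bdd_inverse[OF assms(1)] assms(2) unfolding bdd_inverse_def by blast
  have s: "transpose (f t) = f t" using assms unfolding unif_pos_def by blast
  have "transpose (matrix_inv (f t) ** f t) = mat 1"
    unfolding matrix_inv_inverts[OF i] by (rule transpose_mat)
  then have "f t ** transpose (matrix_inv (f t)) = mat 1" unfolding matrix_transpose_mul s .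
  from matrix_inv_unique(1)[OF this] show ?thesis by simp
qed

lemma set_integral_Icc_Ioc:
  fixes f :: "real \<Rightarrow> 'e::euclidean_space"
  assumes f: "set_integrable lborel {0..T} f" and t: "0 \<le> t" "t \<le> T"
  shows "(LINT s:{t..T}|lborel. f s) = (LINT s:{t<..T}|lborel. f s)"
proof -
  have "(LINT s:{t..t} \<union> {t<..T}|lborel. f s) = (LINT s:{t..t}|lborel. f s) + (LINT s:{t<..T}|lborel. f s)"
    using t by (intro set_integral_Un set_integrable_subset[OF f]) auto
  moreover have "{t..t} \<union> {t<..T} = {t..T}" using t by auto
  ultimately show ?thesis by (simp only: set_integral_Icc_self add_0_left)
qed

text \<open>From X' = - f it is - X that has derivative f. The product rule expects an integral
  starting at time 0, and - \<Pi> x is a summand of \<delta>.\<close>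

lemma terminal_ode_forward:
  assumes "terminal_ode T \<Gamma> f X" "0 \<le> T" "t \<in> {0..T}"
  shows "- X t = - X 0 + (LINT s:{0..t}|lborel. f s)"
proof -
  have f: "set_integrable lborel {0..T} f" and X: "\<And>t. t \<in> {0..T} \<Longrightarrow> X t = \<Gamma> + (LINT s:{t..T}|lborel. f s)"
    using assms(1) unfolding terminal_ode_def by auto
  have "(LINT s:{0..T}|lborel. f s) - (LINT s:{0..t}|lborel. f s) = (LINT s:{t<..T}|lborel. f s)"
    using assms by (intro set_integral_Ioc_diff[OF f]) auto
  then have a: "(LINT s:{0..T}|lborel. f s) = (LINT s:{t<..T}|lborel. f s) + (LINT s:{0..t}|lborel. f s)"
    by (simp only: diff_eq_eq)
  have b: "(LINT s:{t..T}|lborel. f s) = (LINT s:{t<..T}|lborel. f s)"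
    using assms by (intro set_integral_Icc_Ioc[OF f]) auto
  have "X t = \<Gamma> + (LINT s:{t<..T}|lborel. f s)"
    "X 0 = \<Gamma> + ((LINT s:{t<..T}|lborel. f s) + (LINT s:{0..t}|lborel. f s))"
    using X[of t] X[of 0] assms unfolding b a by simp_all
  then show ?thesis by simp
qed

definition bdd_player :: "real \<Rightarrow> ('n::finite, 'p::finite) player \<Rightarrow> bool" where
  "bdd_player T p \<longleftrightarrow> bdd_coeff T (pB p) \<and> bdd_coeff T (pD p) \<and> bdd_coeff T (pQ p) \<and> bdd_coeff T (pS p) \<and> bdd_coeff T (pR p)"

definition bdd_game :: "real \<Rightarrow> ('n::finite, 'p::finite, 'q::finite) game \<Rightarrow> bool" where
  "bdd_game T g \<longleftrightarrow> bdd_coeff T (gA g) \<and> bdd_coeff T (gC g) \<and> bdd_player T (pl1 g) \<and> bdd_player T (pl2 g)"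

lemmas bdd_coeff_intros = bdd_coeff_add bdd_coeff_diff bdd_coeff_minus bdd_coeff_mult bdd_coeff_scaleR
  bdd_coeff_transpose bdd_coeff_hcat bdd_coeff_vcat bdd_coeff_bdiag

lemma bdd_game_blocks:
  assumes g: "bdd_game T g" and A3: "A3 T g"
  shows "bdd_coeff T (closed_A g)" "bdd_coeff T (closed_C g)" "bdd_coeff T (BB1 g)" "bdd_coeff T (BB2 g)"
    "bdd_coeff T (DD1 g)" "bdd_coeff T (DD2 g)" "bdd_coeff T (AA g)" "bdd_coeff T (CC g)"
proof -
  have p: "bdd_coeff T (pB (pl1 g))" "bdd_coeff T (pD (pl1 g))" "bdd_coeff T (pS (pl1 g))" "bdd_coeff T (pR (pl1 g))"
    "bdd_coeff T (pB (pl2 g))" "bdd_coeff T (pD (pl2 g))" "bdd_coeff T (pS (pl2 g))" "bdd_coeff T (pR (pl2 g))"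
    "bdd_coeff T (gA g)" "bdd_coeff T (gC g)"
    using g unfolding bdd_game_def bdd_player_def by auto
  have "bdd_coeff T (\<lambda>t. matrix_inv (pR (pl1 g) t))" "bdd_coeff T (\<lambda>t. matrix_inv (pR (pl2 g) t))"
    using A3 unfolding A3_def by (intro bdd_coeff_matrix_inv p unif_pos_bdd_inverse; simp)+
  note p = p this
  show "bdd_coeff T (closed_A g)" "bdd_coeff T (closed_C g)" "bdd_coeff T (BB1 g)" "bdd_coeff T (BB2 g)"
    "bdd_coeff T (DD1 g)" "bdd_coeff T (DD2 g)" "bdd_coeff T (AA g)" "bdd_coeff T (CC g)"
    unfolding closed_A_def[abs_def] closed_C_def[abs_def] BB1_def[abs_def] BB2_def[abs_def] DD1_def[abs_def]
      DD2_def[abs_def] AA_def[abs_def] CC_def[abs_def] BRS_def DRS_def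
    by (intro bdd_coeff_intros p)+
qed

context brownian_basis
begin

section \<open>Processes multiplied by bounded matrix functions\<close>

lemma bdd_coeff_LT: "bdd_coeff T f \<Longrightarrow> f \<in> borel_measurable LT"
  unfolding bdd_coeff_def using measurable_cong_sets[OF sets_LT refl, of borel] by blast

lemma joint_mv:
  fixes f :: "real \<Rightarrow> real^'m^'n"
  assumes "bdd_coeff T f" "joint \<phi>" shows "joint (\<lambda>t w. f t *v \<phi> t w)"
  by (rule joint_bilinear[OF bounded_bilinear_matrix_vector_mult bdd_coeff_LT[OF assms(1)] assms(2)])

lemma joint_minus: "joint \<phi> \<Longrightarrow> joint (\<lambda>t w. - \<phi> t w)"
  unfolding joint_def split_beta' by simp

lemma L2F_mv:
  fixes f :: "real \<Rightarrow> real^'m^'n"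
  assumes "bdd_coeff T f" "\<phi> \<in> L2F M T W" shows "(\<lambda>t w. f t *v \<phi> t w) \<in> L2F M T W"
  using assms(1) unfolding bdd_coeff_def by (intro L2F_bilinear[OF bounded_bilinear_matrix_vector_mult _ _ assms(2)]) auto

lemma ito_process_mv:
  fixes A :: "real^'m^'n"
  assumes "ito_process M T W x b \<sigma>" "joint b"
  shows "ito_process M T W (\<lambda>t w. A *v x t w) (\<lambda>t w. A *v b t w) (\<lambda>t w. A *v \<sigma> t w)"
proof -
  have z: "set_integrable lborel {0..T} (\<lambda>_. 0 :: real^'m^'n)" by (simp add: set_integrable_def)
  have "ito_process M T W (\<lambda>t w. A *v x t w) (\<lambda>t w. 0 *v x t w + A *v b t w) (\<lambda>t w. A *v \<sigma> t w)"
    by (rule ito_process_product[OF bounded_bilinear_matrix_vector_mult assms continuous_on_const z])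
       (simp add: set_lebesgue_integral_def)
  then show ?thesis by simp
qed

text \<open>The drift integral of the sum splits only on paths where both drifts are integrable, so
  the sum of the two Ito integrals is adjusted on a null set by \<open>ito_cong\<close>.\<close>

lemma ito_process_add:
  assumes x: "ito_process M T W x b \<sigma>" "joint b" and y: "ito_process M T W y c \<rho>" "joint c"
  shows "ito_process M T W (\<lambda>t w. x t w + y t w) (\<lambda>t w. b t w + c t w) (\<lambda>t w. \<sigma> t w + \<rho> t w)"
proof -
  have xL: "x \<in> L2F M T W" and xc: "AE w in M. continuous_on {0..T} (\<lambda>t. x t w)"
    and bi: "AE w in M. set_integrable lborel {0..T} (\<lambda>t. b t w)"
    and I: "has_ito_integral M T W \<sigma> (\<lambda>t w. x t w - x 0 w - (LINT s:{0..t}|lborel. b s w))"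
    using x unfolding ito_process_def by auto
  have yL: "y \<in> L2F M T W" and yc: "AE w in M. continuous_on {0..T} (\<lambda>t. y t w)"
    and ci: "AE w in M. set_integrable lborel {0..T} (\<lambda>t. c t w)"
    and J: "has_ito_integral M T W \<rho> (\<lambda>t w. y t w - y 0 w - (LINT s:{0..t}|lborel. c s w))"
    using y unfolding ito_process_def by auto
  show ?thesis
    unfolding ito_process_def
  proof (intro conjI)
    show "(\<lambda>t w. x t w + y t w) \<in> L2F M T W" by (rule L2F_add[OF xL yL])
    show "AE w in M. continuous_on {0..T} (\<lambda>t. x t w + y t w)"
      using xc yc by eventually_elim (rule continuous_on_add)
    show "AE w in M. set_integrable lborel {0..T} (\<lambda>t. b t w + c t w)"
      using bi ci by eventually_elim (rule set_integral_add)
    show "has_ito_integral M T W (\<lambda>t w. \<sigma> t w + \<rho> t w)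
      (\<lambda>t w. x t w + y t w - (x 0 w + y 0 w) - (LINT s:{0..t}|lborel. b s w + c s w))"
    proof (rule ito_cong[OF ito_add[OF I J]])
      show "(\<lambda>t w. \<sigma> t w + \<rho> t w) \<in> L2F M T W" by (rule L2F_add[OF ito_L2F[OF I] ito_L2F[OF J]])
      fix t assume t: "t \<in> {0..T}"
      show "(\<lambda>w. x t w + y t w - (x 0 w + y 0 w) - (LINT s:{0..t}|lborel. b s w + c s w)) \<in> borel_measurable M"
        using t T_pos
        by (intro borel_measurable_diff borel_measurable_add joint_rv L2F_joint[OF xL] L2F_joint[OF yL]
            joint_integral_measurable joint_add x y) auto
      show "AE w in M. x t w - x 0 w - (LINT s:{0..t}|lborel. b s w) + (y t w - y 0 w - (LINT s:{0..t}|lborel. c s w))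
        = x t w + y t w - (x 0 w + y 0 w) - (LINT s:{0..t}|lborel. b s w + c s w)"
        using bi ci
      proof eventually_elim
        case (elim w)
        have sub: "{0..t} \<subseteq> {0..T}" using t by auto
        have "(LINT s:{0..t}|lborel. b s w + c s w) = (LINT s:{0..t}|lborel. b s w) + (LINT s:{0..t}|lborel. c s w)"
          by (intro set_integral_add set_integrable_subset[OF elim(1) _ sub] set_integrable_subset[OF elim(2) _ sub]) simp_all
        then show ?case by simp
      qed
    qed simp
  qed
qed

lemma bdd_coeff_norm_mv:
  fixes f :: "real \<Rightarrow> real^'m^'n"
  assumes "bdd_coeff T f"
  obtains K where "0 \<le> K" "\<And>t v. t \<in> {0..T} \<Longrightarrow> norm (f t *v v) \<le> K * norm v"
proof -
  interpret bounded_bilinear "\<lambda>(A :: real^'m^'n) (x :: real^'m). A *v x" by (rule bounded_bilinear_matrix_vector_mult)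
  obtain C where C: "0 \<le> C" "\<And>(A :: real^'m^'n) (x :: real^'m). norm (A *v x) \<le> norm A * norm x * C"
    using nonneg_bounded by auto
  obtain L where L: "\<And>t. t \<in> {0..T} \<Longrightarrow> norm (f t) \<le> L"
    using assms unfolding bdd_coeff_def bounded_iff by blast
  have L0: "0 \<le> L" using order_trans[OF norm_ge_zero L[of 0]] T_pos by simp
  show ?thesis
  proof (rule that[of "L * C"])
    show "0 \<le> L * C" using C L0 by simp
    fix t :: real and v :: "real^'m" assume t: "t \<in> {0..T}"
    have "norm (f t *v v) \<le> norm (f t) * norm v * C" by (rule C)
    also have "\<dots> \<le> L * norm v * C" by (intro mult_right_mono L t C) simp
    finally show "norm (f t *v v) \<le> L * C * norm v" by (simp add: ac_simps)
  qed
qed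

text \<open>Formulated for an arbitrary game with bounded coefficients; of the Level 2 construction
  only \<open>bdd_level2_game\<close> has to be supplied.\<close>

theorem feedback_form:
  fixes g :: "('n::finite, 'p::finite, 'q::finite) game"
  assumes g: "bdd_game T g" and A3: "A3 T g"
    and u: "u1 \<in> L2F M T W" "u2 \<in> L2F M T W"
    and u1: "ae_equal M T u1 (open_loop_form (pl1 g) x y z)"
    and u2: "ae_equal M T u2 (open_loop_form (pl2 g) x Y Z)"
    and x: "game_state M T W g x0 u1 u2 x"
    and y: "adjoint_bsde M T W (gA g) (gC g) (pl1 g) x u1 y z"
    and Y: "adjoint_bsde M T W (gA g) (gC g) (pl2 g) x u2 Y Z"
    and Pm: "Pi_solution T g Pm"
  shows "ae_equal M T u1 (\<lambda>t w. - (matrix_inv (pR (pl1 g) t) **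
          (transpose (pS (pl1 g) t) + (transpose (pB (pl1 g) t) \<parallel>\<^sub>h 0) ** Pm t
           + (transpose (pD (pl1 g) t) \<parallel>\<^sub>h 0) ** Sigma_fb g Pm t) *v x t w))"
      (is "ae_equal M T u1 ?f1")
    and "ae_equal M T u2 (\<lambda>t w. - (matrix_inv (pR (pl2 g) t) **
          (transpose (pS (pl2 g) t) + (0 \<parallel>\<^sub>h transpose (pB (pl2 g) t)) ** Pm t
           + (0 \<parallel>\<^sub>h transpose (pD (pl2 g) t)) ** Sigma_fb g Pm t) *v x t w))"
      (is "ae_equal M T u2 ?f2")
    and "ito_process M T W x
        (\<lambda>t w. (gA g t - BRS (pl1 g) t - BRS (pl2 g) t
                 + BB1 g t ** Pm t + BB2 g t ** Sigma_fb g Pm t) *v x t w)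
        (\<lambda>t w. (gC g t - DRS (pl1 g) t - DRS (pl2 g) t
                 + DD1 g t ** Pm t + DD2 g t ** Sigma_fb g Pm t) *v x t w)"
      (is "ito_process M T W x ?b ?s")
proof -
  define bx where "bx = (\<lambda>t w. gA g t *v x t w + pB (pl1 g) t *v u1 t w + pB (pl2 g) t *v u2 t w)"
  define sx where "sx = (\<lambda>t w. gC g t *v x t w + pD (pl1 g) t *v u1 t w + pD (pl2 g) t *v u2 t w)"
  define cy where "cy = (\<lambda>t w. - (transpose (gA g t) *v y t w + transpose (gC g t) *v z t w + pQ (pl1 g) t *v x t w + pS (pl1 g) t *v u1 t w))"
  define cY where "cY = (\<lambda>t w. - (transpose (gA g t) *v Y t w + transpose (gC g t) *v Z t w + pQ (pl2 g) t *v x t w + pS (pl2 g) t *v u2 t w))"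
  have ix: "ito_process M T W x bx sx" and iy: "ito_process M T W y cy z" and iY: "ito_process M T W Y cY Z"
    and yT: "AE w in M. y T w = pG (pl1 g) *v x T w" and YT: "AE w in M. Y T w = pG (pl2 g) *v x T w"
    using x y Y unfolding game_state_def adjoint_bsde_def bx_def sx_def cy_def cY_def by auto
  have xL: "x \<in> L2F M T W" and yL: "y \<in> L2F M T W" and zL: "z \<in> L2F M T W" and YL: "Y \<in> L2F M T W" and ZL: "Z \<in> L2F M T W"
    using ix iy iY unfolding ito_process_def has_ito_integral_def by auto
  note L = xL yL zL YL ZL u
  note J = L[THEN L2F_joint]
  have bg: "bdd_coeff T (gA g)" "bdd_coeff T (gC g)"
    "bdd_coeff T (pB (pl1 g))" "bdd_coeff T (pD (pl1 g))" "bdd_coeff T (pQ (pl1 g))" "bdd_coeff T (pS (pl1 g))"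
    "bdd_coeff T (pB (pl2 g))" "bdd_coeff T (pD (pl2 g))" "bdd_coeff T (pQ (pl2 g))" "bdd_coeff T (pS (pl2 g))"
    using g unfolding bdd_game_def bdd_player_def by auto
  note bb = bdd_game_blocks[OF g A3]
  have Pode: "terminal_ode T (GG g) (Pi_rhs g Pm) Pm" and Pinv: "bdd_inverse T (\<lambda>t. mat 1 - Pm t ** DD2 g t)"
    using Pm unfolding Pi_solution_def by auto
  have Pc: "continuous_on {0..T} Pm" and Pi: "set_integrable lborel {0..T} (Pi_rhs g Pm)"
    using Pode unfolding terminal_ode_def by auto
  have PT: "Pm T = GG g"
    using Pode T_pos set_integral_Icc_self[of T "Pi_rhs g Pm"] unfolding terminal_ode_def by simp
  have bP: "bdd_coeff T Pm" by (rule bdd_coeff_continuous[OF Pc])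
  define H where "H t = matrix_inv (mat 1 - Pm t ** DD2 g t)" for t
  have bH: "bdd_coeff T H"
    unfolding H_def[abs_def] by (intro bdd_coeff_matrix_inv Pinv bdd_coeff_intros bdd_coeff_const bP bb)
  have HI: "H t ** (mat 1 - Pm t ** DD2 g t) = mat 1" if "t \<in> {0..T}" for t
    using Pinv that unfolding H_def bdd_inverse_def by (intro matrix_inv_inverts) blast
  have Seq: "Sigma_fb g Pm t = H t ** (Pm t ** closed_C g t + Pm t ** DD1 g t ** Pm t)" for t
    unfolding H_def by (rule Sigma_fb_eq)
  have bS: "bdd_coeff T (Sigma_fb g Pm)"
    unfolding Seq[abs_def] by (intro bdd_coeff_intros bH bP bb)
  have jx: "joint bx" "joint sx" and jy: "joint cy" and jY: "joint cY"
    unfolding bx_def sx_def cy_def cY_def by (intro joint_minus joint_add joint_mv bdd_coeff_transpose bg J)+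
  \<comment> \<open>Written with - Pm as a factor, so that the product rule applies directly with
    derivative \<open>Pi_rhs\<close> and the three parts are simply added.\<close>
  define \<delta> where "\<delta> = (\<lambda>t w. (blk1 *v y t w + blk2 *v Y t w) + (- Pm t) *v x t w)"
  define b where "b = (\<lambda>t w. (blk1 *v cy t w + blk2 *v cY t w) + (Pi_rhs g Pm t *v x t w + (- Pm t) *v bx t w))"
  define \<zeta> where "\<zeta> = (\<lambda>t w. (blk1 *v z t w + blk2 *v Z t w) + (- Pm t) *v sx t w)"
  have PLT: "Pi_rhs g Pm \<in> borel_measurable LT"
    using Pi unfolding set_integrable_def by (simp add: borel_measurable_restrict_space_iff)
  have jpx: "joint (\<lambda>t w. Pi_rhs g Pm t *v x t w + (- Pm t) *v bx t w)"
    by (intro joint_add joint_mv bdd_coeff_minus bP jx joint_bilinear[OF bounded_bilinear_matrix_vector_mult PLT] J)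
  have jyY: "joint (\<lambda>t w. blk1 *v cy t w + blk2 *v cY t w)" and jyY1: "joint (\<lambda>t w. blk1 *v cy t w)" "joint (\<lambda>t w. blk2 *v cY t w)"
    by (intro joint_add joint_mv bdd_coeff_const jy jY)+
  have i\<delta>: "ito_process M T W \<delta> b \<zeta>"
    unfolding \<delta>_def b_def \<zeta>_def
  proof (intro ito_process_add ito_process_mv iy iY jy jY jpx jyY jyY1)
    show "ito_process M T W (\<lambda>t w. (- Pm t) *v x t w)
        (\<lambda>t w. Pi_rhs g Pm t *v x t w + (- Pm t) *v bx t w) (\<lambda>t w. (- Pm t) *v sx t w)"
      by (rule ito_process_product[OF bounded_bilinear_matrix_vector_mult ix jx(1) continuous_on_minus[OF Pc] Pi])
         (rule terminal_ode_forward[OF Pode less_imp_le[OF T_pos]])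
  qed
  have jb: "joint b" unfolding b_def by (intro joint_add jyY jpx)
  have \<delta>L: "\<delta> \<in> L2F M T W" and \<zeta>L: "\<zeta> \<in> L2F M T W"
    using i\<delta> unfolding ito_process_def has_ito_integral_def by auto
  \<comment> \<open>M1 and M2 are the coefficients of \<delta> and \<zeta> in the second part of
    \<open>decoupling_identity\<close>.\<close>
  define M1 where "M1 t = transpose (AA g t) + Pm t ** BB1 g t + (transpose (CC g t) + Pm t ** BB2 g t) ** H t ** (Pm t ** DD1 g t)" for t
  define M2 where "M2 t = (transpose (CC g t) + Pm t ** BB2 g t) ** H t" for t
  have bM: "bdd_coeff T M1" "bdd_coeff T M2"
    unfolding M1_def[abs_def] M2_def[abs_def] by (intro bdd_coeff_intros bH bP bb)+
  \<comment> \<open>b is the drift as the sum and product rules deliver it, still expressed through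
    x and the controls. b' agrees with it wherever the controls have the open-loop form, and it has
    the linear bound that \<open>bsde_zero\<close> needs.\<close>
  define b' where "b' = (\<lambda>t w. - (M1 t *v \<delta> t w + M2 t *v \<zeta> t w))"
  have jb': "joint b'" unfolding b'_def by (intro joint_minus joint_add joint_mv bM L2F_joint \<delta>L \<zeta>L)
  have ut: "AE (t, w) in LT \<Otimes>\<^sub>M M. t \<in> {0..T} \<and>
      u1 t w = open_loop_form (pl1 g) x y z t w \<and> u2 t w = open_loop_form (pl2 g) x Y Z t w"
  proof -
    have sp: "AE p in LT \<Otimes>\<^sub>M M. fst p \<in> {0..T}"
      using AE_space by eventually_elim (auto simp: space_pair_measure space_LT)
    show ?thesis
      using sp u1[unfolded ae_equal_def] u2[unfolded ae_equal_def]
      by eventually_elim auto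
  qed
  have alg: "bx t w = closed_A g t *v x t w + BB1 g t *v (blk1 *v y t w + blk2 *v Y t w) + BB2 g t *v (blk1 *v z t w + blk2 *v Z t w)"
      "sx t w = closed_C g t *v x t w + DD1 g t *v (blk1 *v y t w + blk2 *v Y t w) + DD2 g t *v (blk1 *v z t w + blk2 *v Z t w)"
      "b t w = b' t w"
      "blk1 *v z t w + blk2 *v Z t w = Sigma_fb g Pm t *v x t w + H t *v (\<zeta> t w + (Pm t ** DD1 g t) *v \<delta> t w)"
    if t: "t \<in> {0..T}" and v: "u1 t w = open_loop_form (pl1 g) x y z t w" "u2 t w = open_loop_form (pl2 g) x Y Z t w" for t w
  proof -
    note v = v[unfolded open_loop_form_def]
    show 1: "bx t w = closed_A g t *v x t w + BB1 g t *v (blk1 *v y t w + blk2 *v Y t w) + BB2 g t *v (blk1 *v z t w + blk2 *v Z t w)"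
      unfolding bx_def by (rule forward_coefficients(1)[OF v])
    show 2: "sx t w = closed_C g t *v x t w + DD1 g t *v (blk1 *v y t w + blk2 *v Y t w) + DD2 g t *v (blk1 *v z t w + blk2 *v Z t w)"
      unfolding sx_def by (rule forward_coefficients(2)[OF v])
    have sy: "transpose (matrix_inv (pR (pl1 g) t)) = matrix_inv (pR (pl1 g) t)" "transpose (matrix_inv (pR (pl2 g) t)) = matrix_inv (pR (pl2 g) t)"
      using A3 t unfolding A3_def by (auto intro: unif_pos_inv_symmetric)
    have 3: "blk1 *v cy t w + blk2 *v cY t w = - (transpose (AA g t) *v (blk1 *v y t w + blk2 *v Y t w)
        + transpose (CC g t) *v (blk1 *v z t w + blk2 *v Z t w) + QQ g t *v x t w)"
      unfolding backward_coefficients[OF v sy, symmetric] cy_def cY_def matrix_vector_minus(2) by (rule minus_add_distrib[symmetric])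
    have d: "\<delta> t w = (blk1 *v y t w + blk2 *v Y t w) - Pm t *v x t w" by (simp add: \<delta>_def matrix_vector_minus)
    have e: "\<zeta> t w = (blk1 *v z t w + blk2 *v Z t w) - Pm t *v (closed_C g t *v x t w
        + DD1 g t *v (blk1 *v y t w + blk2 *v Y t w) + DD2 g t *v (blk1 *v z t w + blk2 *v Z t w))"
      unfolding \<zeta>_def 2 by (simp add: matrix_vector_minus)
    note id = decoupling_identity[OF HI[OF t] d e Seq]
    show "blk1 *v z t w + blk2 *v Z t w = Sigma_fb g Pm t *v x t w + H t *v (\<zeta> t w + (Pm t ** DD1 g t) *v \<delta> t w)"
      by (rule id(1))
    show "b t w = b' t w"
      unfolding b_def b'_def 3 Pi_rhs_eq M1_def M2_def 1 matrix_vector_minus(1) add_uminus_conv_diff by (rule id(2))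
  qed
  have i\<delta>': "ito_process M T W \<delta> b' \<zeta>"
  proof (rule ito_process_cong[OF i\<delta> jb jb' \<zeta>L])
    show "AE (t, w) in LT \<Otimes>\<^sub>M M. b t w = b' t w"
      using ut by eventually_elim (use alg(3) in auto)
  qed simp
  \<comment> \<open>The two terminal conditions stack to X(T) = \<open>GG g\<close> x(T), and
    \<open>GG g\<close> is the terminal value of \<Pi>.\<close>
  have \<delta>T: "AE w in M. \<delta> T w = 0"
    using yT YT by eventually_elim (simp add: \<delta>_def PT GG_def vcat_blk matrix_vector_minus)
  obtain K1 where K1: "0 \<le> K1" "\<And>t v. t \<in> {0..T} \<Longrightarrow> norm (M1 t *v v) \<le> K1 * norm v"
    using bdd_coeff_norm_mv[OF bM(1)] by blast
  obtain K2 where K2: "0 \<le> K2" "\<And>t v. t \<in> {0..T} \<Longrightarrow> norm (M2 t *v v) \<le> K2 * norm v"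
    using bdd_coeff_norm_mv[OF bM(2)] by blast
  have bnd: "norm (b' t w) \<le> (K1 + K2) * (norm (\<delta> t w) + norm (\<zeta> t w))" if t: "t \<in> {0..T}" for t w
  proof -
    have "norm (b' t w) \<le> K1 * norm (\<delta> t w) + K2 * norm (\<zeta> t w)"
      unfolding b'_def norm_minus_cancel by (intro norm_triangle_le add_mono K1 K2 t)
    also have "\<dots> \<le> (K1 + K2) * (norm (\<delta> t w) + norm (\<zeta> t w))"
      using K1(1) K2(1) by (simp add: algebra_simps)
    finally show ?thesis .
  qed
  have zero: "AE (t, w) in LT \<Otimes>\<^sub>M M. \<delta> t w = 0" "AE (t, w) in LT \<Otimes>\<^sub>M M. \<zeta> t w = 0"
    using bsde_zero[OF i\<delta>' jb' \<delta>T _ bnd] K1(1) K2(1) by auto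
  \<comment> \<open>Setting \<delta> = 0 gives the first identity; then \<zeta> = 0 as well reduces
    \<open>alg(4)\<close> to the second.\<close>
  have rep: "AE (t, w) in LT \<Otimes>\<^sub>M M. blk1 *v y t w + blk2 *v Y t w = Pm t *v x t w \<and>
      blk1 *v z t w + blk2 *v Z t w = Sigma_fb g Pm t *v x t w \<and>
      u1 t w = open_loop_form (pl1 g) x y z t w \<and> u2 t w = open_loop_form (pl2 g) x Y Z t w \<and> t \<in> {0..T}"
    using zero ut
  proof eventually_elim
    case (elim p)
    obtain t w where p: "p = (t, w)" by (cases p)
    have e: "\<delta> t w = 0" "\<zeta> t w = 0" "t \<in> {0..T}" "u1 t w = open_loop_form (pl1 g) x y z t w"
        "u2 t w = open_loop_form (pl2 g) x Y Z t w" using elim unfolding p by auto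
    show ?case unfolding p
      using e alg(4)[OF e(3-5)] by (simp add: \<delta>_def matrix_vector_minus)
  qed
  show "ae_equal M T u1 ?f1"
    unfolding ae_equal_def using rep
  proof eventually_elim
    case (elim p)
    obtain t w where p: "p = (t, w)" by (cases p)
    have e: "Pm t *v x t w = blk1 *v y t w + blk2 *v Y t w" "Sigma_fb g Pm t *v x t w = blk1 *v z t w + blk2 *v Z t w"
        "u1 t w = open_loop_form (pl1 g) x y z t w" using elim unfolding p by simp_all
    show ?case
      unfolding p case_prod_conv e(3) open_loop_form_def matrix_vector_mul_assoc[symmetric] matrix_vector_mult_add_rdistrib
        e(1,2) matrix_vector_right_distrib hcat_blk by simp
  qed
  show "ae_equal M T u2 ?f2"
    unfolding ae_equal_def using rep
  proof eventually_elim
    case (elim p)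
    obtain t w where p: "p = (t, w)" by (cases p)
    have e: "Pm t *v x t w = blk1 *v y t w + blk2 *v Y t w" "Sigma_fb g Pm t *v x t w = blk1 *v z t w + blk2 *v Z t w"
        "u2 t w = open_loop_form (pl2 g) x Y Z t w" using elim unfolding p by simp_all
    show ?case
      unfolding p case_prod_conv e(3) open_loop_form_def matrix_vector_mul_assoc[symmetric] matrix_vector_mult_add_rdistrib
        e(1,2) matrix_vector_right_distrib hcat_blk by simp
  qed
  have bcl: "bdd_coeff T (\<lambda>t. gA g t - BRS (pl1 g) t - BRS (pl2 g) t + BB1 g t ** Pm t + BB2 g t ** Sigma_fb g Pm t)"
      "bdd_coeff T (\<lambda>t. gC g t - DRS (pl1 g) t - DRS (pl2 g) t + DD1 g t ** Pm t + DD2 g t ** Sigma_fb g Pm t)"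
    unfolding closed_A_def[symmetric] closed_C_def[symmetric] by (intro bdd_coeff_intros bb bP bS)+
  show "ito_process M T W x ?b ?s"
  proof (rule ito_process_cong[OF ix jx(1)])
    show "joint ?b"
      by (intro joint_mv bcl J)
    show "?s \<in> L2F M T W"
      by (intro L2F_mv bcl L)
    show "AE (t, w) in LT \<Otimes>\<^sub>M M. bx t w = ?b t w"
      using rep
    proof eventually_elim
      case (elim p)
      obtain t w where p: "p = (t, w)" by (cases p)
      show ?case
        using elim alg(1)[of t w] unfolding p closed_A_def[symmetric]
        by (simp add: matrix_vector_mul_assoc[symmetric] matrix_vector_mult_add_rdistrib)
    qed
    show "AE (t, w) in LT \<Otimes>\<^sub>M M. sx t w = ?s t w"
      using rep
    proof eventually_elim
      case (elim p)
      obtain t w where p: "p = (t, w)" by (cases p)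
      show ?case
        using elim alg(2)[of t w] unfolding p closed_C_def[symmetric]
        by (simp add: matrix_vector_mul_assoc[symmetric] matrix_vector_mult_add_rdistrib)
    qed
  qed
qed

end

section \<open>Boundedness of the Level 2 coefficients\<close>

lemma bdd_coeff_unif_pos_inv: "bdd_coeff T f \<Longrightarrow> unif_pos T f \<Longrightarrow> bdd_coeff T (\<lambda>t. matrix_inv (f t))"
  for f :: "real \<Rightarrow> real^'n^'n"
  by (intro bdd_coeff_matrix_inv unif_pos_bdd_inverse)

lemma bdd_channelsD:
  assumes "bdd_channels T c"
  shows "bdd_coeff T (cB1 c)" "bdd_coeff T (cB21 c)" "bdd_coeff T (cB22 c)" "bdd_coeff T (cB23 c)"
    "bdd_coeff T (cB31 c)" "bdd_coeff T (cB32 c)" "bdd_coeff T (cB33 c)" "bdd_coeff T (cD1 c)"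
    "bdd_coeff T (cD21 c)" "bdd_coeff T (cD22 c)" "bdd_coeff T (cD23 c)" "bdd_coeff T (cD31 c)"
    "bdd_coeff T (cD32 c)" "bdd_coeff T (cD33 c)" "bdd_coeff T (cR c)" "bdd_coeff T (cR11 c)"
    "bdd_coeff T (cR12 c)" "bdd_coeff T (cR13 c)" "bdd_coeff T (cRb11 c)" "bdd_coeff T (cRb12 c)"
    "bdd_coeff T (cRb13 c)"
  using assms unfolding bdd_channels_def by blast+

lemma A2_channelsD:
  assumes "A2_channels T c"
  shows "unif_pos T (cR c)" "unif_pos T (cR11 c)" "unif_pos T (cR12 c)" "unif_pos T (cR13 c)"
    "unif_pos T (cRb11 c)" "unif_pos T (cRb12 c)" "unif_pos T (cRb13 c)"
  using assms unfolding A2_channels_def by blast+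

lemma bdd_weights2D:
  assumes "bdd_weights2 T w"
  shows "bdd_coeff T (wQ w)" "bdd_coeff T (wR w)" "bdd_coeff T (wR21 w)" "bdd_coeff T (wR22 w)"
    "bdd_coeff T (wR23 w)" "bdd_coeff T (wRb21 w)" "bdd_coeff T (wRb22 w)" "bdd_coeff T (wRb23 w)"
  using assms unfolding bdd_weights2_def by blast+

lemma continuous_gains_bdd:
  assumes "continuous_gains T h"
  shows "bdd_coeff T (eta1 h)" "bdd_coeff T (eta2 h)" "bdd_coeff T (eta3 h)"
    "bdd_coeff T (zeta1 h)" "bdd_coeff T (zeta2 h)" "bdd_coeff T (zeta3 h)"
  using assms unfolding continuous_gains_def by (blast intro: bdd_coeff_continuous)+

lemma bdd_coeff_gainK:
  assumes "bdd_coeff T R" "unif_pos T R" "bdd_coeff T B" "bdd_coeff T D" "bdd_coeff T P" "bdd_coeff T L"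
  shows "bdd_coeff T (\<lambda>t. gainK (R t) (B t) (D t) (P t) (L t))"
  unfolding gainK_def by (intro bdd_coeff_intros bdd_coeff_unif_pos_inv assms)

lemma bdd_coeff_xi:
  assumes c: "bdd_channels T c" "A2_channels T c" and h: "continuous_gains T h"
    and P: "bdd_coeff T P" and L: "bdd_coeff T L"
  shows "bdd_coeff T (\<lambda>t. xi c h (P t) (L t) t)"
  unfolding xi_def Let_def xi_term_def
  by (intro bdd_coeff_intros bdd_coeff_gainK bdd_channelsD[OF c(1)] A2_channelsD[OF c(2)]
      continuous_gains_bdd[OF h] P L)

lemma bdd_coeff_NN: "continuous_gains T h \<Longrightarrow> bdd_coeff T (NN h)"
  unfolding NN_def[abs_def] by (intro bdd_coeff_intros continuous_gains_bdd)

text \<open>P is bounded by continuity, the inverse of \<open>Rc\<close> by uniform positivity of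
  its blocks, and the inverse of \<open>riccati_den\<close> by the notion of solution; \<Lambda> is
  a product of such factors.\<close>

lemma bdd_coeff_Lam:
  assumes s: "bdd_system T s" and c: "bdd_channels T c" "A2_channels T c" and d: "bdd_channels T d" "A2_channels T d"
    and P: "riccati_solution T s c d \<gamma> P"
  shows "bdd_coeff T P" "bdd_coeff T (Lam s c d P)"
proof -
  have den: "bdd_inverse T (riccati_den c d P)" and Pc: "continuous_on {0..T} P"
    using P unfolding riccati_solution_def terminal_ode_def by auto
  have sC: "bdd_coeff T (sC s)" using s unfolding bdd_system_def by blast
  show bP: "bdd_coeff T P" by (rule bdd_coeff_continuous[OF Pc])
  note b = bdd_channelsD[OF c(1)] bdd_channelsD[OF d(1)]
  have bB: "bdd_coeff T (Bc c d)" and bD: "bdd_coeff T (Dc c d)" and bR: "bdd_coeff T (Rc c d)"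
    unfolding Bc_def[abs_def] Dc_def[abs_def] Rc_def[abs_def] by (intro bdd_coeff_intros b)+
  have "bdd_inverse T (Rc c d)"
    unfolding Rc_def[abs_def] by (intro bdd_inverse_bdiag unif_pos_bdd_inverse A2_channelsD[OF c(2)] A2_channelsD[OF d(2)])
  then have Ri: "bdd_coeff T (\<lambda>t. matrix_inv (Rc c d t))" by (rule bdd_coeff_matrix_inv[OF bR])
  have bden: "bdd_coeff T (riccati_den c d P)"
    unfolding riccati_den_def[abs_def] by (intro bdd_coeff_intros bdd_coeff_const bP bD Ri)
  have bC: "bdd_coeff T (riccati_C s c d P)"
    unfolding riccati_C_def[abs_def] by (intro bdd_coeff_intros bP bD bB Ri sC)
  show "bdd_coeff T (Lam s c d P)"
    unfolding Lam_def[abs_def] by (intro bdd_coeff_intros bdd_coeff_matrix_inv bden den bP bC)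
qed

lemma bdd_level2_player:
  assumes c: "bdd_channels T c" "A2_channels T c" and w: "bdd_weights2 T w" and h: "continuous_gains T h"
    and P: "bdd_coeff T P" and L: "bdd_coeff T L"
  shows "bdd_player T (level2_player c w h P L)"
  unfolding bdd_player_def level2_player_def player.simps
  by (intro conjI bdd_coeff_intros bdd_coeff_xi[OF c h P L] bdd_coeff_NN[OF h] bdd_channelsD[OF c(1)] bdd_weights2D[OF w])

lemma bdd_level2_game:
  assumes s: "bdd_system T s" and c: "bdd_channels T c" "A2_channels T c" and d: "bdd_channels T d" "A2_channels T d"
    and P: "riccati_solution T s c d \<gamma> P" and w: "bdd_weights2 T w1" "bdd_weights2 T w2"
    and h: "continuous_gains T h1" "continuous_gains T h2"
  shows "bdd_game T (level2_game s c d w1 w2 h1 h2 \<gamma> P)"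
proof -
  note p = bdd_coeff_Lam[OF s c d P]
  have sb: "bdd_coeff T (sA s)" "bdd_coeff T (sC s)" "bdd_coeff T (sE s)" using s unfolding bdd_system_def by blast+
  show ?thesis
    unfolding bdd_game_def level2_game_def game.simps
    by (intro conjI bdd_coeff_intros bdd_level2_player[OF c w(1) h(1) p] bdd_level2_player[OF d w(2) h(2) p]
        bdd_coeff_xi[OF c h(1) p] bdd_coeff_xi[OF d h(2) p] bdd_channelsD[OF c(1)] bdd_channelsD[OF d(1)] sb p(1))
qed

theorem proposition3p4:
  fixes T :: real
    and s :: "('n::finite, 'v::finite) system"
    and c1 :: "('n, 'a1::finite, 'b11::finite, 'b12::finite, 'b13::finite,
                'c11::finite, 'c21::finite, 'c31::finite) channels"
    and c2 :: "('n, 'a2::finite, 'b21::finite, 'b22::finite, 'b23::finite,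
                'c12::finite, 'c22::finite, 'c32::finite) channels"
  assumes "T > 0"
    and "bdd_system T s" and "bdd_channels T c1" and "bdd_channels T c2"
    and "A1_system T s" and "A2_channels T c1" and "A2_channels T c2"
  shows "\<exists>\<gamma>\<^sub>0>0. \<forall>\<gamma>\<ge>\<gamma>\<^sub>0. \<forall>P :: real \<Rightarrow> real^'n^'n.
    riccati_solution T s c1 c2 \<gamma> P \<longrightarrow>
    (\<forall>(w1 :: ('n, 'a1, 'b11, 'b12, 'b13, 'c11, 'c21, 'c31) weights2)
      (w2 :: ('n, 'a2, 'b21, 'b22, 'b23, 'c12, 'c22, 'c32) weights2)
      (h1 :: ('a1, 'b11, 'b12, 'b13, 'c11, 'c21, 'c31) gains)
      (h2 :: ('a2, 'b21, 'b22, 'b23, 'c12, 'c22, 'c32) gains)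
      g (M :: 'w measure) W x0 u1 u2 x y z Y Z Pm.
      bdd_weights2 T w1 \<longrightarrow> bdd_weights2 T w2 \<longrightarrow>
      A1_weights2 T w1 \<longrightarrow> A1_weights2 T w2 \<longrightarrow>
      A2_weights2 T w1 \<longrightarrow> A2_weights2 T w2 \<longrightarrow>
      continuous_gains T h1 \<longrightarrow> continuous_gains T h2 \<longrightarrow>
      g = level2_game s c1 c2 w1 w2 h1 h2 \<gamma> P \<longrightarrow>
      stochastic_basis M T W \<longrightarrow>
      A3 T g \<longrightarrow> A4 M T W g \<longrightarrow>
      nash_equilibrium M T W g x0 u1 u2 \<longrightarrow>
      ae_equal M T u1 (open_loop_form (pl1 g) x y z) \<longrightarrow>
      ae_equal M T u2 (open_loop_form (pl2 g) x Y Z) \<longrightarrow>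
      game_state M T W g x0 u1 u2 x \<longrightarrow>
      adjoint_bsde M T W (gA g) (gC g) (pl1 g) x u1 y z \<longrightarrow>
      adjoint_bsde M T W (gA g) (gC g) (pl2 g) x u2 Y Z \<longrightarrow>
      Pi_solution T g Pm \<longrightarrow>
      ae_equal M T u1 (\<lambda>t \<omega>. - (matrix_inv (pR (pl1 g) t) **
          (transpose (pS (pl1 g) t) + (transpose (pB (pl1 g) t) \<parallel>\<^sub>h 0) ** Pm t
           + (transpose (pD (pl1 g) t) \<parallel>\<^sub>h 0) ** Sigma_fb g Pm t) *v x t \<omega>)) \<and>
      ae_equal M T u2 (\<lambda>t \<omega>. - (matrix_inv (pR (pl2 g) t) **
          (transpose (pS (pl2 g) t) + (0 \<parallel>\<^sub>h transpose (pB (pl2 g) t)) ** Pm t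
           + (0 \<parallel>\<^sub>h transpose (pD (pl2 g) t)) ** Sigma_fb g Pm t) *v x t \<omega>)) \<and>
      ito_process M T W x
        (\<lambda>t \<omega>. (gA g t - BRS (pl1 g) t - BRS (pl2 g) t
                 + BB1 g t ** Pm t + BB2 g t ** Sigma_fb g Pm t) *v x t \<omega>)
        (\<lambda>t \<omega>. (gC g t - DRS (pl1 g) t - DRS (pl2 g) t
                 + DD1 g t ** Pm t + DD2 g t ** Sigma_fb g Pm t) *v x t \<omega>) \<and>
      (AE \<omega> in M. x 0 \<omega> = x0))"

proof (rule exI[of _ "1::real"], rule conjI[OF zero_less_one], intro allI impI, goal_cases)
  \<comment> \<open>The threshold 1 only has to be positive: for each \<gamma> the solution P and
    the bounded inverse of \<open>riccati_den\<close> are supplied by the premise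
    \<open>riccati_solution\<close>, and \<gamma> enters the game as a fixed scalar factor.\<close>
  case (1 \<gamma> P w1 w2 h1 h2 g M W x0 u1 u2 x y z Y Z Pm)
  have g: "bdd_game T g"
    unfolding 1(11) by (rule bdd_level2_game[OF assms(2) assms(3,6) assms(4,7) 1(2) 1(3,4) 1(9,10)])
  have basis: "prob_space M" "brownian_motion M T W" using 1(12) unfolding stochastic_basis_def by simp_all
  interpret brownian_basis M T W
    unfolding brownian_basis_def brownian_basis_axioms_def using basis assms(1) by simp
  have u: "u1 \<in> L2F M T W" "u2 \<in> L2F M T W" using 1(15) unfolding nash_equilibrium_def by simp_all
  have x0: "AE \<omega> in M. x 0 \<omega> = x0" using 1(18) unfolding game_state_def by simp
  note form = feedback_form[OF g 1(13) u 1(16-21)]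
  show ?case by (intro conjI form x0)
qed

end
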